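(* Let $\xi_0,\xi_1,\xi_2,\dots$ be i.i.d. centered complex random variables with $\mathbb{E}|\xi_0|^2=1$ and $\mathbb{E}|\xi_0|^{2+\delta'}<\infty$ for some $\delta'>0$. For $n\in\mathbb{N}$ consider the Weyl polynomial $$f_n^W(z)=\sum_{k=0}^n\sqrt{\frac{n^k}{k!}}\;\xi_k z^k$$ and let $\mu_n^W=\frac1n\sum_{\lambda:\,f_n^W(\lambda)=0}\delta_\lambda$ be the empirical measure of its zeros, counted with multiplicity. If $\mathbb{E}|1/\xi_0|^{\delta}<\infty$ for some $\delta>0$, then for every $\epsilon,Q>0$ and all sufficiently large $n$, $$\mathbb{P}\bigl(D(\mu_n^W,\mu_\infty)\le n^{-1/2+\epsilon}\bigr)\ge 1-n^{-Q}.$$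
   Context: $B_R(z_0)=\{z\in\mathbb{C}:|z-z_0|<R\}$. For measures $\mu,\nu$ on $\mathbb{C}$, $D(\mu,\nu)=\sup_{z_0\in\mathbb{C},R>0}|\mu(B_R(z_0))-\nu(B_R(z_0))|$. $\mu_\infty$ is the uniform distribution on the unit disc, with density $\frac1\pi\mathbf{1}_{B_1(0)}$. By convention $|1/0|^\delta=\infty$, so the hypothesis forces $\mathbb{P}(\xi_0=0)=0$. *)

theory Defs
  imports "HOL-Probability.Probability" "HOL-Computational_Algebra.Polynomial"
begin

definition weyl_poly :: "nat \<Rightarrow> (nat \<Rightarrow> complex) \<Rightarrow> complex poly" where
  "weyl_poly n a = (\<Sum>k\<le>n. monom (complex_of_real (sqrt (real n ^ k / fact k)) * a k) k)"

lemma poly_weyl_poly: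
  "poly (weyl_poly n a) z = (\<Sum>k\<le>n. complex_of_real (sqrt (real n ^ k / fact k)) * a k * z ^ k)"
  by (simp add: weyl_poly_def poly_sum poly_monom)

(* The mass is normalised by n, not by the degree of p. For p = 0 the sum ranges over an
   infinite set, so that the result is the null measure. *)
definition zeros_measure :: "nat \<Rightarrow> complex poly \<Rightarrow> complex measure" where
  "zeros_measure n p = measure_of UNIV (sets borel)
     (\<lambda>A. ennreal (1 / real n) * (\<Sum>w | poly p w = 0. of_nat (order w p) * indicator A w))"

lemma sets_zeros_measure [simp, measurable_cong]: "sets (zeros_measure n p) = sets borel"
  and space_zeros_measure [simp]: "space (zeros_measure n p) = UNIV"
  using sets.sigma_sets_eq[of "borel :: complex measure"]
  by (simp_all add: zeros_measure_def)

lemma emeasure_zeros_measure: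
  assumes A: "A \<in> sets borel"
  shows "emeasure (zeros_measure n p) A =
    ennreal (1 / real n) * (\<Sum>w | poly p w = 0. of_nat (order w p) * indicator A w)"
proof (rule emeasure_measure_of[OF zeros_measure_def[of n p]])
  show "countably_additive (sets (zeros_measure n p))
    (\<lambda>A. ennreal (1 / real n) * (\<Sum>w | poly p w = 0. of_nat (order w p) * indicator A w))"
  proof (rule countably_additiveI)
    fix F :: "nat \<Rightarrow> complex set"
    assume "disjoint_family F"
    then have "(\<Sum>i. indicator (F i) x :: ennreal) = indicator (\<Union>i. F i) x" for x
      by (rule suminf_indicator)
    then show "(\<Sum>i. ennreal (1 / real n) *
          (\<Sum>w | poly p w = 0. of_nat (order w p) * indicator (F i) w)) =
        ennreal (1 / real n) *
          (\<Sum>w | poly p w = 0. of_nat (order w p) * indicator (\<Union>i. F i) w)"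
      by (simp add: suminf_sum ennreal_suminf_cmult)
  qed
qed (use A in \<open>auto simp: positive_def\<close>)

lemma finite_measure_zeros_measure: "finite_measure (zeros_measure n p)"
  by (rule finite_measureI)
    (simp add: emeasure_zeros_measure ennreal_mult_eq_top_iff of_nat_less_top
      flip: of_nat_sum)

definition uniform_disc :: "complex measure" where
  "uniform_disc = uniform_measure lborel (ball 0 1)"

lemma emeasure_lborel_unit_disc: "emeasure lborel (ball 0 1 :: complex set) = ennreal pi"
  by (simp add: emeasure_ball unit_ball_vol_2)

lemma uniform_disc_eq_density:
  "uniform_disc = density lborel (\<lambda>z. ennreal (1 / pi * indicator (ball 0 1) z))"
  unfolding uniform_disc_def uniform_measure_def emeasure_lborel_unit_disc
  by (intro density_cong)
    (auto simp: indicator_def divide_ennreal ennreal_1[symmetric] simp del: ennreal_1)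

lemma prob_space_uniform_disc: "prob_space uniform_disc"
  unfolding uniform_disc_def
  by (rule prob_space_uniform_measure) (simp_all add: emeasure_lborel_unit_disc)

(* Meant for finite measures, for which the supremum is taken over a bounded set. *)
definition disc_discrepancy :: "complex measure \<Rightarrow> complex measure \<Rightarrow> real" where
  "disc_discrepancy \<mu> \<nu> =
     (SUP (z, R) \<in> UNIV \<times> {0<..}. \<bar>measure \<mu> (ball z R) - measure \<nu> (ball z R)\<bar>)"

lemma bdd_above_disc_discrepancy:
  assumes "finite_measure \<mu>" "finite_measure \<nu>"
  shows "bdd_above ((\<lambda>(z :: complex, R). \<bar>measure \<mu> (ball z R) - measure \<nu> (ball z R)\<bar>)
           ` (UNIV \<times> {0<..}))"
proof (rule bdd_aboveI2)
  fix x :: "complex \<times> real"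
  have "measure \<mu> A \<le> measure \<mu> (space \<mu>)" "measure \<nu> A \<le> measure \<nu> (space \<nu>)" for A
    using assms by (auto intro: finite_measure.bounded_measure)
  moreover have "\<bar>a - b\<bar> \<le> c + d" if "0 \<le> a" "a \<le> c" "0 \<le> b" "b \<le> d" for a b c d :: real
    using that by linarith
  ultimately show "(case x of (z, R) \<Rightarrow> \<bar>measure \<mu> (ball z R) - measure \<nu> (ball z R)\<bar>)
      \<le> measure \<mu> (space \<mu>) + measure \<nu> (space \<nu>)"
    by (cases x) simp
qed

end

theory Submission
  imports Defs "HOL-Complex_Analysis.Cauchy_Integral_Formula"
    "HOL-Computational_Algebra.Fundamental_Theorem_Algebra" "HOL-Real_Asymp.Real_Asymp"
begin

text \<open>Write \<open>V\<close> for \<open>disc_potential\<close>, that is \<open>|z|\<^sup>2 / 2\<close> in the unit disc and \<open>1/2 + ln |z|\<close> outside.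
Up to an additive constant \<open>V\<close> is the logarithmic potential of the uniform distribution on the unit
disc, and \<open>ln |f|\<close> is, again up to a constant, \<open>n\<close> times the potential of the zero measure of a
polynomial \<open>f\<close> of degree \<open>n\<close>. The theorem follows from the fact that \<open>ln |f|\<close> and \<open>n V\<close> are close
for a random Weyl polynomial, together with a quantitative way to recover the mass of discs from
potentials.

\<^bold>\<open>The potentials are close.\<close> By Cauchy-Schwarz, \<open>ln |f| \<le> n V + O(log n)\<close> on the whole plane as soon
as all coefficients are at most polynomially large, which fails with small probability by
Chebyshev's inequality. A lower bound cannot hold near the zeros, but it holds with overwhelming
probability at each fixed point \<open>z\<close> that is neither too close to the origin nor too large
(\<open>small_ball_weyl\<close>): the numbers \<open>sqrt (n^k / k!) |z|^k exp (- n V(z))\<close> climb from almost \<open>0\<close> at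
\<open>k = 0\<close> to at least \<open>1 / (e n)\<close>, and no step gains more than a polynomial factor. Hence there is a chain
of \<open>J\<close>, a large multiple of \<open>ln n\<close>, indices along which they grow by a large power of \<open>n\<close> at each step
(\<open>exists_lacunary\<close>). If \<open>f(z)\<close> is tiny, then along this chain, from the largest weight down, each
coefficient lies in a disc of a fixed radius that is determined by the coefficients already seen.
As the coefficients are not deterministic, this costs a factor \<open>\<eta> < 1\<close> every time
(\<open>small_ball_lacunary\<close>), and \<open>\<eta> ^ J\<close> is smaller than any prescribed power of \<open>1 / n\<close>. So the lower
bound \<open>ln |f| \<ge> n V - M\<close> with \<open>M = n powr (2 e)\<close> can be imposed at polynomially many points at once.

\<^bold>\<open>From potentials to discs.\<close> The difference of the potentials of two concentric uniform annuli of
width \<open>\<rho>\<close> is constant inside, zero outside and monotone in between (\<open>cutoff\<close>); this only uses that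
Lebesgue measure is invariant under rotations and that circular means of \<open>ln |u - v|\<close> are explicit
(\<open>radial_log_integral\<close>). Summing it over the zeros gives the difference of two annular means of
\<open>ln |f|\<close>, and comparing with \<open>n V\<close> leaves an error of the size of the mean of \<open>|ln |f| - n V|\<close> over
the annuli, divided by \<open>\<rho>\<close>. That mean is at most a multiple of \<open>M\<close>: on a disc of radius \<open>\<rho>\<close> about a
grid point, the lower bound at the centre propagates by the mean value inequality, the upper bound
holds everywhere, and \<open>n V\<close> itself varies by \<open>O(n \<rho>\<^sup>2)\<close> beyond its harmonic part
(\<open>ball_deviation\<close>). With \<open>\<rho> = n powr (- 1/2 + e)\<close> one has \<open>n \<rho>\<^sup>2 = M\<close>, and the
discrepancy is \<open>O(\<rho> + M / (n \<rho>)) = O(\<rho>)\<close> (\<open>counting_discrepancy\<close>, \<open>discrepancy_bound\<close>).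

\<^bold>\<open>Large discs.\<close> The annuli have to stay in a bounded region and their radii must not be large. Both are
achieved for all discs at once by an inversion \<open>w \<mapsto> 1 / (w - p)\<close> whose centre \<open>p\<close> has distance at
least \<open>1\<close> from the disc: the image is a disc inside the unit disc, and the two potentials transform in
the same way. Four centres \<open>p\<close> serve every disc that does not contain the unit disc
(\<open>exists_far_pole\<close>); the others are compared with \<open>ball 0 r\<close> as \<open>r\<close> tends to \<open>1\<close>.

\<^bold>\<open>Measurability.\<close> The number of zeros in a disc is a limit of annular means of \<open>ln |f|\<close>
(\<open>measure_zeros_ball_limit\<close>), hence a measurable function of the coefficients, and the supremum over all
discs is determined by a countable family of them.\<close>

section \<open>Rotation invariance of planar Lebesgue measure\<close>

lemma nn_integral_lborel_shift:
  fixes f :: "'b::euclidean_space \<Rightarrow> ennreal"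
  assumes [measurable]: "f \<in> borel_measurable borel"
  shows "(\<integral>\<^sup>+x. f (x + c) \<partial>lborel) = (\<integral>\<^sup>+x. f x \<partial>lborel)"
proof -
  have "(\<integral>\<^sup>+x. f x \<partial>lborel) = (\<integral>\<^sup>+x. f x \<partial>distr lborel borel ((+) c))"
    by (simp add: lborel_distr_plus)
  also have "\<dots> = (\<integral>\<^sup>+x. f (c + x) \<partial>lborel)"
    by (subst nn_integral_distr) auto
  finally show ?thesis by (simp add: add.commute)
qed

lemma nn_integral_lborel_uminus:
  fixes f :: "'b::euclidean_space \<Rightarrow> ennreal"
  assumes [measurable]: "f \<in> borel_measurable borel"
  shows "(\<integral>\<^sup>+x. f (- x) \<partial>lborel) = (\<integral>\<^sup>+x. f x \<partial>lborel)"
proof -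
  have eq: "lborel = distr lborel borel (\<lambda>x::'b. - x)"
    by (subst lborel_affine[of "-1" 0]) (auto simp: density_1)
  have "(\<integral>\<^sup>+x. f x \<partial>lborel) = (\<integral>\<^sup>+x. f (- x) \<partial>lborel)"
    by (subst eq, subst nn_integral_distr) auto
  thus ?thesis by simp
qed

text \<open>Translations and the reflection \<open>y \<mapsto> - y\<close> turn the double integral of \<open>1\<^sub>A(a x) 1\<^sub>B(y)\<close> into that of
\<open>1\<^sub>A(y) 1\<^sub>B(x)\<close>, where \<open>B\<close> is the unit disc and thus rotation invariant. Dividing by the area of \<open>B\<close>
gives the claim.\<close>
lemma lborel_rotate:
  fixes a :: complex
  assumes a: "cmod a = 1"
  shows "distr lborel borel (\<lambda>x. a * x) = lborel"
proof (rule measure_eqI)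
  fix A :: "complex set" assume "A \<in> sets (distr lborel borel (\<lambda>x. a * x))"
  hence A[measurable]: "A \<in> sets borel" by simp
  define B :: "complex set" where "B = ball 0 1"
  have [measurable]: "B \<in> sets borel" by (simp add: B_def)
  have a0: "a \<noteq> 0" using a by auto
  have iB: "indicator B (a * x) = (indicator B x :: ennreal)" for x
    by (simp add: B_def indicator_def norm_mult a)
  have "emeasure lborel {x. a * x \<in> A} * emeasure lborel B
      = (\<integral>\<^sup>+x. (\<integral>\<^sup>+y. indicator A (a * x) * indicator B y \<partial>lborel) \<partial>lborel)"
  proof -
    have "emeasure lborel {x. a * x \<in> A} = (\<integral>\<^sup>+x. indicator {x. a * x \<in> A} x \<partial>lborel)"
      by (subst nn_integral_indicator) auto
    also have "\<dots> = (\<integral>\<^sup>+x. indicator A (a * x) \<partial>lborel)"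
      by (auto intro!: nn_integral_cong simp: indicator_def)
    finally have "emeasure lborel {x. a * x \<in> A} = (\<integral>\<^sup>+x. indicator A (a * x) \<partial>lborel)" .
    moreover have "emeasure lborel B = (\<integral>\<^sup>+x. indicator B x \<partial>lborel)" by simp
    moreover have "(\<lambda>x. indicator A (a * x) :: ennreal) \<in> borel_measurable lborel" by measurable
    ultimately show ?thesis by (simp add: nn_integral_cmult nn_integral_multc)
  qed
  also have "\<dots> = (\<integral>\<^sup>+x. (\<integral>\<^sup>+y. indicator A (a * x) * indicator B (y + a * x) \<partial>lborel) \<partial>lborel)"
    by (intro nn_integral_cong nn_integral_lborel_shift[symmetric]) measurable
  also have "\<dots> = (\<integral>\<^sup>+y. (\<integral>\<^sup>+x. indicator A (a * x) * indicator B (y + a * x) \<partial>lborel) \<partial>lborel)"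
    by (intro lborel_pair.Fubini') measurable
  also have "\<dots> = (\<integral>\<^sup>+y. (\<integral>\<^sup>+x. indicator A (a * x - y) * indicator B x \<partial>lborel) \<partial>lborel)"
  proof (rule nn_integral_cong)
    fix y :: complex
    have "(\<integral>\<^sup>+x. indicator A (a * x) * indicator B (y + a * x) \<partial>lborel)
       = (\<integral>\<^sup>+x. indicator A (a * (x + (- y / a))) * indicator B (y + a * (x + (- y / a))) \<partial>lborel)"
      by (rule nn_integral_lborel_shift[symmetric]) measurable
    also have "\<dots> = (\<integral>\<^sup>+x. indicator A (a * x - y) * indicator B x \<partial>lborel)"
      using a0 by (intro nn_integral_cong) (simp add: iB ring_distribs)
    finally show "(\<integral>\<^sup>+x. indicator A (a * x) * indicator B (y + a * x) \<partial>lborel) =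
      (\<integral>\<^sup>+x. indicator A (a * x - y) * (indicator B x :: ennreal) \<partial>lborel)" .
  qed
  also have "\<dots> = (\<integral>\<^sup>+x. (\<integral>\<^sup>+y. indicator A (a * x - y) * indicator B x \<partial>lborel) \<partial>lborel)"
    by (intro lborel_pair.Fubini') measurable
  also have "\<dots> = (\<integral>\<^sup>+x. (\<integral>\<^sup>+y. indicator A y \<partial>lborel) * indicator B x \<partial>lborel)"
  proof (rule nn_integral_cong)
    fix x :: complex
    have "(\<integral>\<^sup>+y. indicator A (a * x - y) \<partial>lborel) = (\<integral>\<^sup>+y. indicator A (a * x + y) \<partial>lborel :: ennreal)"
      by (subst nn_integral_lborel_uminus[symmetric]) auto
    also have "\<dots> = (\<integral>\<^sup>+y. indicator A y \<partial>lborel)"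
      using nn_integral_lborel_shift[of "indicator A" "a * x"] by (simp add: add.commute)
    finally show "(\<integral>\<^sup>+y. indicator A (a * x - y) * indicator B x \<partial>lborel) =
        (\<integral>\<^sup>+y. indicator A y \<partial>lborel) * (indicator B x :: ennreal)"
      by (subst nn_integral_multc) auto
  qed
  also have "\<dots> = emeasure lborel A * emeasure lborel B"
    by (subst nn_integral_cmult) auto
  finally have "emeasure lborel {x. a * x \<in> A} = emeasure lborel A"
    by (subst (asm) (1 2) mult.commute, subst (asm) ennreal_mult_cancel_left)
      (auto simp: B_def emeasure_lborel_unit_disc)
  thus "emeasure (distr lborel borel (\<lambda>x. a * x)) A = emeasure lborel A"
    by (subst emeasure_distr) (auto simp: vimage_def)
qed simp

section \<open>Circular means of the logarithm\<close>

text \<open>For \<open>r < |u|\<close> the function \<open>w \<mapsto> ln |u - w|\<close> is, near the disc of radius \<open>r\<close>, the real part of the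
holomorphic function \<open>Ln (1 - w / u)\<close> up to a constant, so the mean is the value at the centre.\<close>
lemma circle_mean_log_outside:
  fixes u :: complex
  assumes "0 \<le> r" "r < cmod u"
  shows "((\<lambda>t. ln (cmod (u - of_real r * cis (2 * pi * t)))) has_integral ln (cmod u)) {0..1}"
proof -
  define f where "f = (\<lambda>w. Ln (1 - w / u))"
  have u0: "u \<noteq> 0" using assms by auto
  show ?thesis
  proof (cases "r = 0")
    case True
    then show ?thesis using has_integral_const_real[of "ln (cmod u)" 0 1] by simp
  next
    case False
    hence r: "r > 0" using assms by simp
    have re: "0 < Re (1 - w / u)" if "cmod w < cmod u" for w
    proof -
      have "cmod (w / u) < 1" using that u0 by (simp add: norm_divide)
      thus ?thesis using complex_Re_le_cmod[of "w / u"] by simp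
    qed
    have hol: "f holomorphic_on ball 0 (cmod u)"
      unfolding f_def
      by (intro holomorphic_intros) (auto dest!: re simp: complex_nonpos_Reals_iff u0 simp del: minus_complex.sel)
    have "((\<lambda>w. f w / (w - 0)) has_contour_integral (2 * of_real pi * \<i> * f 0)) (circlepath 0 r)"
      using assms r
      by (intro Cauchy_integral_circlepath_simple holomorphic_on_subset[OF hol]) auto
    hence "((\<lambda>t. f (circlepath 0 r t) / circlepath 0 r t * vector_derivative (circlepath 0 r) (at t within {0..1}))
        has_integral 0) {0..1}"
      by (simp add: has_contour_integral_def f_def)
    also have "?this \<longleftrightarrow> ((\<lambda>t. (2 * of_real pi * \<i>) * f (circlepath 0 r t)) has_integral 0) {0..1}"
      using r by (intro has_integral_cong) (simp add: vector_derivative_circlepath01, simp add: circlepath)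
    finally have "((\<lambda>t. (2 * of_real pi * \<i>) * f (circlepath 0 r t)) has_integral 0) {0..1}" .
    hence "((\<lambda>t. f (circlepath 0 r t)) has_integral 0) {0..1}"
      using has_integral_mult_right[of "\<lambda>t. (2 * of_real pi * \<i>) * f (circlepath 0 r t)" 0 "{0..1}" "1 / (2 * of_real pi * \<i>)"]
      by simp
    hence "((\<lambda>t. Re (f (circlepath 0 r t))) has_integral 0) {0..1}"
      by (metis has_integral_Re zero_complex.sel(1))
    hence "((\<lambda>t. Re (f (circlepath 0 r t)) + ln (cmod u)) has_integral 0 + ln (cmod u)) {0..1}"
      using has_integral_const_real[of "ln (cmod u)" 0 1]
      by (intro has_integral_add) auto
    moreover have "Re (f (circlepath 0 r t)) + ln (cmod u) = ln (cmod (u - of_real r * cis (2 * pi * t)))" for t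
    proof -
      define w where "w = of_real r * cis (2 * pi * t)"
      have w: "circlepath 0 r t = w" by (simp add: circlepath w_def cis_conv_exp mult_ac)
      have nw: "cmod w < cmod u" using assms r by (simp add: w_def norm_mult)
      hence ne: "1 - w / u \<noteq> 0" using re[of w] by force
      have "Re (f w) = ln (cmod (1 - w / u))" unfolding f_def using ne by simp
      moreover have "cmod (u - w) = cmod u * cmod (1 - w / u)"
        using u0 by (simp flip: norm_mult add: right_diff_distrib)
      ultimately show ?thesis using ne u0 by (simp add: w ln_mult flip: w_def)
    qed
    ultimately show ?thesis by simp
  qed
qed

text \<open>A point inside the circle is reduced to one outside by reflection: with \<open>v = r / cnj u\<close> the quantities
\<open>|u - r exp (i \<theta>)|\<close> and \<open>|u| |v - exp (i \<theta>)|\<close> agree.\<close>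
lemma circle_mean_log:
  fixes u :: complex
  assumes "0 \<le> r" "r \<noteq> cmod u"
  shows "((\<lambda>t. ln (cmod (u - of_real r * cis (2 * pi * t)))) has_integral ln (max (cmod u) r)) {0..1}"
proof (cases "r < cmod u")
  case True
  thus ?thesis using circle_mean_log_outside[OF assms(1) True] by (simp add: max_def)
next
  case False
  hence lt: "cmod u < r" using assms by simp
  hence "r > 0" using norm_ge_zero[of u] by linarith
  have "((\<lambda>t. ln (cmod (u - of_real r * cis (2 * pi * t)))) has_integral ln r) {0..1}"
  proof (cases "u = 0")
    case True
    thus ?thesis using has_integral_const_real[of "ln r" 0 1] \<open>r > 0\<close> by (simp add: norm_mult)
  next
    case False
    define v where "v = of_real r / cnj u"
    have v: "cmod v = r / cmod u" using \<open>r > 0\<close> by (simp add: v_def norm_divide)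
    have "((\<lambda>t. ln (cmod (v - of_real 1 * cis (2 * pi * t)))) has_integral ln (cmod v)) {0..1}"
      using lt False by (intro circle_mean_log_outside) (auto simp: v)
    hence "((\<lambda>t. ln (cmod (v - of_real 1 * cis (2 * pi * t))) + ln (cmod u)) has_integral
       ln (cmod v) + ln (cmod u)) {0..1}"
      using has_integral_const_real[of "ln (cmod u)" 0 1] by (intro has_integral_add) auto
    moreover have "ln (cmod v) + ln (cmod u) = ln r"
      using False \<open>r > 0\<close> by (simp add: v ln_div)
    moreover have "ln (cmod (v - of_real 1 * cis (2 * pi * t))) + ln (cmod u) =
        ln (cmod (u - of_real r * cis (2 * pi * t)))" for t
    proof -
      let ?c = "cis (2 * pi * t)"
      have "u - of_real r * ?c = ?c * cnj (cnj u * ?c - of_real r)"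
        by (simp add: algebra_simps cis_cnj cis_mult)
      hence "cmod (u - of_real r * ?c) = cmod (cnj (cnj u * ?c - of_real r))"
        by (simp add: norm_mult del: complex_cnj_diff complex_cnj_mult complex_mod_cnj)
      also have "\<dots> = cmod (of_real r - cnj u * ?c)"
        by (simp only: complex_mod_cnj norm_minus_commute)
      also have "\<dots> = cmod (cnj u * (v - ?c))"
        using False by (simp add: v_def right_diff_distrib)
      also have "\<dots> = cmod u * cmod (v - ?c)" by (simp add: norm_mult)
      finally have eq: "cmod (u - of_real r * ?c) = cmod u * cmod (v - ?c)" .
      have "cmod v > 1" using lt False by (simp add: v)
      hence "v \<noteq> ?c" by auto
      thus ?thesis using False by (simp add: eq ln_mult)
    qed
    ultimately show ?thesis by simp
  qed
  thus ?thesis using lt by (simp add: max_def)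
qed

section \<open>Logarithmic poles and radial averages\<close>

lemma nn_integral_inverse_interval:
  assumes "0 < d" "0 < \<rho>"
  shows "(\<integral>\<^sup>+t. ennreal (1 / t) * indicator {d..\<rho>} t \<partial>lborel) = ennreal (ln (max 1 (\<rho> / d)))"
proof (cases "d \<le> \<rho>")
  case True
  have "(\<integral>\<^sup>+t. ennreal (1 / t) * indicator {d..\<rho>} t \<partial>lborel) = ennreal (ln \<rho> - ln d)"
    using assms True
    by (intro nn_integral_FTC_Icc) (auto intro!: derivative_eq_intros)
  also have "max 1 (\<rho> / d) = \<rho> / d" using assms True by (simp add: max_def field_simps)
  ultimately show ?thesis using assms by (simp add: ln_div)
next
  case False
  hence "max 1 (\<rho> / d) = 1" using assms by (simp add: max_def field_simps)
  thus ?thesis using False by simp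
qed

text \<open>Layer-cake formula: write the truncated logarithm as an integral of \<open>1 / t\<close> and exchange the integrals.
Thus the size of a logarithmic pole is governed by the mass of small discs about it. An atom at the
pole has to be excluded because the truncated logarithm takes the value \<open>0\<close> there.\<close>
lemma nn_integral_log_pole:
  fixes c :: complex
  assumes m: "sigma_finite_measure m" and [measurable_cong]: "sets m = sets borel"
    and c: "AE \<tau> in m. \<tau> \<noteq> c" and \<rho>: "\<rho> > 0"
  shows "(\<integral>\<^sup>+\<tau>. ennreal (ln (max 1 (\<rho> / cmod (\<tau> - c)))) \<partial>m) =
         (\<integral>\<^sup>+t. ennreal (1 / t) * emeasure m (cball c t) * indicator {0<..\<rho>} t \<partial>lborel)"
proof -
  interpret m: sigma_finite_measure m by fact
  interpret pair_sigma_finite m "lborel :: real measure" ..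
  have "(\<integral>\<^sup>+\<tau>. ennreal (ln (max 1 (\<rho> / cmod (\<tau> - c)))) \<partial>m) =
        (\<integral>\<^sup>+\<tau>. (\<integral>\<^sup>+t. ennreal (1 / t) * indicator (cball c t) \<tau> * indicator {0<..\<rho>} t \<partial>lborel) \<partial>m)"
  proof (rule nn_integral_cong_AE, use c in eventually_elim)
    case (elim \<tau>)
    hence "ennreal (ln (max 1 (\<rho> / cmod (\<tau> - c)))) =
        (\<integral>\<^sup>+t. ennreal (1 / t) * indicator {cmod (\<tau> - c)..\<rho>} t \<partial>lborel)"
      using \<rho> by (intro nn_integral_inverse_interval[symmetric]) auto
    also have "\<dots> = (\<integral>\<^sup>+t. ennreal (1 / t) * indicator (cball c t) \<tau> * indicator {0<..\<rho>} t \<partial>lborel)"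
      using less_le_trans[of 0 "cmod (\<tau> - c)"] elim by (intro nn_integral_cong)
        (auto simp: indicator_def dist_norm norm_minus_commute)
    finally show ?case .
  qed
  also have "\<dots> = (\<integral>\<^sup>+t. (\<integral>\<^sup>+\<tau>. ennreal (1 / t) * indicator (cball c t) \<tau> * indicator {0<..\<rho>} t \<partial>m) \<partial>lborel)"
  proof (rule Fubini'[symmetric])
    have "(\<lambda>(\<tau>, t). indicator (cball c t) \<tau> :: ennreal) = (\<lambda>(\<tau>, t). indicator {0..} (t - dist c \<tau>))"
      by (auto simp: fun_eq_iff indicator_def)
    moreover have "(\<lambda>(\<tau>, t). indicator {0..} (t - dist c \<tau>) :: ennreal) \<in> borel_measurable (m \<Otimes>\<^sub>M lborel)"
      by measurable
    ultimately have [measurable]: "(\<lambda>(\<tau>, t). indicator (cball c t) \<tau> :: ennreal) \<in> borel_measurable (m \<Otimes>\<^sub>M lborel)"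
      by simp
    show "(\<lambda>(\<tau>, t). ennreal (1 / t) * indicator (cball c t) \<tau> * indicator {0<..\<rho>} t) \<in> borel_measurable (m \<Otimes>\<^sub>M lborel)"
      by measurable
  qed
  also have "\<dots> = (\<integral>\<^sup>+t. ennreal (1 / t) * emeasure m (cball c t) * indicator {0<..\<rho>} t \<partial>lborel)"
  proof (rule nn_integral_cong)
    fix t
    have [measurable]: "cball c t \<in> sets m" by (simp add: assms)
    show "(\<integral>\<^sup>+\<tau>. ennreal (1 / t) * indicator (cball c t) \<tau> * indicator {0<..\<rho>} t \<partial>m) =
       ennreal (1 / t) * emeasure m (cball c t) * indicator {0<..\<rho>} t"
      by (simp add: nn_integral_cmult nn_integral_multc)
  qed
  finally show ?thesis .
qed

lemma nn_integral_linear_interval: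
  assumes "0 \<le> C" "0 < \<rho>"
  shows "(\<integral>\<^sup>+t. ennreal (1 / t) * ennreal (C * t\<^sup>2) * indicator {0<..\<rho>} t \<partial>lborel) = ennreal (C * \<rho>\<^sup>2 / 2)"
proof -
  have "(\<integral>\<^sup>+t. ennreal (1 / t) * ennreal (C * t\<^sup>2) * indicator {0<..\<rho>} t \<partial>lborel) =
      (\<integral>\<^sup>+t. ennreal (C * t) * indicator {0..\<rho>} t \<partial>lborel)"
    using assms by (intro nn_integral_cong)
      (auto simp: indicator_def ennreal_mult[symmetric] power2_eq_square)
  also have "\<dots> = ennreal (C * \<rho>\<^sup>2 / 2 - C * 0\<^sup>2 / 2)"
    using assms by (intro nn_integral_FTC_Icc) (auto intro!: derivative_eq_intros)
  finally show ?thesis by simp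
qed

text \<open>Letting \<open>t\<close> tend to \<open>0\<close> in the bound for the mass of discs shows that there is no atom.\<close>
lemma AE_neq_of_regular:
  fixes c :: complex
  assumes [measurable_cong]: "sets m = sets borel"
    and reg: "\<And>t. t > 0 \<Longrightarrow> emeasure m (cball c t) \<le> ennreal (C * t\<^sup>2)"
  shows "AE \<tau> in m. \<tau> \<noteq> c"
proof -
  have "emeasure m {c} = 0"
  proof (rule ccontr)
    assume "emeasure m {c} \<noteq> 0"
    have le: "emeasure m {c} \<le> ennreal (C * t\<^sup>2)" if "t > 0" for t
      by (rule order_trans[OF _ reg[OF that]]) (use that in \<open>auto intro!: emeasure_mono simp: assms\<close>)
    have "((\<lambda>t. ennreal (C * t\<^sup>2)) \<longlongrightarrow> ennreal (C * 0\<^sup>2)) (at_right 0)"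
      by (intro tendsto_intros)
    hence "emeasure m {c} \<le> ennreal (C * 0\<^sup>2)"
      by (rule tendsto_lowerbound) (auto simp: eventually_at_right_less intro!: eventually_at_rightI[of 0 1] le)
    with \<open>emeasure m {c} \<noteq> 0\<close> show False by simp
  qed
  thus ?thesis by (intro AE_I[of _ _ "{c}"]) (auto simp: assms)
qed

lemma nn_integral_log_pole_le:
  fixes c :: complex
  assumes m: "sigma_finite_measure m" and sets: "sets m = sets borel"
    and reg: "\<And>t. t > 0 \<Longrightarrow> emeasure m (cball c t) \<le> ennreal (C * t\<^sup>2)"
    and C: "C \<ge> 0" and \<rho>: "\<rho> > 0"
  shows "(\<integral>\<^sup>+\<tau>. ennreal (ln (max 1 (\<rho> / cmod (\<tau> - c)))) \<partial>m) \<le> ennreal (C * \<rho>\<^sup>2 / 2)"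
proof -
  have "(\<integral>\<^sup>+\<tau>. ennreal (ln (max 1 (\<rho> / cmod (\<tau> - c)))) \<partial>m) =
      (\<integral>\<^sup>+t. ennreal (1 / t) * emeasure m (cball c t) * indicator {0<..\<rho>} t \<partial>lborel)"
    using AE_neq_of_regular[OF sets reg] by (intro nn_integral_log_pole m sets \<rho>) auto
  also have "\<dots> \<le> (\<integral>\<^sup>+t. ennreal (1 / t) * ennreal (C * t\<^sup>2) * indicator {0<..\<rho>} t \<partial>lborel)"
    by (intro nn_integral_mono) (auto simp: indicator_def intro!: mult_left_mono reg)
  also have "\<dots> = ennreal (C * \<rho>\<^sup>2 / 2)" by (rule nn_integral_linear_interval[OF C \<rho>])
  finally show ?thesis .
qed

lemma nn_integral_log_pole_lborel:
  fixes c :: complex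
  assumes \<rho>: "\<rho> > 0"
  shows "(\<integral>\<^sup>+\<tau>. ennreal (ln (max 1 (\<rho> / cmod (\<tau> - c)))) \<partial>lborel) = ennreal (pi * \<rho>\<^sup>2 / 2)"
proof -
  have "(\<integral>\<^sup>+\<tau>. ennreal (ln (max 1 (\<rho> / cmod (\<tau> - c)))) \<partial>lborel) =
      (\<integral>\<^sup>+t. ennreal (1 / t) * emeasure lborel (cball c t) * indicator {0<..\<rho>} t \<partial>lborel)"
    by (intro nn_integral_log_pole \<rho> sigma_finite_lborel AE_lborel_singleton) auto
  also have "\<dots> = (\<integral>\<^sup>+t. ennreal (1 / t) * ennreal (pi * t\<^sup>2) * indicator {0<..\<rho>} t \<partial>lborel)"
    by (intro nn_integral_cong) (auto simp: indicator_def emeasure_cball unit_ball_vol_2)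
  also have "\<dots> = ennreal (pi * \<rho>\<^sup>2 / 2)" by (rule nn_integral_linear_interval[OF _ \<rho>]) simp
  finally show ?thesis .
qed

lemma abs_ln_le_pole:
  assumes "0 \<le> d"
  shows "\<bar>ln d\<bar> \<le> ln (max 1 (1 / d)) + (d::real)"
proof (cases "d \<ge> 1")
  case True
  thus ?thesis using ln_le_minus_one[of d] by (simp add: max_def)
next
  case False
  show ?thesis
  proof (cases "d = 0")
    case False
    with \<open>\<not> d \<ge> 1\<close> assms have "max 1 (1/d) = 1/d" "ln d \<le> 0" by (auto simp: max_def field_simps)
    thus ?thesis using assms False by (simp add: ln_div)
  qed simp
qed

lemma set_integrable_log:
  fixes u :: complex
  assumes [measurable]: "A \<in> sets borel" and A: "bounded A"
  shows "set_integrable lborel A (\<lambda>v. ln (cmod (u - v)))"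
proof -
  obtain K where K: "\<And>v. v \<in> A \<Longrightarrow> cmod v \<le> K" using A by (auto simp: bounded_iff)
  have fA: "emeasure lborel A < \<infinity>" by (rule emeasure_bounded_finite[OF A])
  have i1: "integrable lborel (\<lambda>v. ln (max 1 (1 / cmod (v - u))))"
    by (rule integrableI_bounded)
      (use nn_integral_log_pole_lborel[of 1 u] in \<open>auto simp: ln_ge_zero\<close>)
  have i2: "integrable lborel (\<lambda>v. indicator A v * (cmod u + K))"
    using fA by (intro integrable_mult_left integrable_real_indicator) auto
  show ?thesis
    unfolding set_integrable_def
  proof (rule Bochner_Integration.integrable_bound[OF Bochner_Integration.integrable_add[OF i1 i2]])
    show "AE v in lborel. norm (indicator A v *\<^sub>R ln (cmod (u - v))) \<le>
       norm (ln (max 1 (1 / cmod (v - u))) + indicator A v * (cmod u + K))"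
    proof (rule AE_I2)
      fix v
      have "\<bar>ln (cmod (u - v))\<bar> \<le> ln (max 1 (1 / cmod (v - u))) + (cmod u + K)" if "v \<in> A"
        using abs_ln_le_pole[of "cmod (u - v)"] K[OF that] norm_triangle_ineq4[of u v]
        by (simp add: norm_minus_commute)
      moreover have "ln (max 1 (1 / cmod (v - u))) \<ge> 0" by simp
      ultimately show "norm (indicator A v *\<^sub>R ln (cmod (u - v))) \<le>
       norm (ln (max 1 (1 / cmod (v - u))) + indicator A v * (cmod u + K))"
        by (auto simp: indicator_def)
    qed
  qed measurable
qed

text \<open>The version for the circle through an arbitrary point \<open>v\<close>, in the form in which it meets rotations.\<close>
lemma circle_mean_log_complex:
  fixes u v :: complex
  assumes "cmod v \<noteq> cmod u"
  shows "((\<lambda>t. ln (cmod (u - v * cis (2 * pi * t)))) has_integral ln (max (cmod u) (cmod v))) {0..1}"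
proof -
  define a where "a = cis (Arg v)"
  have va: "v = of_real (cmod v) * a" using rcis_cmod_Arg[of v] by (simp add: a_def rcis_def)
  have na: "cmod a = 1" "a \<noteq> 0" by (auto simp: a_def)
  have "((\<lambda>t. ln (cmod (u / a - of_real (cmod v) * cis (2 * pi * t)))) has_integral
    ln (max (cmod (u / a)) (cmod v))) {0..1}"
    using assms by (intro circle_mean_log) (auto simp: norm_divide na)
  moreover have "cmod (u / a - of_real (cmod v) * cis (2 * pi * t)) = cmod (u - v * cis (2 * pi * t))" for t
  proof -
    have "u - v * cis (2 * pi * t) = a * (u / a - of_real (cmod v) * cis (2 * pi * t))"
      by (subst va) (use na in \<open>simp add: field_simps\<close>)
    thus ?thesis by (simp add: norm_mult na)
  qed
  ultimately show ?thesis by (simp add: norm_divide na)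
qed

lemma lborel_rotate_about:
  fixes u0 a :: complex
  assumes a: "cmod a = 1"
  shows "distr lborel borel (\<lambda>v. u0 + a * (v - u0)) = lborel"
proof -
  have "distr lborel borel (\<lambda>v. u0 + a * (v - u0)) =
     distr (distr lborel borel (\<lambda>x. a * x)) borel ((+) (u0 - a * u0))"
    by (subst distr_distr) (auto simp: o_def algebra_simps intro!: distr_cong)
  thus ?thesis by (simp add: lborel_rotate[OF a] lborel_distr_plus)
qed

text \<open>Averaging over all rotations about \<open>u0\<close> does not change the integral over a rotation invariant set, and by
Fubini it replaces \<open>ln |u - v|\<close> by its mean over the circle through \<open>v\<close>. The circle through \<open>u\<close>, where
that mean is not covered by the formula, is a null set.\<close>
lemma radial_log_integral:
  fixes u u0 :: complex
  assumes A[measurable]: "A \<in> sets borel" and bdd: "bounded A"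
    and rad: "\<And>v w. v \<in> A \<Longrightarrow> cmod (w - u0) = cmod (v - u0) \<Longrightarrow> w \<in> A"
  shows "(LINT v:A|lborel. ln (cmod (u - v))) = (LINT v:A|lborel. ln (max (cmod (u - u0)) (cmod (v - u0))))"
proof -
  define R where "R = (\<lambda>t v. u0 + cis (2 * pi * t) * (v - u0))"
  let ?g = "\<lambda>v. indicator A v * ln (cmod (u - v))" and ?h = "\<lambda>t v. indicator A v * ln (cmod (u - R t v))"
  define F where "F = (\<lambda>t v. indicator {0..1::real} t * (indicator A v * ln (cmod (u - R t v))))"
  have [measurable]: "cis \<in> borel_measurable borel"
    by (intro borel_measurable_continuous_onI continuous_intros)
  have [measurable]: "R t \<in> borel_measurable borel" for t
    unfolding R_def by measurable
  have [measurable]: "(\<lambda>(t, v). F t v) \<in> borel_measurable (lborel \<Otimes>\<^sub>M lborel)"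
    unfolding F_def R_def by measurable
  have RA: "R t v \<in> A \<longleftrightarrow> v \<in> A" for t v
    using rad[of v "R t v"] rad[of "R t v" v] by (auto simp: R_def norm_mult)
  have distr_R: "distr lborel borel (R t) = lborel" for t
    unfolding R_def by (rule lborel_rotate_about) simp
  have intA: "integrable lborel ?g"
    using set_integrable_log[OF A bdd, of u] by (simp add: set_integrable_def)
  have rot: "integrable lborel (?h t)"
       "(\<integral>v. ?h t v \<partial>lborel) = (\<integral>v. ?g v \<partial>lborel)"
       "(\<integral>v. \<bar>?h t v\<bar> \<partial>lborel) = (\<integral>v. \<bar>?g v\<bar> \<partial>lborel)" for t
  proof -
    have eq: "indicator A v = (indicator A (R t v) :: real)" for v by (simp add: indicator_def RA)
    have "integrable (distr lborel borel (R t)) ?g"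
      by (simp add: distr_R intA)
    thus "integrable lborel (?h t)"
      by (subst (asm) integrable_distr_eq) (auto simp: RA indicator_def)
    have "(\<integral>v. ?g v \<partial>lborel) = (\<integral>v. ?g v \<partial>distr lborel borel (R t))"
      by (simp add: distr_R)
    also have "\<dots> = (\<integral>v. ?h t v \<partial>lborel)"
      by (subst integral_distr) (auto simp: RA indicator_def)
    finally show "(\<integral>v. ?h t v \<partial>lborel) = (\<integral>v. ?g v \<partial>lborel)" ..
    have "(\<integral>v. \<bar>?g v\<bar> \<partial>lborel) = (\<integral>v. \<bar>?g v\<bar> \<partial>distr lborel borel (R t))"
      by (simp add: distr_R)
    also have "\<dots> = (\<integral>v. \<bar>?h t v\<bar> \<partial>lborel)"
      by (subst integral_distr) (auto simp: RA indicator_def)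
    finally show "(\<integral>v. \<bar>?h t v\<bar> \<partial>lborel) = (\<integral>v. \<bar>?g v\<bar> \<partial>lborel)" ..
  qed
  have intF: "integrable (lborel \<Otimes>\<^sub>M lborel) (\<lambda>(t, v). F t v)"
  proof (rule lborel_pair.Fubini_integrable)
    have "(\<integral>v. norm (F t v) \<partial>lborel) = indicator {0..1} t * (\<integral>v. \<bar>?g v\<bar> \<partial>lborel)" for t
      using rot(3)[of t] by (simp add: F_def indicator_def)
    moreover have "integrable lborel (\<lambda>t. indicator {0..1::real} t * (\<integral>v. \<bar>?g v\<bar> \<partial>lborel))"
      by (intro integrable_mult_left integrable_real_indicator) auto
    ultimately show "integrable lborel (\<lambda>t. \<integral>v. norm (case (t, v) of (t, v) \<Rightarrow> F t v) \<partial>lborel)" by simp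
    show "AE t in lborel. integrable lborel (\<lambda>v. case (t, v) of (t, v) \<Rightarrow> F t v)"
      by (auto simp: F_def intro!: AE_I2 rot)
  qed measurable
  have "(\<integral>v. (\<integral>t. F t v \<partial>lborel) \<partial>lborel) = (\<integral>t. (\<integral>v. F t v \<partial>lborel) \<partial>lborel)"
    by (rule lborel_pair.Fubini_integral[OF intF])
  also have "(\<lambda>t. \<integral>v. F t v \<partial>lborel) = (\<lambda>t. indicator {0..1} t * (\<integral>v. ?g v \<partial>lborel))"
    by (auto simp: F_def rot)
  also have "(\<integral>t. indicator {0..1::real} t * (\<integral>v. ?g v \<partial>lborel) \<partial>lborel) =
      (\<integral>v. ?g v \<partial>lborel)"
    by simp
  also have "(\<integral>v. (\<integral>t. F t v \<partial>lborel) \<partial>lborel) = (\<integral>v. indicator A v * ln (max (cmod (u - u0)) (cmod (v - u0))) \<partial>lborel)"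
  proof (rule integral_cong_AE)
    show "(\<lambda>v. \<integral>t. F t v \<partial>lborel) \<in> borel_measurable lborel"
      using intF by (intro borel_measurable_integrable lborel_pair.integrable_snd) auto
    have "AE v in lborel. v \<notin> sphere u0 (cmod (u - u0))"
      by (intro AE_not_in)
        (auto simp: null_sets_completion_iff negligible_iff_null_sets[symmetric] negligible_sphere
          simp flip: null_sets_completion_iff)
    thus "AE v in lborel. (\<integral>t. F t v \<partial>lborel) = indicator A v * ln (max (cmod (u - u0)) (cmod (v - u0)))"
    proof eventually_elim
      case (elim v)
      hence ne: "cmod (v - u0) \<noteq> cmod (u - u0)" by (simp add: dist_norm norm_minus_commute)
      have eq: "u - R t v = (u - u0) - (v - u0) * cis (2 * pi * t)" for t by (simp add: R_def)
      have nz: "u - R t v \<noteq> 0" for t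
      proof
        assume "u - R t v = 0"
        hence "u - u0 = (v - u0) * cis (2 * pi * t)" by (simp add: eq)
        hence "cmod (u - u0) = cmod (v - u0)" by (simp add: norm_mult)
        thus False using ne by simp
      qed
      have si: "set_integrable lborel {0..1} (\<lambda>t. ln (cmod (u - R t v)))"
        using nz unfolding eq
        by (intro borel_integrable_atLeastAtMost' continuous_intros) auto
      have "(\<integral>t. F t v \<partial>lborel) = indicator A v * (LINT t:{0..1}|lborel. ln (cmod (u - R t v)))"
        by (simp add: F_def set_lebesgue_integral_def mult.left_commute)
      also have "(LINT t:{0..1}|lborel. ln (cmod (u - R t v))) = integral {0..1} (\<lambda>t. ln (cmod (u - R t v)))"
        by (rule set_borel_integral_eq_integral[OF si])
      also have "\<dots> = ln (max (cmod (u - u0)) (cmod (v - u0)))"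
        unfolding eq using circle_mean_log_complex[OF ne] by (rule integral_unique)
      finally show ?case .
    qed
  qed measurable
  finally show ?thesis by (simp add: set_lebesgue_integral_def)
qed

section \<open>The logarithmic potential of the uniform disc\<close>

lemma measure_ball_complex:
  fixes c :: complex
  assumes "0 \<le> r"
  shows "measure lborel (ball c r) = pi * r\<^sup>2" "emeasure lborel (ball c r) = ennreal (pi * r\<^sup>2)"
  using assms by (simp_all add: measure_def emeasure_ball unit_ball_vol_2)

text \<open>This is the layer-cake formula for the pole at the origin, with \<open>r\<close> as the truncation radius.\<close>
lemma ball_log_integral:
  assumes r: "r > 0"
  shows "(LINT w:ball 0 r|lborel. ln (cmod w)) = pi * r\<^sup>2 * ln r - pi * r\<^sup>2 / 2"
proof -
  have [measurable]: "ball (0::complex) r \<in> sets borel" by simp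
  have i1: "set_integrable lborel (ball 0 r) (\<lambda>w. ln (cmod w))"
    using set_integrable_log[of "ball 0 r" 0] by simp
  have i2: "set_integrable lborel (ball (0::complex) r) (\<lambda>w. ln r)"
    using r by (simp add: set_integrable_def measure_ball_complex)
  have eq: "ln (max 1 (r / cmod w)) = indicator (ball 0 r) w * (ln r - ln (cmod w))" if "w \<noteq> 0" for w
    using that r by (auto simp: indicator_def ln_div max_def field_simps)
  have "(\<integral>w. ln (max 1 (r / cmod w)) \<partial>lborel) = pi * r\<^sup>2 / 2"
    using nn_integral_log_pole_lborel[OF r, of 0] r
    by (subst integral_eq_nn_integral) auto
  also have "(\<integral>w. ln (max 1 (r / cmod w)) \<partial>lborel) = (LINT w:ball 0 r|lborel. (ln r - ln (cmod w)))"
    unfolding set_lebesgue_integral_def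
    by (rule integral_cong_AE, measurable) (use AE_lborel_singleton[of "0::complex"] in \<open>auto elim!: eventually_mono simp: eq\<close>)
  also have "\<dots> = (LINT w:ball (0::complex) r|lborel. ln r) - (LINT w:ball 0 r|lborel. ln (cmod w))"
    using i1 i2 by (rule set_integral_diff(2)[rotated])
  also have "(LINT w:ball (0::complex) r|lborel. ln r) = pi * r\<^sup>2 * ln r"
    using r by (simp add: measure_ball_complex set_lebesgue_integral_def)
  finally show ?thesis by simp
qed

definition disc_potential :: "complex \<Rightarrow> real" where
  "disc_potential z = (if cmod z \<le> 1 then (cmod z)\<^sup>2 / 2 else 1 / 2 + ln (cmod z))"

lemma integral_uniform_disc:
  fixes f :: "complex \<Rightarrow> real"
  assumes [measurable]: "f \<in> borel_measurable borel"
  shows "(\<integral>w. f w \<partial>uniform_disc) = (LINT w:ball 0 1|lborel. f w) / pi"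
    and "integrable uniform_disc f \<longleftrightarrow> set_integrable lborel (ball 0 1) f"
proof -
  have [measurable]: "ball (0::complex) 1 \<in> sets borel" by simp
  have "(\<integral>w. f w \<partial>uniform_disc) = (\<integral>w. (1 / pi * indicator (ball 0 1) w) *\<^sub>R f w \<partial>lborel)"
    unfolding uniform_disc_eq_density by (rule integral_density) auto
  also have "(\<lambda>w. (1 / pi * indicator (ball 0 1) w) *\<^sub>R f w) = (\<lambda>w. (1 / pi) * (indicator (ball 0 1) w *\<^sub>R f w))"
    by (simp add: fun_eq_iff)
  finally show "(\<integral>w. f w \<partial>uniform_disc) = (LINT w:ball 0 1|lborel. f w) / pi"
    by (simp add: set_lebesgue_integral_def)
  have "integrable uniform_disc f \<longleftrightarrow> integrable lborel (\<lambda>w. (1 / pi * indicator (ball 0 1) w) *\<^sub>R f w)"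
    unfolding uniform_disc_eq_density by (rule integrable_density) auto
  also have "(\<lambda>w. (1 / pi * indicator (ball 0 1) w) *\<^sub>R f w) = (\<lambda>w. (1 / pi) * (indicator (ball 0 1) w *\<^sub>R f w))"
    by (simp add: fun_eq_iff)
  also have "integrable lborel \<dots> \<longleftrightarrow> set_integrable lborel (ball 0 1) f"
    unfolding set_integrable_def by (subst integrable_mult_left_iff) auto
  finally show "integrable uniform_disc f \<longleftrightarrow> set_integrable lborel (ball 0 1) f" .
qed

text \<open>After radial averaging the integrand is \<open>ln |z|\<close> on the disc of radius \<open>|z|\<close> and \<open>ln |w|\<close> on the rest.\<close>
lemma potential_uniform_disc:
  "(\<integral>w. ln (cmod (z - w)) \<partial>uniform_disc) = disc_potential z - 1 / 2"
proof -
  have "(\<integral>w. ln (cmod (z - w)) \<partial>uniform_disc) = (LINT w:ball 0 1|lborel. ln (max (cmod z) (cmod w))) / pi"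
    using radial_log_integral[of "ball 0 1" 0 z] by (simp add: integral_uniform_disc)
  also have "(LINT w:ball 0 1|lborel. ln (max (cmod z) (cmod w))) = pi * (disc_potential z - 1 / 2)"
  proof (cases "cmod z \<ge> 1")
    case True
    have "(LINT w:ball 0 1|lborel. ln (max (cmod z) (cmod w))) = (LINT w:ball (0::complex) 1|lborel. ln (cmod z))"
      using True by (intro set_lebesgue_integral_cong) (auto simp: max_def)
    also have "\<dots> = pi * ln (cmod z)"
      by (simp add: set_lebesgue_integral_def measure_ball_complex)
    also have "ln (cmod z) = disc_potential z - 1 / 2"
      using True by (auto simp: disc_potential_def)
    finally show ?thesis .
  next
    case False
    show ?thesis
    proof (cases "z = 0")
      case True
      thus ?thesis using ball_log_integral[of 1] by (simp add: disc_potential_def)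
    next
      case nz: False
      define r where "r = cmod z"
      have r: "0 < r" "r < 1" using False nz by (auto simp: r_def)
      have sub: "ball (0::complex) r \<subseteq> ball 0 1" using r by auto
      have i0: "set_integrable lborel (ball 0 s) (\<lambda>w. ln (cmod w))" for s
        using set_integrable_log[of "ball 0 s" 0] by simp
      have i1: "set_integrable lborel (ball 0 1 - ball 0 r) (\<lambda>w. ln (cmod w))"
        by (rule set_integrable_subset[OF i0[of 1]]) auto
      have i2: "set_integrable lborel (ball (0::complex) r) (\<lambda>w. ln r)"
        using r by (simp add: set_integrable_def measure_ball_complex)
      have "(LINT w:ball 0 1|lborel. ln (cmod w)) =
          (LINT w:ball 0 r|lborel. ln (cmod w)) + (LINT w:ball 0 1 - ball 0 r|lborel. ln (cmod w))"
        using set_integral_Un[OF _ i0[of r] i1] sub by (simp add: Un_absorb1)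
      hence e1: "(LINT w:ball 0 1 - ball 0 r|lborel. ln (cmod w)) = - pi / 2 - (pi * r\<^sup>2 * ln r - pi * r\<^sup>2 / 2)"
        using ball_log_integral[of r] ball_log_integral[of 1] r by simp
      have c1: "set_integrable lborel (ball 0 1 - ball 0 r) (\<lambda>w. ln (max r (cmod w))) \<longleftrightarrow>
            set_integrable lborel (ball 0 1 - ball 0 r) (\<lambda>w. ln (cmod w))"
        by (intro set_integrable_cong) (auto simp: max_def)
      have c2: "set_integrable lborel (ball (0::complex) r) (\<lambda>w. ln (max r (cmod w))) \<longleftrightarrow>
            set_integrable lborel (ball (0::complex) r) (\<lambda>w. ln r)"
        by (intro set_integrable_cong) (auto simp: max_def)
      have "(LINT w:ball 0 1|lborel. ln (max r (cmod w))) =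
          (LINT w:ball (0::complex) r|lborel. ln (max r (cmod w))) + (LINT w:ball 0 1 - ball 0 r|lborel. ln (max r (cmod w)))"
        using set_integral_Un[of "ball 0 r" "ball 0 1 - ball 0 r" lborel "\<lambda>w. ln (max r (cmod w))"] i1 i2 sub
        by (simp add: c1 c2 Un_absorb1)
      also have "(LINT w:ball (0::complex) r|lborel. ln (max r (cmod w))) = (LINT w:ball (0::complex) r|lborel. ln r)"
        by (intro set_lebesgue_integral_cong) (auto simp: max_def)
      also have "\<dots> = pi * r\<^sup>2 * ln r" using r by (simp add: set_lebesgue_integral_def measure_ball_complex)
      also have "(LINT w:ball 0 1 - ball 0 r|lborel. ln (max r (cmod w))) = (LINT w:ball 0 1 - ball 0 r|lborel. ln (cmod w))"
        by (intro set_lebesgue_integral_cong) (auto simp: max_def)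
      finally show ?thesis using r unfolding e1
        by (simp add: disc_potential_def r_def[symmetric] algebra_simps)
    qed
  qed
  finally show ?thesis by simp
qed

section \<open>Annular means and logarithmic cutoffs\<close>

definition annulus :: "complex \<Rightarrow> real \<Rightarrow> real \<Rightarrow> complex set" where
  "annulus u0 a b = {v. a \<le> cmod (v - u0) \<and> cmod (v - u0) < b}"

lemma annulus_eq_Diff: "annulus u0 a b = ball u0 b - ball u0 a"
  by (auto simp: annulus_def dist_norm norm_minus_commute)

lemma annulus_borel [measurable]: "annulus u0 a b \<in> sets borel"
  by (simp add: annulus_eq_Diff)

lemma bounded_annulus: "bounded (annulus u0 a b)"
  unfolding annulus_eq_Diff by (rule bounded_subset[OF bounded_ball]) auto

lemma measure_annulus:
  assumes "0 \<le> a" "a \<le> b"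
  shows "measure lborel (annulus u0 a b) = pi * (b\<^sup>2 - a\<^sup>2)"
    and "emeasure lborel (annulus u0 a b) = ennreal (pi * (b\<^sup>2 - a\<^sup>2))"
proof -
  have "emeasure lborel (annulus u0 a b) = emeasure lborel (ball u0 b) - emeasure lborel (ball u0 a)"
    unfolding annulus_eq_Diff using assms
    by (intro emeasure_Diff) (auto simp: measure_ball_complex intro: subset_ball)
  also have "\<dots> = ennreal (pi * b\<^sup>2 - pi * a\<^sup>2)"
    using assms by (simp add: measure_ball_complex ennreal_minus)
  finally show *: "emeasure lborel (annulus u0 a b) = ennreal (pi * (b\<^sup>2 - a\<^sup>2))" by (simp add: algebra_simps)
  show "measure lborel (annulus u0 a b) = pi * (b\<^sup>2 - a\<^sup>2)"
    unfolding measure_def * using assms by (simp add: power_mono)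
qed

definition annulus_mean :: "complex \<Rightarrow> real \<Rightarrow> real \<Rightarrow> (complex \<Rightarrow> real) \<Rightarrow> real" where
  "annulus_mean u0 a b F = (LINT v:annulus u0 a b|lborel. F v) / (pi * (b\<^sup>2 - a\<^sup>2))"

lemma annulus_mean_const:
  assumes "0 \<le> a" "a < b"
  shows "annulus_mean u0 a b (\<lambda>_. c) = c"
proof -
  have "b\<^sup>2 - a\<^sup>2 > 0" using assms by (simp add: power_strict_mono)
  thus ?thesis using assms
    by (simp add: annulus_mean_def set_lebesgue_integral_def measure_annulus)
qed

lemma set_integrable_annulus_const:
  "set_integrable lborel (annulus u0 a b) (\<lambda>_. c :: real)"
  using emeasure_bounded_finite[OF bounded_annulus[of u0 a b]]
  by (simp add: set_integrable_def)

lemma annulus_mean_cong: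
  assumes "\<And>v. v \<in> annulus u0 a b \<Longrightarrow> F v = G v"
  shows "annulus_mean u0 a b F = annulus_mean u0 a b G"
  unfolding annulus_mean_def set_lebesgue_integral_def
  using assms by (intro arg_cong2[of _ _ _ _ "(/)"] Bochner_Integration.integral_cong) (auto simp: indicator_def)

lemma annulus_mean_mono:
  assumes "0 \<le> a" "a < b"
    "set_integrable lborel (annulus u0 a b) F" "set_integrable lborel (annulus u0 a b) G"
    "\<And>v. v \<in> annulus u0 a b \<Longrightarrow> F v \<le> G v"
  shows "annulus_mean u0 a b F \<le> annulus_mean u0 a b G"
proof -
  have "b\<^sup>2 - a\<^sup>2 > 0" using assms by (simp add: power_strict_mono)
  thus ?thesis unfolding annulus_mean_def
    using assms by (intro divide_right_mono set_integral_mono) auto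
qed

lemma annulus_mean_diff:
  assumes "set_integrable lborel (annulus u0 a b) F" "set_integrable lborel (annulus u0 a b) G"
  shows "annulus_mean u0 a b (\<lambda>v. F v - G v) = annulus_mean u0 a b F - annulus_mean u0 a b G"
  using assms by (simp add: annulus_mean_def set_integral_diff diff_divide_distrib)

lemma annulus_mean_bounds:
  assumes "0 \<le> a" "a < b" "set_integrable lborel (annulus u0 a b) F"
  shows "(\<And>v. v \<in> annulus u0 a b \<Longrightarrow> F v \<le> c) \<Longrightarrow> annulus_mean u0 a b F \<le> c"
    and "(\<And>v. v \<in> annulus u0 a b \<Longrightarrow> c \<le> F v) \<Longrightarrow> c \<le> annulus_mean u0 a b F"
  using annulus_mean_mono[OF assms(1,2,3) set_integrable_annulus_const[of _ _ _ c]]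
    annulus_mean_mono[OF assms(1,2) set_integrable_annulus_const[of _ _ _ c] assms(3)]
    annulus_mean_const[OF assms(1,2), of u0 c] by auto

lemma set_integrable_annulus_log_max:
  assumes "0 < a" "0 \<le> d"
  shows "set_integrable lborel (annulus u0 a b) (\<lambda>v. ln (max d (cmod (v - u0))))"
proof (rule set_integrable_bound[OF set_integrable_annulus_const[of u0 a b "\<bar>ln a\<bar> + \<bar>ln (max d b)\<bar>"]])
  show "AE v in lborel. v \<in> annulus u0 a b \<longrightarrow> norm (ln (max d (cmod (v - u0)))) \<le> norm (\<bar>ln a\<bar> + \<bar>ln (max d b)\<bar>)"
  proof (intro AE_I2 impI)
    fix v assume v: "v \<in> annulus u0 a b"
    hence "ln a \<le> ln (max d (cmod (v - u0)))" "ln (max d (cmod (v - u0))) \<le> ln (max d b)"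
      using assms by (auto simp: annulus_def)
    thus "norm (ln (max d (cmod (v - u0)))) \<le> norm (\<bar>ln a\<bar> + \<bar>ln (max d b)\<bar>)" by simp
  qed
qed (simp add: set_borel_measurable_def)

lemma annulus_mean_log:
  "annulus_mean u0 a b (\<lambda>v. ln (cmod (u - v))) =
   annulus_mean u0 a b (\<lambda>v. ln (max (cmod (u - u0)) (cmod (v - u0))))"
  unfolding annulus_mean_def
  by (subst radial_log_integral[of _ u0]) (auto simp: bounded_annulus, simp add: annulus_def)

text \<open>A continuous substitute for the indicator function of the disc of radius \<open>R\<close> about \<open>u0\<close>, up to the
constant factor \<open>cutoff u0 R h u0\<close>. Being a difference of logarithmic potentials, its integral against
any measure is read off from the potential of that measure. The gap between the two annuli keeps the
constant factor of order \<open>h / R\<close>.\<close>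
definition cutoff :: "complex \<Rightarrow> real \<Rightarrow> real \<Rightarrow> complex \<Rightarrow> real" where
  "cutoff u0 R h u = annulus_mean u0 (R + 2 * h) (R + 3 * h) (\<lambda>v. ln (cmod (u - v)))
                    - annulus_mean u0 R (R + h) (\<lambda>v. ln (cmod (u - v)))"

context
  fixes R h :: real and u0 :: complex
  assumes R: "R > 0" and h: "h > 0"
begin

lemma cutoff_outside:
  assumes "cmod (u - u0) \<ge> R + 3 * h"
  shows "cutoff u0 R h u = 0"
proof -
  have "annulus_mean u0 a b (\<lambda>v. ln (cmod (u - v))) = ln (cmod (u - u0))"
    if "0 \<le> a" "a < b" "b \<le> R + 3 * h" for a b
  proof -
    have "annulus_mean u0 a b (\<lambda>v. ln (cmod (u - v))) = annulus_mean u0 a b (\<lambda>v. ln (cmod (u - u0)))"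
      unfolding annulus_mean_log using that assms
      by (intro annulus_mean_cong) (auto simp: annulus_def max_def)
    thus ?thesis using that by (simp add: annulus_mean_const)
  qed
  thus ?thesis using R h by (simp add: cutoff_def)
qed

lemma cutoff_inside:
  assumes "cmod (u - u0) \<le> R"
  shows "cutoff u0 R h u = cutoff u0 R h u0"
proof -
  have "annulus_mean u0 a b (\<lambda>v. ln (cmod (u - v))) = annulus_mean u0 a b (\<lambda>v. ln (cmod (u0 - v)))"
    if "R \<le> a" for a b
    unfolding annulus_mean_log using that assms
    by (intro annulus_mean_cong) (auto simp: annulus_def max_def)
  thus ?thesis using R h by (simp add: cutoff_def)
qed

lemma cutoff_nonneg: "0 \<le> cutoff u0 R h u"
proof -
  define d where "d = cmod (u - u0)"
  have d: "d \<ge> 0" by (simp add: d_def)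
  have "annulus_mean u0 R (R + h) (\<lambda>v. ln (cmod (u - v))) \<le> ln (max d (R + h))"
    unfolding annulus_mean_log d_def[symmetric] using R h d
    by (intro annulus_mean_bounds set_integrable_annulus_log_max) (auto simp: annulus_def)
  moreover have "annulus_mean u0 (R + 2 * h) (R + 3 * h) (\<lambda>v. ln (cmod (u - v))) \<ge> ln (max d (R + h))"
    unfolding annulus_mean_log d_def[symmetric] using R h d
    by (intro annulus_mean_bounds set_integrable_annulus_log_max) (auto simp: annulus_def)
  ultimately show ?thesis by (simp add: cutoff_def)
qed

text \<open>Relative to the centre, each logarithm gains \<open>ln (max d s) - ln s\<close>, which decreases in \<open>s\<close>; so the outer
annulus gains at most as much as the inner one.\<close>
lemma cutoff_le: "cutoff u0 R h u \<le> cutoff u0 R h u0"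
proof -
  define d where "d = cmod (u - u0)"
  have d: "d \<ge> 0" by (simp add: d_def)
  define q where "q = ln (max d (R + h)) - ln (R + h)"
  have ratio: "ln (max d s) - ln s \<le> ln (max d r) - ln r" if "0 < r" "r \<le> s" for r s
  proof -
    have "ln (max d s) + ln r = ln (max d s * r)" using that by (simp add: ln_mult)
    also have "max d s * r \<le> max d r * s"
      using that d by (auto simp: max_def mult_mono algebra_simps intro: mult_right_mono mult_left_mono)
    hence "ln (max d s * r) \<le> ln (max d r * s)" using that d by (subst ln_le_cancel_iff) auto
    also have "\<dots> = ln (max d r) + ln s" using that by (simp add: ln_mult)
    finally show ?thesis by simp
  qed
  have int: "set_integrable lborel (annulus u0 a b) (\<lambda>v. ln (cmod (v - u0)))" if "0 < a" for a b
    using set_integrable_annulus_log_max[OF that, of 0 u0 b] by simp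
  have mean: "annulus_mean u0 a b (\<lambda>v. ln (cmod (u - v))) - annulus_mean u0 a b (\<lambda>v. ln (cmod (u0 - v)))
     = annulus_mean u0 a b (\<lambda>v. ln (max d (cmod (v - u0))) - ln (cmod (v - u0)))" if "0 < a" for a b
    unfolding annulus_mean_log d_def[symmetric]
    by (subst annulus_mean_diff) (use that d in \<open>auto intro!: set_integrable_annulus_log_max int\<close>)
  have "q \<le> annulus_mean u0 R (R + h) (\<lambda>v. ln (cmod (u - v))) - annulus_mean u0 R (R + h) (\<lambda>v. ln (cmod (u0 - v)))"
    unfolding mean[OF R] using R h d
    by (intro annulus_mean_bounds set_integral_diff set_integrable_annulus_log_max int)
       (auto simp: annulus_def q_def intro!: ratio)
  moreover have "annulus_mean u0 (R + 2 * h) (R + 3 * h) (\<lambda>v. ln (cmod (u - v))) - annulus_mean u0 (R + 2 * h) (R + 3 * h) (\<lambda>v. ln (cmod (u0 - v))) \<le> q"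
    using R h d
    by (subst mean, simp, intro annulus_mean_bounds set_integral_diff set_integrable_annulus_log_max int)
       (auto simp: annulus_def q_def intro!: ratio)
  ultimately show ?thesis by (simp add: cutoff_def)
qed

lemma cutoff_centre_ge: "h / (R + 2 * h) \<le> cutoff u0 R h u0"
proof -
  have "annulus_mean u0 R (R + h) (\<lambda>v. ln (cmod (u0 - v))) \<le> ln (R + h)"
    unfolding annulus_mean_log using R h
    by (intro annulus_mean_bounds set_integrable_annulus_log_max)
       (auto simp: annulus_def intro!: ln_le_cancel_iff[THEN iffD2])
  moreover have "annulus_mean u0 (R + 2 * h) (R + 3 * h) (\<lambda>v. ln (cmod (u0 - v))) \<ge> ln (R + 2 * h)"
    unfolding annulus_mean_log using R h
    by (intro annulus_mean_bounds set_integrable_annulus_log_max) (auto simp: annulus_def intro!: ln_le_cancel_iff[THEN iffD2] add_pos_pos)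
  moreover have "ln (R + h) - ln (R + 2 * h) = ln ((R + h) / (R + 2 * h))" using R h by (simp add: ln_div)
  moreover have "\<dots> \<le> (R + h) / (R + 2 * h) - 1" using R h by (intro ln_le_minus_one) auto
  moreover have "\<dots> = - (h / (R + 2 * h))" using R h by (simp add: field_simps)
  ultimately show ?thesis by (simp add: cutoff_def)
qed

end

lemma set_integrable_annulus_log:
  "set_integrable lborel (annulus u0 a b) (\<lambda>v. ln (cmod (u - v)))"
  by (rule set_integrable_log) (auto simp: bounded_annulus)

section \<open>Root sums\<close>

definition root_sum :: "complex poly \<Rightarrow> (complex \<Rightarrow> real) \<Rightarrow> real" where
  "root_sum p g = (\<Sum>w | poly p w = 0. of_nat (order w p) * g w)"

lemma ln_cmod_poly:
  assumes "poly p v \<noteq> 0"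
  shows "ln (cmod (poly p v)) = ln (cmod (lead_coeff p)) + root_sum p (\<lambda>w. ln (cmod (v - w)))"
proof -
  have p: "p \<noteq> 0" using assms by auto
  let ?Z = "{w. poly p w = 0}"
  have fin: "finite ?Z" by (rule poly_roots_finite[OF p])
  have ne: "v \<noteq> w" if "w \<in> ?Z" for w using that assms by auto
  have "poly p v = lead_coeff p * (\<Prod>w\<in>?Z. (v - w) ^ order w p)"
    by (subst complex_poly_decompose[symmetric]) (simp add: poly_prod)
  hence "cmod (poly p v) = cmod (lead_coeff p) * (\<Prod>w\<in>?Z. cmod (v - w) ^ order w p)"
    by (simp add: norm_mult norm_power flip: prod_norm)
  moreover have "(\<Prod>w\<in>?Z. cmod (v - w) ^ order w p) > 0"
    using ne by (intro prod_pos) auto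
  moreover have "ln (\<Prod>w\<in>?Z. cmod (v - w) ^ order w p) = (\<Sum>w\<in>?Z. ln (cmod (v - w) ^ order w p))"
    by (rule ln_prod) (use ne in \<open>auto simp: fin\<close>)
  moreover have "\<dots> = root_sum p (\<lambda>w. ln (cmod (v - w)))"
    unfolding root_sum_def using ne by (intro sum.cong) (auto simp: ln_realpow)
  ultimately show ?thesis using p by (simp add: ln_mult)
qed

lemma measure_zeros_measure:
  assumes "A \<in> sets borel"
  shows "measure (zeros_measure n p) A = root_sum p (indicator A) / real n"
proof (cases "n = 0")
  case True
  thus ?thesis using emeasure_zeros_measure[OF assms, of n p] by (simp add: measure_def)
next
  case False
  have "(\<Sum>w | poly p w = 0. of_nat (order w p) * indicator A w) = ennreal (root_sum p (indicator A))"
    unfolding root_sum_def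
    by (subst sum_ennreal[symmetric])
       (auto intro!: sum.cong simp: ennreal_mult ennreal_indicator ennreal_of_nat_eq_real_of_nat)
  moreover have nn: "root_sum p (indicator A) \<ge> 0"
    unfolding root_sum_def by (intro sum_nonneg) auto
  ultimately have "emeasure (zeros_measure n p) A = ennreal (1 / real n * root_sum p (indicator A))"
    by (subst ennreal_mult) (simp_all add: emeasure_zeros_measure[OF assms])
  with nn show ?thesis by (simp add: measure_def)
qed

lemma AE_poly_nonzero:
  fixes p :: "complex poly"
  assumes "p \<noteq> 0"
  shows "AE v in lborel. poly p v \<noteq> 0"
proof -
  have "{v. poly p v = 0} \<in> null_sets lborel"
    by (rule finite_imp_null_set_lborel) (rule poly_roots_finite[OF assms])
  from AE_not_in[OF this] show ?thesis by simp
qed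

lemma annulus_mean_cong_AE:
  assumes [measurable]: "F \<in> borel_measurable borel" "G \<in> borel_measurable borel"
    and "AE v in lborel. F v = G v"
  shows "annulus_mean u0 a b F = annulus_mean u0 a b G"
proof -
  have "(LINT v:annulus u0 a b|lborel. F v) = (LINT v:annulus u0 a b|lborel. G v)"
    unfolding set_lebesgue_integral_def using assms(3)
    by (intro integral_cong_AE) (auto elim!: eventually_mono)
  thus ?thesis by (simp add: annulus_mean_def)
qed

lemma annulus_mean_sum:
  assumes "\<And>i. i \<in> I \<Longrightarrow> set_integrable lborel (annulus u0 a b) (F i)"
  shows "annulus_mean u0 a b (\<lambda>v. \<Sum>i\<in>I. c i * F i v) = (\<Sum>i\<in>I. c i * annulus_mean u0 a b (F i))"
proof -
  have "(LINT v:annulus u0 a b|lborel. (\<Sum>i\<in>I. c i * F i v)) = (\<Sum>i\<in>I. LINT v:annulus u0 a b|lborel. c i * F i v)"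
    unfolding set_lebesgue_integral_def scaleR_sum_right
    using assms by (intro Bochner_Integration.integral_sum) (auto simp: set_integrable_def mult.left_commute)
  thus ?thesis by (simp add: annulus_mean_def sum_divide_distrib)
qed

text \<open>Jensen's formula in the form used here: both annular means contain the logarithm of the leading
coefficient, which cancels.\<close>
lemma root_sum_cutoff:
  assumes p: "p \<noteq> 0" and R: "R > 0" and h: "h > 0"
  shows "root_sum p (cutoff u0 R h) =
     annulus_mean u0 (R + 2 * h) (R + 3 * h) (\<lambda>v. ln (cmod (poly p v)))
     - annulus_mean u0 R (R + h) (\<lambda>v. ln (cmod (poly p v)))"
proof -
  have mean: "annulus_mean u0 a b (\<lambda>v. ln (cmod (poly p v))) =
     ln (cmod (lead_coeff p)) + root_sum p (\<lambda>w. annulus_mean u0 a b (\<lambda>v. ln (cmod (w - v))))"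
    if "0 < a" "a < b" for a b
  proof -
    have "annulus_mean u0 a b (\<lambda>v. ln (cmod (poly p v))) =
        annulus_mean u0 a b (\<lambda>v. root_sum p (\<lambda>w. ln (cmod (w - v))) - (- ln (cmod (lead_coeff p))))"
    proof (rule annulus_mean_cong_AE)
      have [measurable]: "poly p \<in> borel_measurable borel"
        by (intro borel_measurable_continuous_onI continuous_intros)
      show "(\<lambda>v. ln (cmod (poly p v))) \<in> borel_measurable borel" by measurable
      show "(\<lambda>v. root_sum p (\<lambda>w. ln (cmod (w - v))) - - ln (cmod (lead_coeff p))) \<in> borel_measurable borel"
        unfolding root_sum_def by measurable
      show "AE v in lborel. ln (cmod (poly p v)) = root_sum p (\<lambda>w. ln (cmod (w - v))) - - ln (cmod (lead_coeff p))"
        using AE_poly_nonzero[OF p]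
        by eventually_elim (subst ln_cmod_poly, auto simp: norm_minus_commute)
    qed
    also have "\<dots> = annulus_mean u0 a b (\<lambda>v. root_sum p (\<lambda>w. ln (cmod (w - v)))) - (- ln (cmod (lead_coeff p)))"
    proof (subst annulus_mean_diff)
      show "set_integrable lborel (annulus u0 a b) (\<lambda>v. root_sum p (\<lambda>w. ln (cmod (w - v))))"
        unfolding root_sum_def using set_integrable_annulus_log
        by (auto simp: set_integrable_def sum_distrib_left mult.left_commute)
    qed (use that in \<open>auto simp: set_integrable_annulus_const annulus_mean_const\<close>)
    also have "annulus_mean u0 a b (\<lambda>v. root_sum p (\<lambda>w. ln (cmod (w - v)))) =
       root_sum p (\<lambda>w. annulus_mean u0 a b (\<lambda>v. ln (cmod (w - v))))"
      unfolding root_sum_def by (intro annulus_mean_sum set_integrable_annulus_log)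
    finally show ?thesis by simp
  qed
  show ?thesis using R h
    by (simp add: mean) (simp add: root_sum_def cutoff_def right_diff_distrib sum_subtractf)
qed

section \<open>Measurability of the discrepancy\<close>

text \<open>The cutoffs live inside the disc of radius \<open>R\<close> so that the limit is the indicator function of the open
disc, also on the boundary circle.\<close>
lemma cutoff_tendsto_indicator:
  fixes u0 :: complex
  assumes R: "R > 0"
  defines "h \<equiv> \<lambda>j::nat. R / (4 + real j)"
  shows "(\<lambda>j. cutoff u0 (R - 3 * h j) (h j) u / cutoff u0 (R - 3 * h j) (h j) u0) \<longlonglongrightarrow> indicator (ball u0 R) u"
proof -
  have h: "h j > 0" "R - 3 * h j > 0" for j
    using R by (auto simp: h_def field_simps add_pos_nonneg)
  have h0: "h \<longlonglongrightarrow> 0" unfolding h_def by real_asymp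
  have pos: "cutoff u0 (R - 3 * h j) (h j) u0 > 0" for j
  proof -
    have "h j / (R - 3 * h j + 2 * h j) > 0" using h[of j] by (intro divide_pos_pos) auto
    with cutoff_centre_ge[OF h(2)[of j] h(1)[of j], of u0] show ?thesis by linarith
  qed
  show ?thesis
  proof (cases "cmod (u - u0) < R")
    case True
    have "(\<lambda>j. R - 3 * h j) \<longlonglongrightarrow> R - 3 * 0" by (intro tendsto_intros h0)
    hence "\<forall>\<^sub>F j in sequentially. cmod (u - u0) < R - 3 * h j"
      using True by (intro order_tendstoD(1)) auto
    hence "\<forall>\<^sub>F j in sequentially. 1 = cutoff u0 (R - 3 * h j) (h j) u / cutoff u0 (R - 3 * h j) (h j) u0"
    proof eventually_elim
      case (elim j)
      thus ?case using cutoff_inside[OF h(2)[of j] h(1)[of j], of u u0] pos[of j] by simp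
    qed
    hence "(\<lambda>j. cutoff u0 (R - 3 * h j) (h j) u / cutoff u0 (R - 3 * h j) (h j) u0) \<longlonglongrightarrow> 1"
      by (rule tendsto_eventually[OF eventually_mono]) simp
    thus ?thesis using True by (simp add: dist_norm norm_minus_commute)
  next
    case False
    have "cutoff u0 (R - 3 * h j) (h j) u = 0" for j
      using False by (intro cutoff_outside h) auto
    thus ?thesis using False by (simp add: dist_norm norm_minus_commute)
  qed
qed

text \<open>The formula also holds for the zero polynomial: there the zero measure is the null measure by definition,
and \<open>ln 0 = 0\<close>.\<close>
lemma measure_zeros_ball_limit:
  assumes R: "R > 0"
  defines "h \<equiv> \<lambda>j::nat. R / (4 + real j)"
  shows "(\<lambda>j. (annulus_mean u0 (R - 3 * h j + 2 * h j) (R - 3 * h j + 3 * h j) (\<lambda>v. ln (cmod (poly p v)))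
             - annulus_mean u0 (R - 3 * h j) (R - 3 * h j + h j) (\<lambda>v. ln (cmod (poly p v))))
             / cutoff u0 (R - 3 * h j) (h j) u0 / real n)
          \<longlonglongrightarrow> measure (zeros_measure n p) (ball u0 R)"
proof (cases "p = 0")
  case True
  have "infinite (UNIV :: complex set)" by (rule infinite_UNIV_char_0)
  hence "measure (zeros_measure n p) (ball u0 R) = 0"
    using True by (simp add: measure_zeros_measure root_sum_def)
  thus ?thesis using True by (simp add: annulus_mean_def)
next
  case False
  have h: "h j > 0" "R - 3 * h j > 0" for j
    using R by (auto simp: h_def field_simps add_pos_nonneg)
  have "(\<lambda>j. root_sum p (\<lambda>u. cutoff u0 (R - 3 * h j) (h j) u / cutoff u0 (R - 3 * h j) (h j) u0) / real n) \<longlonglongrightarrow>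
      root_sum p (indicator (ball u0 R)) / real n"
    unfolding root_sum_def h_def divide_inverse[of _ "real n"]
    by (intro tendsto_intros cutoff_tendsto_indicator[OF R])
  moreover have "root_sum p (\<lambda>u. cutoff u0 (R - 3 * h j) (h j) u / cutoff u0 (R - 3 * h j) (h j) u0) =
     root_sum p (cutoff u0 (R - 3 * h j) (h j)) / cutoff u0 (R - 3 * h j) (h j) u0" for j
    by (simp add: root_sum_def sum_divide_distrib)
  ultimately show ?thesis
    by (simp add: measure_zeros_measure root_sum_cutoff[OF False h(2) h(1)])
qed

lemma borel_measurable_zeros_ball:
  fixes a :: "nat \<Rightarrow> 'a \<Rightarrow> complex"
  assumes [measurable]: "\<And>k. a k \<in> borel_measurable M" and R: "R > 0"
  shows "(\<lambda>\<omega>. measure (zeros_measure n (weyl_poly n (\<lambda>k. a k \<omega>))) (ball u0 R)) \<in> borel_measurable M"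
proof -
  have [measurable]: "(\<lambda>\<omega>. annulus_mean u0 s t (\<lambda>v. ln (cmod (poly (weyl_poly n (\<lambda>k. a k \<omega>)) v)))) \<in> borel_measurable M" for s t
    unfolding annulus_mean_def set_lebesgue_integral_def poly_weyl_poly by measurable
  show ?thesis
    by (rule borel_measurable_LIMSEQ_real[OF measure_zeros_ball_limit[OF R]]) measurable
qed

lemma disc_discrepancy_le_iff:
  assumes "finite_measure \<mu>" "finite_measure \<nu>"
  shows "disc_discrepancy \<mu> \<nu> \<le> t \<longleftrightarrow> (\<forall>z. \<forall>R>0. \<bar>measure \<mu> (ball z R) - measure \<nu> (ball z R)\<bar> \<le> t)"
  unfolding disc_discrepancy_def
  by (subst cSUP_le_iff[OF _ bdd_above_disc_discrepancy[OF assms]]) auto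

text \<open>An open disc is the limit of discs inside it with centres in \<open>D\<close> and rational radii, and finite measures
are continuous along such a sequence.\<close>
lemma measure_ball_approx:
  fixes D :: "complex set"
  assumes \<mu>: "finite_measure \<mu>" "sets \<mu> = sets borel" and \<nu>: "finite_measure \<nu>" "sets \<nu> = sets borel"
    and D: "\<And>x e. e > 0 \<Longrightarrow> \<exists>d\<in>D. dist d x < e"
    and le: "\<And>z R. z \<in> D \<Longrightarrow> R \<in> \<rat> \<Longrightarrow> R > 0 \<Longrightarrow> \<bar>measure \<mu> (ball z R) - measure \<nu> (ball z R)\<bar> \<le> t"
    and R: "R > 0"
  shows "\<bar>measure \<mu> (ball z R) - measure \<nu> (ball z R)\<bar> \<le> t"
proof -
  define e where "e = (\<lambda>j::nat. R / (4 + real j))"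
  have e: "e j > 0" "R - 3 * e j > 0" for j
    using R by (auto simp: e_def field_simps add_pos_nonneg)
  have e0: "e \<longlonglongrightarrow> 0" unfolding e_def by real_asymp
  have "\<exists>d\<in>D. dist d z < e j" for j using D e by blast
  then obtain zz where zz: "\<And>j. zz j \<in> D" "\<And>j. dist (zz j) z < e j" by metis
  have "\<exists>r\<in>\<rat>. R - 2 * e j < r \<and> r < R - e j" for j
    using Rats_dense_in_real[of "R - 2 * e j" "R - e j"] e(1)[of j] by auto
  then obtain r where r: "\<And>j. r j \<in> \<rat>" "\<And>j. R - 2 * e j < r j" "\<And>j. r j < R - e j" by metis
  have rpos: "r j > 0" for j using r(2)[of j] e[of j] by linarith
  have conv: "(\<lambda>j. measure m (ball (zz j) (r j))) \<longlonglongrightarrow> measure m (ball z R)"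
    if m: "finite_measure m" "sets m = sets borel" for m :: "complex measure"
  proof -
    interpret finite_measure m by fact
    have sp: "space m = UNIV" using sets_eq_imp_space_eq[OF m(2)] by simp
    have "(\<lambda>j. integral\<^sup>L m (indicator (ball (zz j) (r j)) :: complex \<Rightarrow> real)) \<longlonglongrightarrow> integral\<^sup>L m (indicator (ball z R))"
    proof (rule integral_dominated_convergence[where w = "\<lambda>_. 1"])
      show "AE x in m. (\<lambda>j. indicator (ball (zz j) (r j)) x :: real) \<longlonglongrightarrow> indicator (ball z R) x"
      proof (rule AE_I2)
        fix x
        show "(\<lambda>j. indicator (ball (zz j) (r j)) x :: real) \<longlonglongrightarrow> indicator (ball z R) x"
        proof (cases "dist z x < R")
          case True
          have "(\<lambda>j. R - 3 * e j) \<longlonglongrightarrow> R - 3 * 0" by (intro tendsto_intros e0)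
          hence "\<forall>\<^sub>F j in sequentially. dist z x < R - 3 * e j"
            using True by (intro order_tendstoD(1)) auto
          hence "\<forall>\<^sub>F j in sequentially. (indicator (ball (zz j) (r j)) x :: real) = 1"
          proof eventually_elim
            case (elim j)
            thus ?case using dist_triangle[of "zz j" x z] zz(2)[of j] r(2)[of j] by (simp add: indicator_def)
          qed
          thus ?thesis using True by (simp add: tendsto_eventually)
        next
          case False
          have "x \<notin> ball (zz j) (r j)" for j
            using False dist_triangle[of z x "zz j"] zz(2)[of j] r(3)[of j] by (simp add: dist_commute)
          thus ?thesis using False by simp
        qed
      qed
      show "(\<lambda>x. indicator (ball z R) x :: real) \<in> borel_measurable m"
        "(\<lambda>x. indicator (ball (zz j) (r j)) x :: real) \<in> borel_measurable m" for j
        by (rule borel_measurable_indicator, simp add: m)+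
    qed (auto simp: indicator_def)
    thus ?thesis by (simp add: m sp)
  qed
  have "(\<lambda>j. \<bar>measure \<mu> (ball (zz j) (r j)) - measure \<nu> (ball (zz j) (r j))\<bar>) \<longlonglongrightarrow>
      \<bar>measure \<mu> (ball z R) - measure \<nu> (ball z R)\<bar>"
    by (intro tendsto_intros conv \<mu> \<nu>)
  thus ?thesis
    by (rule LIMSEQ_le_const2) (use le zz r rpos in blast)
qed

lemma discrepancy_event_measurable:
  fixes a :: "nat \<Rightarrow> 'a \<Rightarrow> complex"
  assumes [measurable]: "\<And>k. a k \<in> borel_measurable M"
  shows "{\<omega> \<in> space M. disc_discrepancy (zeros_measure n (weyl_poly n (\<lambda>k. a k \<omega>))) uniform_disc \<le> t} \<in> sets M"
proof -
  obtain D :: "complex set" where D: "countable D" "\<And>X. open X \<Longrightarrow> X \<noteq> {} \<Longrightarrow> \<exists>d\<in>D. d \<in> X"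
    using countable_dense_setE by blast
  have D': "\<exists>d\<in>D. dist d x < e" if "e > 0" for x e
    using D(2)[of "ball x e"] that by (auto simp: dist_commute)
  let ?\<mu> = "\<lambda>\<omega>. zeros_measure n (weyl_poly n (\<lambda>k. a k \<omega>))"
  have fin: "finite_measure (zeros_measure n p)" "finite_measure uniform_disc" for p
    using finite_measure_zeros_measure prob_space_uniform_disc by (auto intro: prob_space.finite_measure)
  have "{\<omega> \<in> space M. disc_discrepancy (?\<mu> \<omega>) uniform_disc \<le> t} =
     {\<omega> \<in> space M. \<forall>z\<in>D. \<forall>R\<in>\<rat>. R > 0 \<longrightarrow> \<bar>measure (?\<mu> \<omega>) (ball z R) - measure uniform_disc (ball z R)\<bar> \<le> t}"
    unfolding disc_discrepancy_le_iff[OF fin]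
    using measure_ball_approx[OF fin(1) _ fin(2), where D = D and t = t] D' by (auto simp: uniform_disc_def)
  also have "\<dots> \<in> sets M"
  proof -
    have meas: "{\<omega> \<in> space M. R > 0 \<longrightarrow> \<bar>measure (?\<mu> \<omega>) (ball z R) - measure uniform_disc (ball z R)\<bar> \<le> t} \<in> sets M" for z R
    proof (cases "R > 0")
      case True
      have [measurable]: "(\<lambda>\<omega>. measure (?\<mu> \<omega>) (ball z R)) \<in> borel_measurable M"
        by (rule borel_measurable_zeros_ball[OF _ True]) measurable
      show ?thesis by measurable
    qed simp
    show ?thesis
      by (rule sets.sets_Collect_countable_All'[OF sets.sets_Collect_countable_All'[OF meas countable_rat] D(1)])
  qed
  finally show ?thesis .
qed

section \<open>Square grids and mean values\<close>

lemma set_integrable_ball_log_max: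
  assumes "0 < d"
  shows "set_integrable lborel (ball c r) (\<lambda>v. ln (max d (cmod (v - c))))"
proof -
  have "set_integrable lborel (ball c r) (\<lambda>v. \<bar>ln d\<bar> + \<bar>ln (max d r)\<bar>)"
    unfolding set_integrable_def using emeasure_bounded_finite[OF bounded_ball, of c r]
    by (intro integrable_scaleR_left integrable_real_indicator) auto
  moreover have [measurable]: "ball c r \<in> sets borel" by simp
  ultimately show ?thesis
  proof (rule_tac set_integrable_bound)
    show "AE v in lborel. v \<in> ball c r \<longrightarrow> norm (ln (max d (cmod (v - c)))) \<le> norm (\<bar>ln d\<bar> + \<bar>ln (max d r)\<bar>)"
    proof (intro AE_I2 impI)
      fix v assume "v \<in> ball c r"
      hence "ln d \<le> ln (max d (cmod (v - c)))" "ln (max d (cmod (v - c))) \<le> ln (max d r)"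
        using assms by (auto simp: dist_norm norm_minus_commute)
      thus "norm (ln (max d (cmod (v - c)))) \<le> norm (\<bar>ln d\<bar> + \<bar>ln (max d r)\<bar>)" by simp
    qed
  qed (unfold set_borel_measurable_def, measurable)
qed

text \<open>The lower bound is the mean value inequality for \<open>ln |v - \<tau>|\<close>. The upper bound measures its defect, which
vanishes unless \<open>\<tau>\<close> lies in the disc.\<close>
lemma ball_log_mean_bounds:
  fixes c \<tau> :: complex
  assumes r: "r > 0" and ne: "\<tau> \<noteq> c"
  shows "pi * r\<^sup>2 * ln (cmod (c - \<tau>)) \<le> (LINT v:ball c r|lborel. ln (cmod (v - \<tau>)))"
    and "(LINT v:ball c r|lborel. ln (cmod (v - \<tau>))) \<le>
      pi * r\<^sup>2 * (ln (cmod (c - \<tau>)) + ln (max 1 (r / cmod (\<tau> - c))))"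
proof -
  define d where "d = cmod (\<tau> - c)"
  have d: "d > 0" using ne by (simp add: d_def)
  have eq: "(LINT v:ball c r|lborel. ln (cmod (v - \<tau>))) = (LINT v:ball c r|lborel. ln (max d (cmod (v - c))))"
    using radial_log_integral[of "ball c r" c \<tau>]
    by (simp add: d_def dist_norm norm_minus_commute)
  have const: "(LINT v:ball c r|lborel. k) = pi * r\<^sup>2 * k" "set_integrable lborel (ball c r) (\<lambda>_. k)" for k :: real
    using r by (simp_all add: set_lebesgue_integral_def set_integrable_def measure_ball_complex)
  have "(LINT v:ball c r|lborel. ln d) \<le> (LINT v:ball c r|lborel. ln (max d (cmod (v - c))))"
    using d by (intro set_integral_mono const set_integrable_ball_log_max) auto
  thus "pi * r\<^sup>2 * ln (cmod (c - \<tau>)) \<le> (LINT v:ball c r|lborel. ln (cmod (v - \<tau>)))"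
    by (simp add: eq const d_def norm_minus_commute)
  have "(LINT v:ball c r|lborel. ln (max d (cmod (v - c)))) \<le> (LINT v:ball c r|lborel. ln (max d r))"
    using d by (intro set_integral_mono const set_integrable_ball_log_max)
      (auto simp: dist_norm norm_minus_commute)
  also have "\<dots> = pi * r\<^sup>2 * ln (max d r)" by (simp add: const)
  also have "max d r = d * max 1 (r / d)" using d by (auto simp: max_def field_simps)
  also have "ln \<dots> = ln d + ln (max 1 (r / d))" using d by (subst ln_mult) auto
  finally show "(LINT v:ball c r|lborel. ln (cmod (v - \<tau>))) \<le>
      pi * r\<^sup>2 * (ln (cmod (c - \<tau>)) + ln (max 1 (r / cmod (\<tau> - c))))"
    by (simp add: eq d_def norm_minus_commute)
qed

text \<open>The points are centres of squares, so that they keep the distance \<open>\<rho> / 2\<close> from both coordinate axes.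
This keeps the test points below away from \<open>0\<close> and \<open>\<infinity>\<close>.\<close>
definition grid :: "real \<Rightarrow> complex set" where
  "grid \<rho> = range (\<lambda>(j::int, k::int). Complex (\<rho> * (of_int j + 1 / 2)) (\<rho> * (of_int k + 1 / 2)))"

lemma grid_dense:
  assumes "\<rho> > 0"
  shows "\<exists>c\<in>grid \<rho>. cmod (v - c) < \<rho>"
proof -
  have *: "\<bar>x - \<rho> * (of_int \<lfloor>x / \<rho>\<rfloor> + 1 / 2)\<bar> \<le> \<rho> / 2" for x
  proof -
    have "of_int \<lfloor>x / \<rho>\<rfloor> \<le> x / \<rho>" "x / \<rho> < of_int \<lfloor>x / \<rho>\<rfloor> + 1" by linarith+
    hence "of_int \<lfloor>x / \<rho>\<rfloor> * \<rho> \<le> x" "x < (of_int \<lfloor>x / \<rho>\<rfloor> + 1) * \<rho>"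
      using assms by (simp_all only: pos_le_divide_eq pos_divide_less_eq)
    moreover have "(of_int \<lfloor>x / \<rho>\<rfloor> + 1) * \<rho> = of_int \<lfloor>x / \<rho>\<rfloor> * \<rho> + \<rho>"
      by (simp add: distrib_right)
    moreover have "\<rho> * (of_int \<lfloor>x / \<rho>\<rfloor> + 1 / 2) = of_int \<lfloor>x / \<rho>\<rfloor> * \<rho> + \<rho> / 2"
      by (simp add: distrib_left)
    ultimately show ?thesis unfolding abs_le_iff by linarith
  qed
  define c where "c = Complex (\<rho> * (of_int \<lfloor>Re v / \<rho>\<rfloor> + 1 / 2)) (\<rho> * (of_int \<lfloor>Im v / \<rho>\<rfloor> + 1 / 2))"
  have "c \<in> grid \<rho>" unfolding grid_def c_def by (rule image_eqI[of _ _ "(\<lfloor>Re v / \<rho>\<rfloor>, \<lfloor>Im v / \<rho>\<rfloor>)"]) auto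
  moreover have "cmod (v - c) < \<rho>"
  proof -
    have "(Re (v - c))\<^sup>2 \<le> (\<rho> / 2)\<^sup>2" "(Im (v - c))\<^sup>2 \<le> (\<rho> / 2)\<^sup>2"
      using *[of "Re v"] *[of "Im v"] assms
      by (simp_all add: c_def flip: abs_le_square_iff)
    moreover have "\<rho>\<^sup>2 > 0" using assms by simp
    moreover have "(\<rho> / 2)\<^sup>2 = \<rho>\<^sup>2 / 4" by (simp add: power_divide)
    ultimately have "(cmod (v - c))\<^sup>2 < \<rho>\<^sup>2"
      unfolding cmod_power2 by linarith
    thus ?thesis using assms by (simp add: power2_less_imp_less)
  qed
  ultimately show ?thesis by blast
qed

lemma grid_separated:
  assumes "\<rho> > 0" "c \<in> grid \<rho>" "c' \<in> grid \<rho>" "c \<noteq> c'"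
  shows "\<rho> \<le> cmod (c - c')"
proof -
  obtain j k j' k' where c: "c = Complex (\<rho> * (of_int j + 1 / 2)) (\<rho> * (of_int k + 1 / 2))"
     "c' = Complex (\<rho> * (of_int j' + 1 / 2)) (\<rho> * (of_int k' + 1 / 2))"
    using assms by (auto simp: grid_def)
  have *: "\<rho> \<le> \<bar>\<rho> * (of_int a + 1 / 2) - \<rho> * (of_int b + 1 / 2)\<bar>" if "a \<noteq> b" for a b :: int
  proof -
    have "1 \<le> \<bar>real_of_int (a - b)\<bar>" using that by linarith
    hence "\<rho> * 1 \<le> \<rho> * \<bar>real_of_int (a - b)\<bar>" using assms by (intro mult_left_mono) auto
    also have "\<dots> = \<bar>\<rho> * real_of_int (a - b)\<bar>" using assms by (simp add: abs_mult)
    also have "\<rho> * real_of_int (a - b) = \<rho> * (of_int a + 1 / 2) - \<rho> * (of_int b + 1 / 2)"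
      by (simp add: algebra_simps)
    finally show ?thesis by simp
  qed
  have "j \<noteq> j' \<or> k \<noteq> k'" using assms(4) c by auto
  thus ?thesis
    using *[of j j'] *[of k k'] abs_Re_le_cmod[of "c - c'"] abs_Im_le_cmod[of "c - c'"] by (auto simp: c)
qed

lemma grid_abs_ge:
  assumes "\<rho> > 0" "c \<in> grid \<rho>"
  shows "\<rho> / 2 \<le> \<bar>Re c\<bar>" "\<rho> / 2 \<le> \<bar>Im c\<bar>"
proof -
  have "\<rho> / 2 \<le> \<bar>\<rho> * (of_int a + 1 / 2)\<bar>" for a :: int
  proof -
    have "a \<ge> 0 \<or> a \<le> -1" by linarith
    hence "real_of_int a \<ge> 0 \<or> real_of_int a \<le> -1" by linarith
    hence "1 / 2 \<le> \<bar>real_of_int a + 1 / 2\<bar>" by linarith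
    hence "\<rho> * (1 / 2) \<le> \<rho> * \<bar>real_of_int a + 1 / 2\<bar>" using assms by (intro mult_left_mono) auto
    thus ?thesis using assms by (simp add: abs_mult)
  qed
  thus "\<rho> / 2 \<le> \<bar>Re c\<bar>" "\<rho> / 2 \<le> \<bar>Im c\<bar>" using assms(2) by (auto simp: grid_def)
qed

text \<open>The discs of radius \<open>\<rho> / 2\<close> about grid points are disjoint.\<close>
lemma card_grid_le_measure:
  assumes \<rho>: "\<rho> > 0" and G: "G \<subseteq> grid \<rho>" and B[measurable]: "B \<in> sets borel" and bdd: "bounded B"
    and sub: "\<And>c. c \<in> G \<Longrightarrow> ball c (\<rho> / 2) \<subseteq> B"
  shows "finite G" "real (card G) * (pi * \<rho>\<^sup>2 / 4) \<le> measure lborel B"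
proof -
  have fB: "emeasure lborel B < \<infinity>" by (rule emeasure_bounded_finite[OF bdd])
  have bound: "real (card F) * (pi * \<rho>\<^sup>2 / 4) \<le> measure lborel B" if F: "F \<subseteq> G" "finite F" for F
  proof -
    have disj: "disjoint_family_on (\<lambda>c. ball c (\<rho> / 2)) F"
      unfolding disjoint_family_on_def
    proof (intro ballI impI)
      fix c c' assume "c \<in> F" "c' \<in> F" "c \<noteq> c'"
      hence "\<rho> \<le> dist c c'" using grid_separated[OF \<rho>, of c c'] F G by (auto simp: dist_norm)
      thus "ball c (\<rho> / 2) \<inter> ball c' (\<rho> / 2) = {}" by (auto intro!: disjoint_ballI)
    qed
    have "real (card F) * (pi * \<rho>\<^sup>2 / 4) = (\<Sum>c\<in>F. measure lborel (ball c (\<rho> / 2)))"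
      using \<rho> by (simp add: measure_ball_complex power_divide)
    also have "\<dots> = measure lborel (\<Union>c\<in>F. ball c (\<rho> / 2))"
      by (rule measure_finite_Union[symmetric]) (use F disj \<rho> in \<open>auto simp: measure_ball_complex\<close>)
    also have "\<dots> \<le> measure lborel B"
      using fB F sub by (intro measure_mono_fmeasurable fmeasurableI) (auto simp: less_top)
    finally show ?thesis .
  qed
  show "finite G"
  proof (rule ccontr)
    assume "infinite G"
    obtain N :: nat where N: "measure lborel B / (pi * \<rho>\<^sup>2 / 4) < real N" using reals_Archimedean2 by blast
    obtain F where F: "F \<subseteq> G" "finite F" "card F = N"
      using infinite_arbitrarily_large[OF \<open>infinite G\<close>, of N] by blast
    thus False using bound[OF F(1,2)] N \<rho> by (simp add: pos_divide_less_eq)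
  qed
  thus "real (card G) * (pi * \<rho>\<^sup>2 / 4) \<le> measure lborel B" using bound by blast
qed

definition grid_cover :: "real \<Rightarrow> complex set \<Rightarrow> complex set" where
  "grid_cover \<rho> A = {c \<in> grid \<rho>. ball c \<rho> \<inter> A \<noteq> {}}"

lemma grid_cover_covers:
  assumes "\<rho> > 0"
  shows "A \<subseteq> (\<Union>c\<in>grid_cover \<rho> A. ball c \<rho>)"
proof
  fix v assume "v \<in> A"
  thus "v \<in> (\<Union>c\<in>grid_cover \<rho> A. ball c \<rho>)"
    using grid_dense[OF assms, of v] by (force simp: grid_cover_def dist_norm norm_minus_commute)
qed

lemma grid_cover_annulus:
  assumes \<rho>: "\<rho> > 0" and a: "a \<ge> 0"
  shows "finite (grid_cover \<rho> (annulus u0 a (a + 3 * \<rho>)))"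
    and "real (card (grid_cover \<rho> (annulus u0 a (a + 3 * \<rho>)))) * \<rho>\<^sup>2 \<le> 140 * \<rho> * (a + \<rho>)"
proof -
  \<comment> \<open>the discs of radius \<open>\<rho> / 2\<close> reach at most \<open>3 \<rho> / 2\<close> beyond the annulus\<close>
  define a' where "a' = max 0 (a - 2 * \<rho>)"
  define B where "B = annulus u0 a' (a + 5 * \<rho>)"
  let ?G = "grid_cover \<rho> (annulus u0 a (a + 3 * \<rho>))"
  have sub: "ball c (\<rho> / 2) \<subseteq> B" if c: "c \<in> ?G" for c
  proof
    fix w assume w: "w \<in> ball c (\<rho> / 2)"
    from c obtain v where v: "dist c v < \<rho>" "v \<in> annulus u0 a (a + 3 * \<rho>)"
      by (auto simp: grid_cover_def)
    have "dist w v < 3 * \<rho> / 2" using dist_triangle[of w v c] v w by (simp add: dist_commute)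
    moreover have "dist w u0 \<le> dist w v + dist v u0" "dist v u0 \<le> dist w v + dist w u0"
      using dist_triangle[of w u0 v] dist_triangle[of v u0 w] by (simp_all add: dist_commute)
    ultimately show "w \<in> B" using v(2) \<rho> by (auto simp: B_def a'_def annulus_def dist_norm)
  qed
  note * = card_grid_le_measure[of \<rho> ?G B, OF \<rho> _ _ _ sub]
  show "finite ?G" by (rule *(1)) (auto simp: grid_cover_def B_def bounded_annulus)
  have "real (card ?G) * (pi * \<rho>\<^sup>2 / 4) \<le> measure lborel B"
    by (rule *(2)) (auto simp: grid_cover_def B_def bounded_annulus)
  also have "\<dots> = pi * ((a + 5 * \<rho>)\<^sup>2 - a'\<^sup>2)"
    unfolding B_def using \<rho> a by (intro measure_annulus) (auto simp: a'_def)
  also have "(a + 5 * \<rho>)\<^sup>2 - a'\<^sup>2 \<le> 7 * \<rho> * (2 * a + 5 * \<rho>)"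
  proof (cases "a \<ge> 2 * \<rho>")
    case True
    hence "a' = a - 2 * \<rho>" by (simp add: a'_def)
    moreover have "(a + 5 * \<rho>)\<^sup>2 - (a - 2 * \<rho>)\<^sup>2 = 7 * \<rho> * (2 * a + 3 * \<rho>)"
      by (simp add: power2_eq_square algebra_simps)
    moreover have "7 * \<rho> * (2 * a + 3 * \<rho>) \<le> 7 * \<rho> * (2 * a + 5 * \<rho>)"
      using \<rho> by (intro mult_left_mono) auto
    ultimately show ?thesis by simp
  next
    case False
    hence "a' = 0" by (simp add: a'_def)
    moreover have "(a + 5 * \<rho>) * (a + 5 * \<rho>) \<le> (7 * \<rho>) * (2 * a + 5 * \<rho>)"
      using False a \<rho> by (intro mult_mono) auto
    ultimately show ?thesis by (simp add: power2_eq_square)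
  qed
  finally have "real (card ?G) * \<rho>\<^sup>2 \<le> 28 * \<rho> * (2 * a + 5 * \<rho>)" by simp
  also have "\<dots> \<le> 28 * \<rho> * (5 * (a + \<rho>))" using \<rho> a by (intro mult_left_mono) auto
  finally show "real (card ?G) * \<rho>\<^sup>2 \<le> 140 * \<rho> * (a + \<rho>)" by (simp add: algebra_simps)
qed

section \<open>Zero counting from bounds on a logarithmic potential\<close>

text \<open>The comparison measure \<open>m\<close> enters only through the quadratic bound on the mass of discs, which limits the
variation of its potential. This covers the images of the uniform disc under the inversions used below.\<close>
locale regular_prob = prob_space m for m :: "complex measure" +
  fixes C0 :: real
  assumes sets_m [simp, measurable_cong]: "sets m = sets borel"
    and C0: "C0 \<ge> 0"
    and reg: "\<And>c t. t > 0 \<Longrightarrow> emeasure m (cball c t) \<le> ennreal (C0 * t\<^sup>2)"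
    and supp: "AE \<tau> in m. cmod \<tau> \<le> 1"
begin

lemma space_m [simp]: "space m = UNIV"
  using sets_eq_imp_space_eq[OF sets_m] by simp

lemma prob_UNIV: "prob UNIV = 1"
  using prob_space by simp

definition potential :: "complex \<Rightarrow> real" where
  "potential v = (\<integral>\<tau>. ln (cmod (v - \<tau>)) \<partial>m)"

lemma AE_neq: "AE \<tau> in m. \<tau> \<noteq> c"
  by (rule AE_neq_of_regular[OF sets_m reg])

lemma integral_pole:
  assumes "\<rho> > 0"
  shows "integrable m (\<lambda>\<tau>. ln (max 1 (\<rho> / cmod (\<tau> - c))))"
    and "(\<integral>\<tau>. ln (max 1 (\<rho> / cmod (\<tau> - c))) \<partial>m) \<le> C0 * \<rho>\<^sup>2 / 2"
proof -
  have le: "(\<integral>\<^sup>+\<tau>. ennreal (ln (max 1 (\<rho> / cmod (\<tau> - c)))) \<partial>m) \<le> ennreal (C0 * \<rho>\<^sup>2 / 2)"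
    by (intro nn_integral_log_pole_le sets_m reg C0 assms) unfold_locales
  show int: "integrable m (\<lambda>\<tau>. ln (max 1 (\<rho> / cmod (\<tau> - c))))"
    by (rule integrableI_nonneg) (use le in \<open>auto simp: ennreal_less_top intro: le_less_trans\<close>)
  show "(\<integral>\<tau>. ln (max 1 (\<rho> / cmod (\<tau> - c))) \<partial>m) \<le> C0 * \<rho>\<^sup>2 / 2"
    using le C0 by (subst (asm) nn_integral_eq_integral[OF int]) (auto simp: ennreal_le_iff)
qed

lemma abs_ln_bound: "AE \<tau> in m. \<bar>ln (cmod (v - \<tau>))\<bar> \<le> ln (max 1 (1 / cmod (\<tau> - v))) + (cmod v + 1)"
  using supp
proof eventually_elim
  case (elim \<tau>)
  thus ?case using abs_ln_le_pole[of "cmod (v - \<tau>)"] norm_triangle_ineq4[of v \<tau>]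
    by (simp add: norm_minus_commute)
qed

lemma integrable_log: "integrable m (\<lambda>\<tau>. ln (cmod (v - \<tau>)))"
proof (rule Bochner_Integration.integrable_bound)
  show "integrable m (\<lambda>\<tau>. ln (max 1 (1 / cmod (\<tau> - v))) + (cmod v + 1))"
    by (intro Bochner_Integration.integrable_add integral_pole) auto
  show "AE \<tau> in m. norm (ln (cmod (v - \<tau>))) \<le> norm (ln (max 1 (1 / cmod (\<tau> - v))) + (cmod v + 1))"
    using abs_ln_bound[of v]
  proof eventually_elim
    case (elim \<tau>)
    have "0 \<le> ln (max 1 (1 / cmod (\<tau> - v)))" by simp
    thus ?case using elim by simp
  qed
qed measurable

lemma integral_abs_log_le: "(\<integral>\<tau>. \<bar>ln (cmod (v - \<tau>))\<bar> \<partial>m) \<le> C0 / 2 + (cmod v + 1)"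
proof -
  have "(\<integral>\<tau>. \<bar>ln (cmod (v - \<tau>))\<bar> \<partial>m) \<le> (\<integral>\<tau>. ln (max 1 (1 / cmod (\<tau> - v))) + (cmod v + 1) \<partial>m)"
    by (intro integral_mono_AE abs_ln_bound integrable_abs integrable_log
          Bochner_Integration.integrable_add integral_pole) auto
  also have "\<dots> \<le> C0 / 2 + (cmod v + 1)"
    using integral_pole[of 1 v] by (subst Bochner_Integration.integral_add) (auto simp: prob_UNIV)
  finally show ?thesis .
qed

lemma integrable_pair_log:
  assumes [measurable]: "A \<in> sets borel" and A: "bounded A"
  shows "integrable (lborel \<Otimes>\<^sub>M m) (\<lambda>(v, \<tau>). indicator A v * ln (cmod (v - \<tau>)))"
proof -
  interpret pair_sigma_finite lborel m ..
  obtain K where K: "\<And>v. v \<in> A \<Longrightarrow> cmod v \<le> K" using A by (auto simp: bounded_iff)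
  have [measurable]: "(\<lambda>(v, \<tau>). indicator A v * ln (cmod (v - \<tau>))) \<in> borel_measurable (lborel \<Otimes>\<^sub>M m)"
    by measurable
  show ?thesis
  proof (rule Fubini_integrable)
    show "integrable lborel (\<lambda>v. \<integral>\<tau>. norm (case (v, \<tau>) of (v, \<tau>) \<Rightarrow> indicator A v * ln (cmod (v - \<tau>))) \<partial>m)"
    proof (rule Bochner_Integration.integrable_bound)
      show "integrable lborel (\<lambda>v. indicator A v * (C0 / 2 + (K + 1)))"
        using emeasure_bounded_finite[OF A] by (intro integrable_mult_left integrable_real_indicator) auto
      show "AE v in lborel. norm (\<integral>\<tau>. norm (case (v, \<tau>) of (v, \<tau>) \<Rightarrow> indicator A v * ln (cmod (v - \<tau>))) \<partial>m) \<le>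
           norm (indicator A v * (C0 / 2 + (K + 1)))"
      proof (rule AE_I2)
        fix v
        show "norm (\<integral>\<tau>. norm (case (v, \<tau>) of (v, \<tau>) \<Rightarrow> indicator A v * ln (cmod (v - \<tau>))) \<partial>m) \<le>
           norm (indicator A v * (C0 / 2 + (K + 1)))"
        proof (cases "v \<in> A")
          case True
          have "0 \<le> (\<integral>\<tau>. \<bar>ln (cmod (v - \<tau>))\<bar> \<partial>m)" by simp
          thus ?thesis using True integral_abs_log_le[of v] K[OF True] by simp
        qed simp
      qed
    qed measurable
    show "AE v in lborel. integrable m (\<lambda>\<tau>. case (v, \<tau>) of (v, \<tau>) \<Rightarrow> indicator A v * ln (cmod (v - \<tau>)))"
      by (auto intro!: AE_I2 integrable_log)
  qed measurable
qed

lemma potential_measurable [measurable]: "potential \<in> borel_measurable borel"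
proof -
  have "(\<lambda>v. \<integral>\<tau>. ln (cmod (v - \<tau>)) \<partial>m) \<in> borel_measurable borel"
    by (rule borel_measurable_lebesgue_integral) measurable
  thus ?thesis unfolding potential_def[abs_def] .
qed

lemma set_integral_potential:
  assumes [measurable]: "A \<in> sets borel" and A: "bounded A"
  shows "set_integrable lborel A potential"
    and "integrable m (\<lambda>\<tau>. LINT v:A|lborel. ln (cmod (v - \<tau>)))"
    and "(LINT v:A|lborel. potential v) = (\<integral>\<tau>. (LINT v:A|lborel. ln (cmod (v - \<tau>))) \<partial>m)"
proof -
  interpret pair_sigma_finite lborel m ..
  note int = integrable_pair_log[OF assms]
  have "integrable lborel (\<lambda>v. \<integral>\<tau>. indicator A v * ln (cmod (v - \<tau>)) \<partial>m)"
    by (rule integrable_fst[OF int])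
  thus "set_integrable lborel A potential" by (simp add: set_integrable_def potential_def)
  have "integrable m (\<lambda>\<tau>. \<integral>v. indicator A v * ln (cmod (v - \<tau>)) \<partial>lborel)"
    by (rule integrable_snd[OF int])
  thus "integrable m (\<lambda>\<tau>. LINT v:A|lborel. ln (cmod (v - \<tau>)))" by (simp add: set_lebesgue_integral_def)
  show "(LINT v:A|lborel. potential v) = (\<integral>\<tau>. (LINT v:A|lborel. ln (cmod (v - \<tau>))) \<partial>m)"
    using Fubini_integral[OF int] by (simp add: set_lebesgue_integral_def potential_def)
qed

text \<open>A quantitative form of the statement that the potential of a measure with bounded density has bounded
Laplacian.\<close>
lemma potential_ball_mean_le:
  assumes \<rho>: "\<rho> > 0"
  shows "(LINT v:ball c \<rho>|lborel. potential v) \<le> pi * \<rho>\<^sup>2 * (potential c + C0 * \<rho>\<^sup>2 / 2)"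
proof -
  have "(LINT v:ball c \<rho>|lborel. potential v) = (\<integral>\<tau>. (LINT v:ball c \<rho>|lborel. ln (cmod (v - \<tau>))) \<partial>m)"
    by (intro set_integral_potential) auto
  also have "\<dots> \<le> (\<integral>\<tau>. pi * \<rho>\<^sup>2 * (ln (cmod (c - \<tau>)) + ln (max 1 (\<rho> / cmod (\<tau> - c)))) \<partial>m)"
  proof (rule integral_mono_AE)
    show "AE \<tau> in m. (LINT v:ball c \<rho>|lborel. ln (cmod (v - \<tau>))) \<le>
        pi * \<rho>\<^sup>2 * (ln (cmod (c - \<tau>)) + ln (max 1 (\<rho> / cmod (\<tau> - c))))"
      using AE_neq[of c] by eventually_elim (rule ball_log_mean_bounds(2)[OF \<rho>])
  qed (auto intro!: set_integral_potential integrable_log integral_pole \<rho>)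
  also have "\<dots> = pi * \<rho>\<^sup>2 * (potential c + (\<integral>\<tau>. ln (max 1 (\<rho> / cmod (\<tau> - c))) \<partial>m))"
    using \<rho> by (simp add: potential_def integrable_log integral_pole)
  also have "\<dots> \<le> pi * \<rho>\<^sup>2 * (potential c + C0 * \<rho>\<^sup>2 / 2)"
    using integral_pole(2)[OF \<rho>, of c] by (intro mult_left_mono) auto
  finally show ?thesis .
qed

lemma measure_cball_le:
  assumes "t > 0"
  shows "measure m (cball c t) \<le> C0 * t\<^sup>2"
  using reg[OF assms, of c] C0 by (simp add: emeasure_eq_measure ennreal_le_iff)

lemma measure_ball_le:
  assumes "t > 0"
  shows "measure m (ball c t) \<le> C0 * t\<^sup>2"
proof -
  have "measure m (ball c t) \<le> measure m (cball c t)" by (rule finite_measure_mono) auto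
  thus ?thesis using measure_cball_le[OF assms, of c] by simp
qed

lemma measure_annulus_le:
  assumes \<rho>: "\<rho> > 0" and a: "a \<ge> 0"
  shows "measure m (annulus u0 a (a + 3 * \<rho>)) \<le> 140 * C0 * \<rho> * (a + \<rho>)"
proof -
  let ?G = "grid_cover \<rho> (annulus u0 a (a + 3 * \<rho>))"
  note G = grid_cover_annulus[OF \<rho> a, of u0]
  have "measure m (annulus u0 a (a + 3 * \<rho>)) \<le> measure m (\<Union>c\<in>?G. ball c \<rho>)"
    using grid_cover_covers[OF \<rho>] G(1) by (intro finite_measure_mono) auto
  also have "\<dots> \<le> (\<Sum>c\<in>?G. measure m (ball c \<rho>))"
    using G(1) by (intro finite_measure_subadditive_finite) auto
  also have "\<dots> \<le> real (card ?G) * (C0 * \<rho>\<^sup>2)"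
    by (intro sum_bounded_above measure_ball_le \<rho>)
  also have "\<dots> = C0 * (real (card ?G) * \<rho>\<^sup>2)" by simp
  also have "\<dots> \<le> C0 * (140 * \<rho> * (a + \<rho>))" using G(2) C0 by (intro mult_left_mono) auto
  finally show ?thesis by (simp add: mult_ac)
qed

lemma integral_cutoff:
  shows "(\<integral>\<tau>. cutoff u0 R h \<tau> \<partial>m) =
     annulus_mean u0 (R + 2 * h) (R + 3 * h) potential - annulus_mean u0 R (R + h) potential"
    and "integrable m (cutoff u0 R h)"
proof -
  have eq: "annulus_mean u0 a b (\<lambda>v. ln (cmod (\<tau> - v))) =
      (LINT v:annulus u0 a b|lborel. ln (cmod (v - \<tau>))) / (pi * (b\<^sup>2 - a\<^sup>2))" for a b \<tau>
    by (simp add: annulus_mean_def norm_minus_commute)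
  have int: "integrable m (\<lambda>\<tau>. annulus_mean u0 a b (\<lambda>v. ln (cmod (\<tau> - v))))"
    and mean: "(\<integral>\<tau>. annulus_mean u0 a b (\<lambda>v. ln (cmod (\<tau> - v))) \<partial>m) = annulus_mean u0 a b potential" for a b
    unfolding eq using set_integral_potential[of "annulus u0 a b"]
    by (auto simp: bounded_annulus annulus_mean_def)
  show "integrable m (cutoff u0 R h)"
    unfolding cutoff_def[abs_def] by (intro Bochner_Integration.integrable_diff int)
  show "(\<integral>\<tau>. cutoff u0 R h \<tau> \<partial>m) =
     annulus_mean u0 (R + 2 * h) (R + 3 * h) potential - annulus_mean u0 R (R + h) potential"
    unfolding cutoff_def by (simp add: int mean)
qed

text \<open>From here on \<open>Y\<close> is the difference between the potential of finitely many weighted points, in the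
applications the zeros with their multiplicities, and \<open>n\<close> times the potential of \<open>m\<close>. It is bounded above
almost everywhere and below at the grid points. The constant \<open>K\<close> is arbitrary since adding a constant to a
potential does not change the measure.\<close>
context
  fixes I :: "'i set" and wt :: "'i \<Rightarrow> real" and \<tau>s :: "'i \<Rightarrow> complex"
    and n \<rho> M K :: real and Y :: "complex \<Rightarrow> real"
  defines "Y \<equiv> \<lambda>v. (\<Sum>i\<in>I. wt i * ln (cmod (v - \<tau>s i))) - n * potential v"
  assumes finI: "finite I" and wt: "\<And>i. i \<in> I \<Longrightarrow> wt i \<ge> 0"
    and n: "n \<ge> 0" and \<rho>: "\<rho> > 0" and nM: "n * \<rho>\<^sup>2 \<le> M"
    and up: "AE v in lborel. Y v \<le> K + M"
    and low: "\<And>c. c \<in> grid \<rho> \<Longrightarrow> cmod c \<le> 2 \<Longrightarrow> K - M \<le> Y c"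
    and ne: "\<And>c i. c \<in> grid \<rho> \<Longrightarrow> cmod c \<le> 2 \<Longrightarrow> i \<in> I \<Longrightarrow> \<tau>s i \<noteq> c"
begin

lemma M_nonneg: "M \<ge> 0"
  using n nM by (meson order_trans zero_le_mult_iff zero_le_power2)

lemma Y_measurable [measurable]: "Y \<in> borel_measurable borel"
  unfolding Y_def by measurable

lemma set_integrable_Y:
  assumes A: "A \<in> sets borel" "bounded A"
  shows "set_integrable lborel A (\<lambda>v. \<Sum>i\<in>I. wt i * ln (cmod (v - \<tau>s i)))" (is ?A)
    and "set_integrable lborel A Y" (is ?B)
    and "set_integrable lborel A (\<lambda>v. Y v - K)" (is ?C)
    and "set_integrable lborel A (\<lambda>v. \<bar>Y v - K\<bar>)" (is ?D)
proof -
  have "set_integrable lborel A (\<lambda>v. ln (cmod (v - \<tau>s i)))" for i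
    using set_integrable_log[OF A, of "\<tau>s i"] by (simp add: norm_minus_commute)
  thus S: ?A by (auto simp: set_integrable_def sum_distrib_left mult.left_commute)
  show B: ?B unfolding Y_def by (intro set_integral_diff S set_integrable_mult_right set_integral_potential A) 
  have "set_integrable lborel A (\<lambda>_. K)"
    using emeasure_bounded_finite[OF A(2)] A(1) by (auto simp: set_integrable_def)
  with B show C: ?C by (rule set_integral_diff)
  show ?D using set_integrable_abs[OF C] .
qed

text \<open>As \<open>Y - K \<le> M\<close>, the absolute value is at most \<open>2 M - (Y - K)\<close>, so only the mean of \<open>Y\<close> has to be bounded
below. The point part dominates its value at the centre; the potential of \<open>m\<close> exceeds its own by at most
\<open>C0 \<rho>\<^sup>2 / 2\<close>, and \<open>n \<rho>\<^sup>2 \<le> M\<close>.\<close>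
lemma ball_deviation:
  assumes c: "c \<in> grid \<rho>" "cmod c \<le> 2"
  shows "(LINT v:ball c \<rho>|lborel. \<bar>Y v - K\<bar>) \<le> (3 + C0 / 2) * M * (pi * \<rho>\<^sup>2)"
proof -
  note int = set_integrable_Y[of "ball c \<rho>", simplified]
  have const: "(LINT v:ball c \<rho>|lborel. k) = pi * \<rho>\<^sup>2 * k" "set_integrable lborel (ball c \<rho>) (\<lambda>_. k)" for k :: real
    using \<rho> by (simp_all add: set_lebesgue_integral_def set_integrable_def measure_ball_complex)
  have "(LINT v:ball c \<rho>|lborel. \<bar>Y v - K\<bar>) \<le> (LINT v:ball c \<rho>|lborel. 2 * M - (Y v - K))"
  proof (rule set_integral_mono_AE)
    show "AE v\<in>ball c \<rho> in lborel. \<bar>Y v - K\<bar> \<le> 2 * M - (Y v - K)"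
      using up by eventually_elim (use M_nonneg in auto)
  qed (intro int const set_integral_diff)+
  also have "\<dots> = pi * \<rho>\<^sup>2 * (2 * M + K) - (LINT v:ball c \<rho>|lborel. Y v)"
    using int(2) const by (simp add: set_integral_diff algebra_simps)
  finally have e1: "(LINT v:ball c \<rho>|lborel. \<bar>Y v - K\<bar>) \<le> pi * \<rho>\<^sup>2 * (2 * M + K) - (LINT v:ball c \<rho>|lborel. Y v)" .
  have e2: "(LINT v:ball c \<rho>|lborel. Y v) = (\<Sum>i\<in>I. wt i * (LINT v:ball c \<rho>|lborel. ln (cmod (v - \<tau>s i)))) - n * (LINT v:ball c \<rho>|lborel. potential v)"
  proof -
    have "set_integrable lborel (ball c \<rho>) (\<lambda>v. ln (cmod (v - \<tau>s i)))" for i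
      using set_integrable_log[of "ball c \<rho>" "\<tau>s i"] by (simp add: norm_minus_commute)
    hence "(LINT v:ball c \<rho>|lborel. (\<Sum>i\<in>I. wt i * ln (cmod (v - \<tau>s i)))) = (\<Sum>i\<in>I. wt i * (LINT v:ball c \<rho>|lborel. ln (cmod (v - \<tau>s i))))"
      unfolding set_lebesgue_integral_def scaleR_sum_right
      by (subst Bochner_Integration.integral_sum) (auto simp: set_integrable_def mult.left_commute)
    moreover have "set_integrable lborel (ball c \<rho>) (\<lambda>v. n * potential v)"
      by (intro set_integrable_mult_right set_integral_potential) auto
    ultimately show ?thesis unfolding Y_def using int(1) by (subst set_integral_diff) auto
  qed
  have "(\<Sum>i\<in>I. wt i * (LINT v:ball c \<rho>|lborel. ln (cmod (v - \<tau>s i)))) \<ge> (\<Sum>i\<in>I. wt i * (pi * \<rho>\<^sup>2 * ln (cmod (c - \<tau>s i))))"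
    using ne[OF c] by (intro sum_mono mult_left_mono wt ball_log_mean_bounds(1)[OF \<rho>]) auto
  also have "(\<Sum>i\<in>I. wt i * (pi * \<rho>\<^sup>2 * ln (cmod (c - \<tau>s i)))) = pi * \<rho>\<^sup>2 * (Y c + n * potential c)"
    by (simp add: Y_def sum_distrib_left mult_ac)
  finally have e3: "pi * \<rho>\<^sup>2 * (Y c + n * potential c) \<le> (\<Sum>i\<in>I. wt i * (LINT v:ball c \<rho>|lborel. ln (cmod (v - \<tau>s i))))" .
  have "n * (LINT v:ball c \<rho>|lborel. potential v) \<le> n * (pi * \<rho>\<^sup>2 * (potential c + C0 * \<rho>\<^sup>2 / 2))"
    by (intro mult_left_mono potential_ball_mean_le \<rho> n)
  with e1 e2 e3 have "(LINT v:ball c \<rho>|lborel. \<bar>Y v - K\<bar>) \<le> pi * \<rho>\<^sup>2 * (2 * M + K) -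
      (pi * \<rho>\<^sup>2 * (Y c + n * potential c) - n * (pi * \<rho>\<^sup>2 * (potential c + C0 * \<rho>\<^sup>2 / 2)))"
    by linarith
  also have "pi * \<rho>\<^sup>2 * (2 * M + K) - (pi * \<rho>\<^sup>2 * (Y c + n * potential c) - n * (pi * \<rho>\<^sup>2 * (potential c + C0 * \<rho>\<^sup>2 / 2)))
     = pi * \<rho>\<^sup>2 * (2 * M + K - Y c + (n * \<rho>\<^sup>2) * (C0 / 2))"
    by (simp add: algebra_simps)
  also have "\<dots> \<le> pi * \<rho>\<^sup>2 * (2 * M + M + M * (C0 / 2))"
    using low[OF c] nM C0 by (intro mult_left_mono add_mono mult_right_mono) auto
  finally show ?thesis by (simp add: algebra_simps)
qed

text \<open>The annulus is covered by the discs of radius \<open>\<rho>\<close> about grid points, whose number is proportional to the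
area of the annulus divided by \<open>\<rho>\<^sup>2\<close>.\<close>
lemma annulus_deviation:
  assumes a: "a \<ge> 0" and u0: "cmod u0 + a + 4 * \<rho> \<le> 2"
  shows "(LINT v:annulus u0 a (a + 3 * \<rho>)|lborel. \<bar>Y v - K\<bar>) \<le> 140 * pi * (3 + C0 / 2) * M * (\<rho> * (a + \<rho>))"
proof -
  let ?A = "annulus u0 a (a + 3 * \<rho>)" and ?F = "\<lambda>v. \<bar>Y v - K\<bar>"
  let ?G = "grid_cover \<rho> ?A"
  note G = grid_cover_annulus[OF \<rho> a, of u0]
  have int: "set_integrable lborel (ball c \<rho>) ?F" for c by (rule set_integrable_Y) auto
  have "(LINT v:?A|lborel. ?F v) \<le> (\<integral>v. (\<Sum>c\<in>?G. indicator (ball c \<rho>) v *\<^sub>R ?F v) \<partial>lborel)"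
    unfolding set_lebesgue_integral_def
  proof (rule integral_mono)
    show "integrable lborel (\<lambda>v. indicator ?A v *\<^sub>R ?F v)"
      using set_integrable_Y(4)[of ?A] by (simp add: set_integrable_def bounded_annulus)
    show "integrable lborel (\<lambda>v. \<Sum>c\<in>?G. indicator (ball c \<rho>) v *\<^sub>R ?F v)"
      using int by (simp add: set_integrable_def)
    fix v
    have nonneg: "(\<Sum>c\<in>?G. indicator (ball c \<rho>) v *\<^sub>R ?F v) \<ge> 0" by (intro sum_nonneg) auto
    show "indicator ?A v *\<^sub>R ?F v \<le> (\<Sum>c\<in>?G. indicator (ball c \<rho>) v *\<^sub>R ?F v)"
    proof (cases "v \<in> ?A")
      case True
      then obtain c where c: "c \<in> ?G" "v \<in> ball c \<rho>" using grid_cover_covers[OF \<rho>, of ?A] by blast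
      have "indicator (ball c \<rho>) v *\<^sub>R ?F v \<le> (\<Sum>c\<in>?G. indicator (ball c \<rho>) v *\<^sub>R ?F v)"
        using G(1) by (intro member_le_sum c) auto
      thus ?thesis using True c(2) by simp
    qed (use nonneg in simp)
  qed
  also have "\<dots> = (\<Sum>c\<in>?G. LINT v:ball c \<rho>|lborel. ?F v)"
    unfolding set_lebesgue_integral_def using int
    by (intro Bochner_Integration.integral_sum) (simp add: set_integrable_def)
  also have "\<dots> \<le> real (card ?G) * ((3 + C0 / 2) * M * (pi * \<rho>\<^sup>2))"
  proof (intro sum_bounded_above ball_deviation)
    fix c assume c: "c \<in> ?G"
    show "c \<in> grid \<rho>" using c by (simp add: grid_cover_def)
    obtain v where v: "dist c v < \<rho>" "v \<in> ?A" using c by (auto simp: grid_cover_def)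
    have "cmod c \<le> cmod (c - v) + cmod (v - u0) + cmod u0"
      using norm_triangle_ineq[of "c - v" v] norm_triangle_ineq[of "v - u0" u0] by simp
    thus "cmod c \<le> 2" using v u0 by (simp add: annulus_def dist_norm)
  qed
  also have "\<dots> = pi * (3 + C0 / 2) * M * (real (card ?G) * \<rho>\<^sup>2)" by simp
  also have "\<dots> \<le> pi * (3 + C0 / 2) * M * (140 * \<rho> * (a + \<rho>))"
    using G(2) C0 M_nonneg by (intro mult_left_mono) auto
  also have "\<dots> = 140 * pi * (3 + C0 / 2) * M * (\<rho> * (a + \<rho>))" by (simp only: mult_ac)
  finally show ?thesis .
qed

lemma annulus_mean_deviation:
  assumes R: "R \<ge> 0" and u0: "cmod u0 + R + 4 * \<rho> \<le> 2"
    and ab: "R \<le> a" "b = a + \<rho>" "b \<le> R + 3 * \<rho>"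
  shows "\<bar>annulus_mean u0 a b Y - K\<bar> \<le> 140 * (3 + C0 / 2) * M"
proof -
  note int = set_integrable_Y[of "annulus u0 _ _", simplified, OF bounded_annulus]
  have ba: "b\<^sup>2 - a\<^sup>2 = \<rho> * (2 * a + \<rho>)" by (simp add: ab(2) power2_eq_square algebra_simps)
  have ge: "\<rho> * (R + \<rho>) \<le> b\<^sup>2 - a\<^sup>2" unfolding ba using \<rho> R ab by (intro mult_left_mono) auto
  have pos: "\<rho> * (R + \<rho>) > 0" using \<rho> R by simp
  have "annulus_mean u0 a b Y - K = annulus_mean u0 a b (\<lambda>v. Y v - K)"
    using \<rho> R ab by (subst annulus_mean_diff[OF int(2) set_integrable_annulus_const]) (simp add: annulus_mean_const)
  also have "\<bar>\<dots>\<bar> = \<bar>LINT v:annulus u0 a b|lborel. Y v - K\<bar> / (pi * (b\<^sup>2 - a\<^sup>2))"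
    using ge pos by (simp add: annulus_mean_def abs_mult)
  also have "\<dots> \<le> (LINT v:annulus u0 R (R + 3 * \<rho>)|lborel. \<bar>Y v - K\<bar>) / (pi * (b\<^sup>2 - a\<^sup>2))"
  proof (intro divide_right_mono)
    have "\<bar>LINT v:annulus u0 a b|lborel. Y v - K\<bar> \<le> (LINT v:annulus u0 a b|lborel. \<bar>Y v - K\<bar>)"
      using integral_norm_bound[of lborel "\<lambda>v. indicator (annulus u0 a b) v *\<^sub>R (Y v - K)"]
      by (simp add: set_lebesgue_integral_def abs_mult)
    also have "\<dots> \<le> (LINT v:annulus u0 R (R + 3 * \<rho>)|lborel. \<bar>Y v - K\<bar>)"
      unfolding set_lebesgue_integral_def
      using int(4) ab \<rho>
      by (intro integral_mono) (auto simp: set_integrable_def indicator_def annulus_def)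
    finally show "\<bar>LINT v:annulus u0 a b|lborel. Y v - K\<bar> \<le> (LINT v:annulus u0 R (R + 3 * \<rho>)|lborel. \<bar>Y v - K\<bar>)" .
  qed (use ge pos in auto)
  also have "\<dots> \<le> (140 * pi * (3 + C0 / 2) * M * (\<rho> * (R + \<rho>))) / (pi * (\<rho> * (R + \<rho>)))"
    using annulus_deviation[OF R u0] ge pos C0 M_nonneg R \<rho>
    by (intro frac_le mult_left_mono) auto
  also have "140 * pi * x * M * q / (pi * q) = 140 * x * M" if "q > 0" for x q :: real
    using that by simp
  note this[OF pos]
  finally show ?thesis .
qed

lemma cutoff_deviation:
  assumes R: "R > 0" and u0: "cmod u0 + R + 4 * \<rho> \<le> 2"
  shows "\<bar>(\<Sum>i\<in>I. wt i * cutoff u0 R \<rho> (\<tau>s i)) - n * (\<integral>\<tau>. cutoff u0 R \<rho> \<tau> \<partial>m)\<bar> \<le> 280 * (3 + C0 / 2) * M"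
proof -
  have mean: "annulus_mean u0 a b Y =
      (\<Sum>i\<in>I. wt i * annulus_mean u0 a b (\<lambda>v. ln (cmod (\<tau>s i - v)))) - n * annulus_mean u0 a b potential" for a b
  proof -
    have A: "annulus u0 a b \<in> sets borel" "bounded (annulus u0 a b)" by (auto simp: bounded_annulus)
    have "annulus_mean u0 a b Y = annulus_mean u0 a b (\<lambda>v. \<Sum>i\<in>I. wt i * ln (cmod (v - \<tau>s i))) - annulus_mean u0 a b (\<lambda>v. n * potential v)"
      unfolding Y_def by (intro annulus_mean_diff set_integrable_Y(1) A set_integrable_mult_right set_integral_potential)
    also have "annulus_mean u0 a b (\<lambda>v. \<Sum>i\<in>I. wt i * ln (cmod (v - \<tau>s i))) = (\<Sum>i\<in>I. wt i * annulus_mean u0 a b (\<lambda>v. ln (cmod (\<tau>s i - v))))"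
      unfolding norm_minus_commute[of _ "\<tau>s _"] by (intro annulus_mean_sum set_integrable_annulus_log)
    also have "annulus_mean u0 a b (\<lambda>v. n * potential v) = n * annulus_mean u0 a b potential"
      by (simp add: annulus_mean_def)
    finally show ?thesis .
  qed
  have "(\<Sum>i\<in>I. wt i * cutoff u0 R \<rho> (\<tau>s i)) - n * (\<integral>\<tau>. cutoff u0 R \<rho> \<tau> \<partial>m) =
     annulus_mean u0 (R + 2 * \<rho>) (R + 3 * \<rho>) Y - annulus_mean u0 R (R + \<rho>) Y"
    unfolding integral_cutoff mean by (simp add: cutoff_def algebra_simps sum_subtractf)
  moreover have "\<bar>annulus_mean u0 (R + 2 * \<rho>) (R + 3 * \<rho>) Y - K\<bar> \<le> 140 * (3 + C0 / 2) * M"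
    using R u0 \<rho> by (intro annulus_mean_deviation[of R]) auto
  moreover have "\<bar>annulus_mean u0 R (R + \<rho>) Y - K\<bar> \<le> 140 * (3 + C0 / 2) * M"
    using R u0 \<rho> by (intro annulus_mean_deviation[of R]) auto
  ultimately show ?thesis by linarith
qed

text \<open>Divided by its central value, the cutoff lies between the indicator functions of the discs of radius \<open>R\<close>
and \<open>R + 3 \<rho>\<close>. The central value is at least \<open>\<rho> / 2\<close>, which turns the error \<open>O(M)\<close> into \<open>O(M / \<rho>)\<close>.\<close>
lemma counting_sandwich:
  assumes R: "R > 0" and u0: "cmod u0 + R + 4 * \<rho> \<le> 2"
  shows "(\<Sum>i\<in>I. wt i * indicator (ball u0 R) (\<tau>s i)) \<le> n * measure m (ball u0 (R + 3 * \<rho>)) + 560 * (3 + C0 / 2) * (M / \<rho>)"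
    and "n * measure m (ball u0 R) \<le> (\<Sum>i\<in>I. wt i * indicator (ball u0 (R + 3 * \<rho>)) (\<tau>s i)) + 560 * (3 + C0 / 2) * (M / \<rho>)"
proof -
  let ?N = "\<lambda>A. \<Sum>i\<in>I. wt i * indicator A (\<tau>s i)"
  define k where "k = cutoff u0 R \<rho> u0"
  define E where "E = 280 * (3 + C0 / 2) * M"
  have E: "E \<ge> 0" using C0 M_nonneg by (simp add: E_def)
  have "\<rho> / 2 \<le> \<rho> / (R + 2 * \<rho>)" using R \<rho> u0 norm_ge_zero[of u0] by (intro divide_left_mono) (auto simp del: norm_ge_zero)
  also have "\<dots> \<le> k" unfolding k_def by (rule cutoff_centre_ge[OF R \<rho>])
  finally have k: "\<rho> / 2 \<le> k" .
  hence k0: "k > 0" using \<rho> by linarith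
  have Ek: "E / k \<le> 560 * (3 + C0 / 2) * (M / \<rho>)"
  proof -
    have "E / k \<le> E / (\<rho> / 2)" using k E \<rho> by (intro divide_left_mono) auto
    thus ?thesis by (simp add: E_def algebra_simps add_divide_distrib)
  qed
  have lower: "k * indicator (ball u0 R) u \<le> cutoff u0 R \<rho> u" for u
    using cutoff_inside[OF R \<rho>, of u u0] cutoff_nonneg[OF R \<rho>, of u0 u]
    by (auto simp: indicator_def k_def dist_norm norm_minus_commute)
  have upper: "cutoff u0 R \<rho> u \<le> k * indicator (ball u0 (R + 3 * \<rho>)) u" for u
    using cutoff_outside[OF R \<rho>, of u u0] cutoff_le[OF R \<rho>, of u0 u]
    by (auto simp: indicator_def k_def dist_norm norm_minus_commute)
  note dev = cutoff_deviation[OF R u0, folded E_def]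
  have int: "integrable m (\<lambda>u. k * indicator (ball u0 r) u)" for r
    by (intro integrable_mult_right integrable_real_indicator) (auto simp: emeasure_eq_measure)
  have lo_m: "k * measure m (ball u0 R) \<le> (\<integral>\<tau>. cutoff u0 R \<rho> \<tau> \<partial>m)"
    using integral_mono[OF int integral_cutoff(2) lower] by simp
  have up_m: "(\<integral>\<tau>. cutoff u0 R \<rho> \<tau> \<partial>m) \<le> k * measure m (ball u0 (R + 3 * \<rho>))"
    using integral_mono[OF integral_cutoff(2) int upper] by simp
  have lo_s: "k * ?N (ball u0 R) \<le> (\<Sum>i\<in>I. wt i * cutoff u0 R \<rho> (\<tau>s i))"
    unfolding sum_distrib_left using mult_left_mono[OF lower wt]
    by (intro sum_mono) (simp add: mult.left_commute)
  have up_s: "(\<Sum>i\<in>I. wt i * cutoff u0 R \<rho> (\<tau>s i)) \<le> k * ?N (ball u0 (R + 3 * \<rho>))"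
    unfolding sum_distrib_left using mult_left_mono[OF upper wt]
    by (intro sum_mono) (simp add: mult.left_commute)
  have "k * ?N (ball u0 R) \<le> n * (\<integral>\<tau>. cutoff u0 R \<rho> \<tau> \<partial>m) + E"
    using lo_s dev by linarith
  also have "\<dots> \<le> n * (k * measure m (ball u0 (R + 3 * \<rho>))) + E"
    using mult_left_mono[OF up_m n] by simp
  also have "\<dots> = k * (n * measure m (ball u0 (R + 3 * \<rho>)) + E / k)" using k0 by (simp add: field_simps)
  finally show "?N (ball u0 R) \<le> n * measure m (ball u0 (R + 3 * \<rho>)) + 560 * (3 + C0 / 2) * (M / \<rho>)"
    using k0 Ek by (simp add: mult_le_cancel_left_pos del: times_divide_eq_right)
  have "k * (n * measure m (ball u0 R)) \<le> n * (\<integral>\<tau>. cutoff u0 R \<rho> \<tau> \<partial>m)"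
    using mult_left_mono[OF lo_m n] by (simp add: mult.left_commute)
  also have "\<dots> \<le> k * ?N (ball u0 (R + 3 * \<rho>)) + E"
    using up_s dev by linarith
  also have "\<dots> = k * (?N (ball u0 (R + 3 * \<rho>)) + E / k)" using k0 by (simp add: field_simps)
  finally show "n * measure m (ball u0 R) \<le> ?N (ball u0 (R + 3 * \<rho>)) + 560 * (3 + C0 / 2) * (M / \<rho>)"
    using k0 Ek by (simp add: mult_le_cancel_left_pos del: times_divide_eq_right)
qed

text \<open>Changing the radius by \<open>3 \<rho>\<close> costs \<open>O(\<rho>)\<close> of the mass of \<open>m\<close>. For the lower bound the cutoff sits
inside the disc; a disc of radius at most \<open>3 \<rho>\<close> has too little mass to matter.\<close>
lemma counting_discrepancy:
  assumes s: "s > 0" "cmod u0 + s \<le> 1" and \<rho>': "\<rho> \<le> 1 / 10"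
  shows "\<bar>(\<Sum>i\<in>I. wt i * indicator (ball u0 s) (\<tau>s i)) - n * measure m (ball u0 s)\<bar>
     \<le> (280 * C0) * (n * \<rho>) + 560 * (3 + C0 / 2) * (M / \<rho>)"
proof -
  let ?N = "\<lambda>A. \<Sum>i\<in>I. wt i * indicator A (\<tau>s i)"
  define E where "E = 560 * (3 + C0 / 2) * (M / \<rho>)"
  have E: "E \<ge> 0" using C0 M_nonneg \<rho> by (simp add: E_def)
  have s1: "s \<le> 1" using s norm_ge_zero[of u0] by linarith
  have gap: "measure m (ball u0 (a + 3 * \<rho>)) \<le> measure m (ball u0 a) + 280 * C0 * \<rho>" if a: "0 \<le> a" "a \<le> 1" for a
  proof -
    have "ball u0 (a + 3 * \<rho>) \<subseteq> ball u0 a \<union> annulus u0 a (a + 3 * \<rho>)" by (auto simp: annulus_eq_Diff)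
    hence "measure m (ball u0 (a + 3 * \<rho>)) \<le> measure m (ball u0 a \<union> annulus u0 a (a + 3 * \<rho>))"
      by (intro finite_measure_mono) auto
    also have "\<dots> \<le> measure m (ball u0 a) + measure m (annulus u0 a (a + 3 * \<rho>))"
      by (intro measure_Un_le) auto
    also have "measure m (annulus u0 a (a + 3 * \<rho>)) \<le> 140 * C0 * \<rho> * (a + \<rho>)"
      by (rule measure_annulus_le[OF \<rho> a(1)])
    also have "\<dots> \<le> 140 * C0 * \<rho> * 2" using C0 \<rho> \<rho>' a by (intro mult_left_mono) auto
    finally show ?thesis by simp
  qed
  have gapn: "n * measure m (ball u0 (a + 3 * \<rho>)) \<le> n * measure m (ball u0 a) + 280 * C0 * (n * \<rho>)" if "0 \<le> a" "a \<le> 1" for a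
    using mult_left_mono[OF gap[OF that] n] by (simp add: algebra_simps)
  have "?N (ball u0 s) \<le> n * measure m (ball u0 (s + 3 * \<rho>)) + E"
    unfolding E_def using s \<rho>' by (intro counting_sandwich) auto
  also note gapn[of s]
  finally have up: "?N (ball u0 s) \<le> n * measure m (ball u0 s) + 280 * C0 * (n * \<rho>) + E"
    using s s1 by simp
  have lo: "n * measure m (ball u0 s) \<le> ?N (ball u0 s) + 280 * C0 * (n * \<rho>) + E"
  proof (cases "s > 3 * \<rho>")
    case True
    have "n * measure m (ball u0 s) \<le> n * measure m (ball u0 (s - 3 * \<rho>)) + 280 * C0 * (n * \<rho>)"
      using gapn[of "s - 3 * \<rho>"] True s1 \<rho> by simp
    also have "n * measure m (ball u0 (s - 3 * \<rho>)) \<le> ?N (ball u0 (s - 3 * \<rho> + 3 * \<rho>)) + E"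
      unfolding E_def using True s \<rho> \<rho>' by (intro counting_sandwich(2)) auto
    finally show ?thesis by simp
  next
    case False
    have "measure m (ball u0 s) \<le> C0 * s\<^sup>2" by (rule measure_ball_le[OF s(1)])
    also have "\<dots> \<le> C0 * (3 * \<rho>)"
    proof (intro mult_left_mono C0)
      have "s * s \<le> 1 * (3 * \<rho>)" using False s s1 by (intro mult_mono) auto
      thus "s\<^sup>2 \<le> 3 * \<rho>" by (simp add: power2_eq_square)
    qed
    also have "\<dots> \<le> 280 * C0 * \<rho>" using C0 \<rho> by simp
    finally have "n * measure m (ball u0 s) \<le> n * (280 * C0 * \<rho>)" using n by (intro mult_left_mono) auto
    moreover have "0 \<le> ?N (ball u0 s)" using wt by (intro sum_nonneg) auto
    ultimately show ?thesis using E by (simp add: mult_ac)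
  qed
  show ?thesis using up lo unfolding E_def by linarith
qed

end

end

section \<open>Inversions and the deterministic discrepancy bound\<close>

lemma sum_order_roots:
  fixes f :: "complex poly"
  assumes f: "f \<noteq> 0"
  shows "(\<Sum>w | poly f w = 0. order w f) = degree f"
proof -
  show ?thesis
    using size_proots_complex[of f] f by (simp add: size_multiset_overloaded_eq)
qed

lemma prob_uniform_disc_subset:
  assumes S: "S \<in> sets borel" "ball 0 1 \<inter> S \<subseteq> cball w r" and r: "r \<ge> 0"
  shows "emeasure uniform_disc S \<le> ennreal (r\<^sup>2)"
proof -
  have "emeasure uniform_disc S = emeasure lborel (ball 0 1 \<inter> S) / emeasure lborel (ball (0::complex) 1)"
    using S unfolding uniform_disc_def by (intro emeasure_uniform_measure) auto
  also have "\<dots> \<le> emeasure lborel (cball w r) / emeasure lborel (ball (0::complex) 1)"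
    using S by (intro divide_right_mono_ennreal emeasure_mono) auto
  also have "\<dots> = ennreal (pi * r\<^sup>2) / ennreal pi"
    using r by (simp add: emeasure_cball emeasure_lborel_unit_disc unit_ball_vol_2)
  also have "\<dots> = ennreal (r\<^sup>2)" by (subst divide_ennreal) auto
  finally show ?thesis .
qed

lemma AE_uniform_disc: "AE w in uniform_disc. cmod w < 1"
  unfolding uniform_disc_def
  by (rule AE_uniform_measureI) auto

lemma sets_uniform_disc [simp, measurable_cong]: "sets uniform_disc = sets borel"
  and space_uniform_disc [simp]: "space uniform_disc = UNIV"
  by (simp_all add: uniform_disc_def)

lemma integrable_log_uniform_disc: "integrable uniform_disc (\<lambda>w. ln (cmod (z - w)))"
  using set_integrable_log[of "ball 0 1" z] by (subst integral_uniform_disc(2)) auto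

lemma AE_uniform_disc_neq: "AE w in uniform_disc. w \<noteq> z"
proof (rule AE_neq_of_regular)
  fix t :: real assume "t > 0"
  thus "emeasure uniform_disc (cball z t) \<le> ennreal (1 * t\<^sup>2)"
    using prob_uniform_disc_subset[of "cball z t" z t] by simp
qed simp

text \<open>The centres of inversion. They lie on the coordinate axes, and so do their inverses, which the grid avoids;
their distance from the unit disc makes the inversions bi-Lipschitz there.\<close>
definition poles :: "complex set" where
  "poles = {4, -4, 4 * \<i>, -4 * \<i>}"

lemma poles_norm: "p \<in> poles \<Longrightarrow> cmod p = 4"
  by (auto simp: poles_def norm_mult)

lemma poles_axis: "p \<in> poles \<Longrightarrow> Re p = 0 \<or> Im p = 0"
  by (auto simp: poles_def)

definition inverted_disc :: "complex \<Rightarrow> complex measure" where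
  "inverted_disc p = distr uniform_disc borel (\<lambda>w. 1 / (w - p))"

text \<open>On the unit disc the inversion shrinks distances by a factor of at most \<open>25\<close>, so the preimage of a disc of
radius \<open>t\<close> meets the unit disc in a set of diameter at most \<open>50 t\<close>.\<close>
lemma regular_inverted_disc:
  assumes p: "p \<in> poles"
  shows "regular_prob (inverted_disc p) 2500"
proof -
  interpret U: prob_space uniform_disc by (rule prob_space_uniform_disc)
  have far: "3 \<le> cmod (w - p)" "cmod (w - p) \<le> 5" if "cmod w < 1" for w
    using norm_triangle_ineq4[of w p] norm_triangle_ineq2[of p w] that poles_norm[OF p]
    by (auto simp: norm_minus_commute)
  show ?thesis
  proof (intro regular_prob.intro regular_prob_axioms.intro)
    show "prob_space (inverted_disc p)" unfolding inverted_disc_def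
      by (rule U.prob_space_distr) simp
    show "sets (inverted_disc p) = sets borel" by (simp add: inverted_disc_def)
    show "AE \<tau> in inverted_disc p. cmod \<tau> \<le> 1"
    proof -
      have "AE w in uniform_disc. cmod (1 / (w - p)) \<le> 1"
        using AE_uniform_disc
      proof eventually_elim
        case (elim w)
        hence "1 \<le> cmod (w - p)" using far[of w] by linarith
        thus ?case by (auto simp: norm_divide divide_le_eq_1)
      qed
      thus ?thesis unfolding inverted_disc_def by (subst AE_distr_iff) auto
    qed
    show "emeasure (inverted_disc p) (cball c t) \<le> ennreal (2500 * t\<^sup>2)" if t: "t > 0" for c t
    proof -
      define S where "S = {w. 1 / (w - p) \<in> cball c t}"
      have "(\<lambda>w. 1 / (w - p)) -` cball c t \<inter> space borel \<in> sets borel"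
        by (rule measurable_sets[where A = borel]) auto
      hence S: "S \<in> sets borel" by (simp add: S_def vimage_def)
      have eq: "emeasure (inverted_disc p) (cball c t) = emeasure uniform_disc S"
        unfolding inverted_disc_def by (subst emeasure_distr) (auto simp: S_def vimage_def)
      have "\<exists>w0. ball 0 1 \<inter> S \<subseteq> cball w0 (50 * t)"
      proof (cases "ball 0 1 \<inter> S = {}")
        case False
        then obtain w0 where w0: "cmod w0 < 1" "w0 \<in> S" by auto
        have "cmod (w - w0) \<le> 50 * t" if w: "cmod w < 1" "w \<in> S" for w
        proof -
          have nz: "w \<noteq> p" "w0 \<noteq> p" using far[OF w(1)] far[OF w0(1)] by auto
          have "a - b = (1 / b - 1 / a) * a * b" if "a \<noteq> 0" "b \<noteq> 0" for a b :: complex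
            using that by (simp add: field_simps)
          from this[of "w - p" "w0 - p"]
          have "w - w0 = (1 / (w0 - p) - 1 / (w - p)) * (w - p) * (w0 - p)"
            using nz by simp
          hence "cmod (w - w0) = cmod (1 / (w0 - p) - 1 / (w - p)) * cmod (w - p) * cmod (w0 - p)"
            by (metis norm_mult)
          also have "cmod (1 / (w0 - p) - 1 / (w - p)) \<le> 2 * t"
            using w0(2) w(2) dist_triangle[of "1 / (w0 - p)" "1 / (w - p)" c]
            by (simp add: S_def dist_commute) (simp add: dist_norm)
          also have "2 * t * cmod (w - p) * cmod (w0 - p) \<le> 2 * t * 5 * 5"
            using far[OF w(1)] far[OF w0(1)] t by (intro mult_mono) auto
          finally show ?thesis using far[OF w(1)] far[OF w0(1)] t
            by (simp add: mult_right_mono)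
        qed
        thus ?thesis by (intro exI[of _ w0]) (auto simp: dist_norm norm_minus_commute)
      qed auto
      then obtain w0 where "ball 0 1 \<inter> S \<subseteq> cball w0 (50 * t)" ..
      hence "emeasure uniform_disc S \<le> ennreal ((50 * t)\<^sup>2)"
        using t by (intro prob_uniform_disc_subset S) auto
      thus ?thesis by (simp add: eq power_mult_distrib)
    qed
  qed simp
qed

lemma inversion_diff:
  assumes "v \<noteq> 0" "w \<noteq> (p::complex)"
  shows "cmod (v - 1 / (w - p)) = cmod v * cmod (p + 1 / v - w) / cmod (p - w)"
proof -
  have "v - 1 / (w - p) = v * (p + 1 / v - w) / (p - w)"
    using assms by (simp add: field_simps)
  thus ?thesis by (simp add: norm_divide norm_mult)
qed

lemma potential_inverted_disc:
  assumes p: "p \<in> poles" and v: "v \<noteq> 0"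
  shows "regular_prob.potential (inverted_disc p) v =
    disc_potential (p + 1 / v) + ln (cmod v) - disc_potential p"
proof -
  interpret regular_prob "inverted_disc p" 2500 by (rule regular_inverted_disc[OF p])
  interpret U: prob_space uniform_disc by (rule prob_space_uniform_disc)
  have "potential v = (\<integral>w. ln (cmod (v - 1 / (w - p))) \<partial>uniform_disc)"
    unfolding potential_def unfolding inverted_disc_def by (subst integral_distr) auto
  also have "\<dots> = (\<integral>w. ln (cmod (p + 1 / v - w)) + ln (cmod v) - ln (cmod (p - w)) \<partial>uniform_disc)"
  proof (rule integral_cong_AE)
    show "AE w in uniform_disc. ln (cmod (v - 1 / (w - p))) = ln (cmod (p + 1 / v - w)) + ln (cmod v) - ln (cmod (p - w))"
      using AE_uniform_disc_neq[of p] AE_uniform_disc_neq[of "p + 1 / v"]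
    proof eventually_elim
      case (elim w)
      thus ?case using v by (subst inversion_diff) (auto simp: ln_mult ln_div)
    qed
  qed measurable
  also have "\<dots> = (disc_potential (p + 1 / v) - 1 / 2) + ln (cmod v) - (disc_potential p - 1 / 2)"
    using U.prob_space by (simp add: integrable_log_uniform_disc potential_uniform_disc)
  finally show ?thesis by simp
qed

text \<open>Clearing denominators in \<open>|w - z0| < R\<close> gives a quadratic inequality in \<open>u = 1 / (w - p)\<close>, whose
completed square is the image disc. It is contained in the unit disc because \<open>1 / (D - R)\<close>, with
\<open>D = |p - z0|\<close>, is the largest modulus of its closure.\<close>
lemma inversion_ball_iff:
  fixes p z0 :: complex
  assumes R: "R > 0" and far: "cmod (p - z0) \<ge> R + 1"
  defines "\<Delta> \<equiv> (cmod (p - z0))\<^sup>2 - R\<^sup>2"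
  shows "\<Delta> > 0" "cmod (- cnj (p - z0) / of_real \<Delta>) + R / \<Delta> \<le> 1"
    and "w \<noteq> p \<Longrightarrow> w \<in> ball z0 R \<longleftrightarrow> 1 / (w - p) \<in> ball (- cnj (p - z0) / of_real \<Delta>) (R / \<Delta>)"
proof -
  define D where "D = cmod (p - z0)"
  have D: "D \<ge> R + 1" using far by (simp add: D_def)
  have fac: "\<Delta> = (D - R) * (D + R)" by (simp add: \<Delta>_def D_def power2_eq_square algebra_simps)
  show pos: "\<Delta> > 0" unfolding fac using D R by (intro mult_pos_pos) auto
  have "cmod (- cnj (p - z0) / of_real \<Delta>) + R / \<Delta> = (D + R) / \<Delta>"
    using pos by (simp add: norm_divide D_def add_divide_distrib del: complex_cnj_diff)
  also have "\<dots> = 1 / (D - R)" using D R by (simp add: fac)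
  also have "\<dots> \<le> 1" using D by simp
  finally show "cmod (- cnj (p - z0) / of_real \<Delta>) + R / \<Delta> \<le> 1" .
  have sq: "x < y \<longleftrightarrow> x\<^sup>2 < y\<^sup>2" if "0 \<le> x" "0 \<le> y" for x y :: real
    using that by (meson power2_less_imp_less power_strict_mono zero_less_numeral)
  assume w: "w \<noteq> p"
  define u where "u = 1 / (w - p)"
  define d where "d = p - z0"
  have u0: "u \<noteq> 0" using w by (simp add: u_def)
  have wu: "w - z0 = (1 + d * u) / u" using w by (simp add: u_def d_def field_simps)
  have "w \<in> ball z0 R \<longleftrightarrow> cmod (w - z0) < R" by (simp add: dist_norm norm_minus_commute)
  also have "\<dots> \<longleftrightarrow> cmod (1 + d * u) < R * cmod u"
    using u0 by (simp add: wu norm_divide divide_less_eq)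
  also have "\<dots> \<longleftrightarrow> (cmod (1 + d * u))\<^sup>2 < (R * cmod u)\<^sup>2"
    by (rule sq) (use R in auto)
  also have "(cmod (1 + d * u))\<^sup>2 = 1 + 2 * Re (d * u) + (cmod d)\<^sup>2 * (cmod u)\<^sup>2"
    unfolding cmod_power2 by (simp add: power2_eq_square algebra_simps)
  also have "1 + 2 * Re (d * u) + (cmod d)\<^sup>2 * (cmod u)\<^sup>2 < (R * cmod u)\<^sup>2 \<longleftrightarrow>
      1 + 2 * Re (d * u) + \<Delta> * (cmod u)\<^sup>2 < 0"
    by (simp add: \<Delta>_def d_def power_mult_distrib algebra_simps)
  also have "\<dots> \<longleftrightarrow> (cmod (of_real \<Delta> * u + cnj d))\<^sup>2 < R\<^sup>2"
  proof -
    have "(cmod (of_real \<Delta> * u + cnj d))\<^sup>2 - R\<^sup>2 = \<Delta> * (1 + 2 * Re (d * u) + \<Delta> * (cmod u)\<^sup>2)"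
    proof -
      have "(cmod (of_real \<Delta> * u + cnj d))\<^sup>2 = \<Delta>\<^sup>2 * (cmod u)\<^sup>2 + 2 * \<Delta> * Re (d * u) + (cmod d)\<^sup>2"
        unfolding cmod_power2 by (simp add: power2_eq_square algebra_simps)
      thus ?thesis by (simp add: \<Delta>_def d_def power2_eq_square algebra_simps)
    qed
    thus ?thesis using pos by (metis diff_less_0_iff_less mult_less_0_iff order_less_asym)
  qed
  also have "\<dots> \<longleftrightarrow> cmod (of_real \<Delta> * u + cnj d) < R"
    by (rule sq[symmetric]) (use R in auto)
  also have "\<dots> \<longleftrightarrow> cmod (u + cnj d / of_real \<Delta>) < R / \<Delta>"
  proof -
    have "of_real \<Delta> * u + cnj d = of_real \<Delta> * (u + cnj d / of_real \<Delta>)" using pos by (simp add: field_simps)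
    hence "cmod (of_real \<Delta> * u + cnj d) = \<Delta> * cmod (u + cnj d / of_real \<Delta>)" using pos by (simp only: norm_mult) simp
    thus ?thesis using pos by (simp add: pos_less_divide_eq mult.commute)
  qed
  also have "\<dots> \<longleftrightarrow> u \<in> ball (- cnj d / of_real \<Delta>) (R / \<Delta>)"
  proof -
    have "- cnj d / of_real \<Delta> - u = - (u + cnj d / of_real \<Delta>)" by simp
    hence "dist (- cnj d / of_real \<Delta>) u = cmod (u + cnj d / of_real \<Delta>)"
      by (simp only: dist_norm norm_minus_cancel)
    thus ?thesis by simp
  qed
  finally show "w \<in> ball z0 R \<longleftrightarrow> 1 / (w - p) \<in> ball (- cnj (p - z0) / of_real \<Delta>) (R / \<Delta>)"
    by (simp add: u_def d_def)
qed

text \<open>Let \<open>q\<close> be a point of the unit disc outside the given disc. The half-plane beyond \<open>q\<close>, seen from \<open>z0\<close>,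
avoids the disc, and one of the four centres lies at depth at least \<open>1\<close> in it.\<close>
lemma exists_far_pole:
  assumes R: "R > 0" and ns: "\<not> ball 0 1 \<subseteq> ball z0 R"
  shows "\<exists>p\<in>poles. cmod (p - z0) \<ge> R + 1"
proof -
  obtain q where q: "cmod q < 1" "cmod (q - z0) \<ge> R"
    using ns by (auto simp: subset_eq dist_norm norm_minus_commute not_less)
  \<comment> \<open>the outward direction at \<open>q\<close>\<close>
  define e where "e = sgn (q - z0)"
  have qz: "q \<noteq> z0" using q(2) R by auto
  have e1: "cmod e = 1" using qz by (simp add: e_def norm_sgn)
  have qe: "inner (q - z0) e = cmod (q - z0)"
    using qz by (simp add: e_def sgn_div_norm power2_norm_eq_inner[symmetric] power2_eq_square)
  have "\<bar>Re e\<bar> \<ge> 1 / 2 \<or> \<bar>Im e\<bar> \<ge> 1 / 2"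
  proof (rule ccontr)
    assume "\<not> ?thesis"
    hence "(Re e)\<^sup>2 < (1 / 2)\<^sup>2" "(Im e)\<^sup>2 < (1 / 2)\<^sup>2"
      by (auto simp: not_le abs_square_less_1 intro: power2_strict_mono)
    hence "(cmod e)\<^sup>2 < 1" unfolding cmod_power2 by (simp add: power_divide)
    thus False using e1 by simp
  qed
  hence "\<exists>p\<in>poles. inner p e \<ge> 2"
    by (auto simp: poles_def inner_complex_def abs_real_def split: if_splits)
  then obtain p where p: "p \<in> poles" "inner p e \<ge> 2" by blast
  have "inner q e \<le> 1" using Cauchy_Schwarz_ineq2[of q e] e1 q(1) by simp
  hence "R + 1 \<le> inner p e - inner q e + inner (q - z0) e" using p(2) qe q(2) by simp
  also have "\<dots> = inner (p - z0) e" by (simp add: inner_diff_left)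
  also have "\<dots> \<le> cmod (p - z0)" using Cauchy_Schwarz_ineq2[of "p - z0" e] e1 by simp
  finally show ?thesis using p(1) by blast
qed

text \<open>The deterministic input: an upper bound for \<open>ln |f|\<close> everywhere, a lower bound at the points that the
inversions send to the grid.\<close>
locale controlled_poly =
  fixes f :: "complex poly" and n :: nat and \<rho> M :: real
  assumes deg: "degree f = n" and n0: "n > 0"
    and \<rho>: "0 < \<rho>" "\<rho> \<le> 1 / 10" and nM: "real n * \<rho>\<^sup>2 \<le> M"
    and upper: "\<And>z. cmod (poly f z) \<le> exp (M + real n * disc_potential z)"
    and nonzero: "\<And>p. p \<in> poles \<Longrightarrow> poly f p \<noteq> 0"
    and lower: "\<And>p c. p \<in> poles \<Longrightarrow> c \<in> grid \<rho> \<Longrightarrow> cmod c \<le> 2 \<Longrightarrow>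
       exp (- M + real n * disc_potential (p + 1 / c)) \<le> cmod (poly f (p + 1 / c))"
begin

lemma f_nonzero: "f \<noteq> 0"
  using deg n0 by auto

text \<open>After the inversion the zeros have potential \<open>ln |f(p + 1/v)| + n ln |v| - ln |f(p)|\<close>, and the image of the
uniform disc has potential \<open>V(p + 1/v) + ln |v| - V(p)\<close>. The terms \<open>ln |v|\<close> cancel because \<open>f\<close> has exactly
\<open>n\<close> zeros, and the bounds on \<open>ln |f| - n V\<close> are inherited with \<open>K\<close> absorbing the values at \<open>p\<close>.\<close>
lemma discrepancy_far:
  assumes R: "R > 0" and p: "p \<in> poles" and far: "cmod (p - z0) \<ge> R + 1"
  shows "\<bar>root_sum f (indicator (ball z0 R)) - real n * measure uniform_disc (ball z0 R)\<bar>
     \<le> 10 ^ 6 * (real n * \<rho> + M / \<rho>)"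
proof -
  interpret regular_prob "inverted_disc p" 2500 by (rule regular_inverted_disc[OF p])
  let ?Z = "{w. poly f w = 0}" and ?T = "\<lambda>w. 1 / (w - p)"
  define K where "K = - (ln (cmod (poly f p)) - real n * disc_potential p)"
  define Y where "Y = (\<lambda>v. (\<Sum>w\<in>?Z. real (order w f) * ln (cmod (v - ?T w))) - real n * potential v)"
  have fin: "finite ?Z" by (rule poly_roots_finite[OF f_nonzero])
  have p_root: "w \<noteq> p" if "w \<in> ?Z" for w using nonzero[OF p] that by auto
  have order_sum: "(\<Sum>w\<in>?Z. real (order w f)) = real n"
    using sum_order_roots[OF f_nonzero] deg by (simp flip: of_nat_sum)
  have Y: "Y v = ln (cmod (poly f (p + 1 / v))) - real n * disc_potential (p + 1 / v) + K"
    if v: "v \<noteq> 0" "poly f (p + 1 / v) \<noteq> 0" for v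
  proof -
    have "(\<Sum>w\<in>?Z. real (order w f) * ln (cmod (v - ?T w))) =
       (\<Sum>w\<in>?Z. real (order w f) * (ln (cmod (p + 1 / v - w)) + ln (cmod v) - ln (cmod (p - w))))"
    proof (intro sum.cong refl arg_cong2[of _ _ _ _ "(*)"])
      fix w assume w: "w \<in> ?Z"
      hence "p + 1 / v \<noteq> w" using v by auto
      thus "ln (cmod (v - ?T w)) = ln (cmod (p + 1 / v - w)) + ln (cmod v) - ln (cmod (p - w))"
        using p_root[OF w] v by (subst inversion_diff) (auto simp: ln_mult ln_div)
    qed
    also have "\<dots> = root_sum f (\<lambda>w. ln (cmod (p + 1 / v - w))) + real n * ln (cmod v) - root_sum f (\<lambda>w. ln (cmod (p - w)))"
      unfolding root_sum_def order_sum[symmetric] sum_distrib_right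
      by (simp add: algebra_simps sum.distrib sum_subtractf)
    also have "\<dots> = ln (cmod (poly f (p + 1 / v))) + real n * ln (cmod v) - ln (cmod (poly f p))"
      using ln_cmod_poly[OF v(2)] ln_cmod_poly[OF nonzero[OF p]] by simp
    finally show ?thesis
      unfolding Y_def K_def potential_inverted_disc[OF p v(1)] by (simp add: algebra_simps)
  qed
  have null: "AE v in lborel. v \<noteq> 0 \<and> poly f (p + 1 / v) \<noteq> 0"
  proof -
    have "{v. v = 0 \<or> poly f (p + 1 / v) = 0} \<subseteq> insert 0 (?T ` ?Z)"
      by (auto simp: image_iff) (metis add_diff_cancel_left' divide_divide_eq_right divide_self_if mult_1 nonzero_divide_eq_eq)
    hence "finite {v. v = 0 \<or> poly f (p + 1 / v) = 0}" by (rule finite_subset) (use fin in auto)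
    from AE_not_in[OF finite_imp_null_set_lborel[OF this]] show ?thesis by simp
  qed
  have up: "AE v in lborel. Y v \<le> K + M"
    using null
  proof eventually_elim
    case (elim v)
    hence "ln (cmod (poly f (p + 1 / v))) \<le> ln (exp (M + real n * disc_potential (p + 1 / v)))"
      by (subst ln_le_cancel_iff) (auto simp: upper)
    thus ?case using Y[of v] elim by simp
  qed
  have grid_nz: "c \<noteq> 0" if "c \<in> grid \<rho>" for c
    using grid_abs_ge[OF \<rho>(1) that] \<rho> by auto
  have grid_f: "poly f (p + 1 / c) \<noteq> 0" if c: "c \<in> grid \<rho>" "cmod c \<le> 2" for c
  proof
    assume "poly f (p + 1 / c) = 0"
    thus False using lower[OF p c] by simp
  qed
  have low: "K - M \<le> Y c" if c: "c \<in> grid \<rho>" "cmod c \<le> 2" for c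
  proof -
    have "ln (exp (- M + real n * disc_potential (p + 1 / c))) \<le> ln (cmod (poly f (p + 1 / c)))"
      by (subst ln_le_cancel_iff) (use lower[OF p c] grid_f[OF c] in auto)
    thus ?thesis using Y[OF grid_nz[OF c(1)] grid_f[OF c]] by simp
  qed
  have ne: "?T w \<noteq> c" if c: "c \<in> grid \<rho>" "cmod c \<le> 2" and w: "w \<in> ?Z" for c w
  proof
    assume "?T w = c"
    hence "1 / c = w - p" by auto
    hence "p + 1 / c = w" by simp
    thus False using grid_f[OF c] w by simp
  qed
  define \<Delta> where "\<Delta> = (cmod (p - z0))\<^sup>2 - R\<^sup>2"
  define u0 where "u0 = - cnj (p - z0) / of_real \<Delta>"
  note inv = inversion_ball_iff[OF R far, folded \<Delta>_def, folded u0_def]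
  have sum_eq: "(\<Sum>w\<in>?Z. real (order w f) * indicator (ball u0 (R / \<Delta>)) (?T w)) = root_sum f (indicator (ball z0 R))"
    unfolding root_sum_def using inv(3) p_root by (intro sum.cong) (auto simp: indicator_def)
  have "measure (inverted_disc p) (ball u0 (R / \<Delta>)) = measure uniform_disc {w. ?T w \<in> ball u0 (R / \<Delta>)}"
    unfolding inverted_disc_def by (subst measure_distr) (auto simp: vimage_def)
  also have "\<dots> = measure uniform_disc (ball z0 R)"
  proof (rule measure_eq_AE)
    show "AE w in uniform_disc. w \<in> {w. ?T w \<in> ball u0 (R / \<Delta>)} \<longleftrightarrow> w \<in> ball z0 R"
      using AE_uniform_disc_neq[of p] by eventually_elim (use inv(3) in auto)
  qed auto
  finally have m_eq: "measure (inverted_disc p) (ball u0 (R / \<Delta>)) = measure uniform_disc (ball z0 R)" .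
  have M0: "M \<ge> 0" using nM by (rule order_trans[rotated]) simp
  have "\<bar>(\<Sum>w\<in>?Z. real (order w f) * indicator (ball u0 (R / \<Delta>)) (?T w)) - real n * measure (inverted_disc p) (ball u0 (R / \<Delta>))\<bar>
      \<le> (280 * 2500) * (real n * \<rho>) + 560 * (3 + 2500 / 2) * (M / \<rho>)"
    by (rule counting_discrepancy[where K = K])
       (use fin \<rho> nM up low ne inv(1,2) R in \<open>auto simp: Y_def\<close>)
  also have "\<dots> \<le> 10 ^ 6 * (real n * \<rho> + M / \<rho>)"
  proof -
    have le: "(280 * 2500) * y + 560 * (3 + 2500 / 2) * x \<le> 10 ^ 6 * (y + x)" if "0 \<le> x" "0 \<le> y" for x y :: real
      using that by simp
    show ?thesis by (rule le) (use M0 \<rho> in auto)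
  qed
  finally show ?thesis unfolding sum_eq m_eq .
qed

theorem discrepancy_bound:
  "disc_discrepancy (zeros_measure n f) uniform_disc \<le> 10 ^ 6 * (\<rho> + M / (real n * \<rho>))"
proof -
  interpret U: prob_space uniform_disc by (rule prob_space_uniform_disc)
  interpret Z: finite_measure "zeros_measure n f" by (rule finite_measure_zeros_measure)
  define E where "E = 10 ^ 6 * (\<rho> + M / (real n * \<rho>))"
  have M0: "M \<ge> 0" using nM by (rule order_trans[rotated]) simp
  have E0: "E \<ge> 0" using M0 \<rho> by (simp add: E_def)
  have main: "\<bar>measure (zeros_measure n f) (ball z0 R) - measure uniform_disc (ball z0 R)\<bar> \<le> E"
    if R: "R > 0" and ns: "\<not> ball 0 1 \<subseteq> ball z0 R" for z0 R
  proof -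
    obtain p where p: "p \<in> poles" "cmod (p - z0) \<ge> R + 1" using exists_far_pole[OF R ns] by blast
    have "measure (zeros_measure n f) (ball z0 R) - measure uniform_disc (ball z0 R) =
        (root_sum f (indicator (ball z0 R)) - real n * measure uniform_disc (ball z0 R)) / real n"
      using n0 by (simp add: measure_zeros_measure field_simps)
    hence "\<bar>measure (zeros_measure n f) (ball z0 R) - measure uniform_disc (ball z0 R)\<bar> =
        \<bar>root_sum f (indicator (ball z0 R)) - real n * measure uniform_disc (ball z0 R)\<bar> / real n"
      by simp
    also have "\<dots> \<le> (10 ^ 6 * (real n * \<rho> + M / \<rho>)) / real n"
      by (intro divide_right_mono discrepancy_far[OF R p]) auto
    also have "\<dots> = E" using n0 \<rho> by (simp add: E_def field_simps)
    finally show ?thesis .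
  qed
  have "\<bar>measure (zeros_measure n f) (ball z0 R) - measure uniform_disc (ball z0 R)\<bar> \<le> E" if R: "R > 0" for z0 R
  proof (cases "ball 0 1 \<subseteq> ball z0 R")
    case True
    have full: "measure uniform_disc (ball z0 R) = 1"
    proof -
      have "AE w in uniform_disc. w \<in> ball z0 R" using AE_uniform_disc True by (auto elim!: eventually_mono)
      thus ?thesis by (intro U.prob_eq_1[THEN iffD2]) auto
    qed
    have disc: "measure uniform_disc (ball 0 r) = r\<^sup>2" if "0 < r" "r < 1" for r
    proof -
      have "measure uniform_disc (ball 0 r) = measure lborel (ball 0 1 \<inter> ball (0::complex) r) / measure lborel (ball (0::complex) 1)"
        unfolding uniform_disc_def
        by (subst measure_uniform_measure) (auto simp: emeasure_lborel_unit_disc)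
      also have "ball 0 1 \<inter> ball 0 r = (ball 0 r :: complex set)" using that by auto
      finally show ?thesis using that by (simp add: measure_ball_complex)
    qed
    have total: "measure (zeros_measure n f) (ball z0 R) \<le> 1"
    proof -
      have "root_sum f (indicator (ball z0 R)) \<le> (\<Sum>w | poly f w = 0. real (order w f))"
        unfolding root_sum_def by (intro sum_mono) (auto simp: indicator_def)
      also have "\<dots> = real n" using sum_order_roots[OF f_nonzero] deg by (simp flip: of_nat_sum)
      finally show ?thesis using n0 by (simp add: measure_zeros_measure)
    qed
    have "1 \<le> measure (zeros_measure n f) (ball z0 R) + E"
    proof (rule ccontr)
      define x where "x = measure (zeros_measure n f) (ball z0 R) + E"
      assume "\<not> ?thesis"
      hence x: "x < 1" by (simp add: x_def)
      have x0: "x \<ge> 0" using E0 by (simp add: x_def)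
      \<comment> \<open>any radius with \<open>x < r\<^sup>2 < 1\<close>\<close>
      define r where "r = sqrt ((1 + x) / 2)"
      have r: "0 < r" "r < 1" "r\<^sup>2 = (1 + x) / 2" using x x0 by (auto simp: r_def)
      have ns: "\<not> ball 0 1 \<subseteq> (ball 0 r :: complex set)"
      proof
        assume "ball 0 1 \<subseteq> (ball 0 r :: complex set)"
        moreover have "complex_of_real r \<in> ball 0 1" using r by simp
        ultimately have "complex_of_real r \<in> ball 0 r" by blast
        thus False by simp
      qed
      have "r\<^sup>2 \<le> measure (zeros_measure n f) (ball 0 r) + E"
        using main[OF r(1) ns] disc[OF r(1,2)] by linarith
      also have "measure (zeros_measure n f) (ball 0 r) \<le> measure (zeros_measure n f) (ball z0 R)"
        using True r by (intro Z.finite_measure_mono) auto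
      finally show False using r(3) x unfolding x_def by simp
    qed
    thus ?thesis using full total E0 by simp
  qed (use main R in blast)
  thus ?thesis
    unfolding E_def[symmetric]
    by (subst disc_discrepancy_le_iff)
       (auto simp: finite_measure_zeros_measure intro: prob_space.finite_measure prob_space_uniform_disc)
qed

end

section \<open>Lacunary sums and small balls\<close>

text \<open>Weights in decreasing order, each of which dominates all later ones even if these carry coefficients of size
\<open>B\<close>, up to the precision \<open>t\<close>.\<close>
fun lacunary :: "real \<Rightarrow> real \<Rightarrow> real \<Rightarrow> real list \<Rightarrow> bool" where
  "lacunary t B r [] \<longleftrightarrow> True"
| "lacunary t B r (a # as) \<longleftrightarrow> t + B * sum_list as \<le> r * a \<and> lacunary t B r as"

text \<open>The chain is built from below: if \<open>T\<close> is the total that the next weight has to dominate, take the first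
index \<open>k\<close> with \<open>r * a k \<ge> T\<close>. By minimality and the bound \<open>s\<close> on the growth, \<open>a k\<close> is not much larger than
needed, so that the new total is at most \<open>G * T\<close>. Thus the chain can be continued until the totals,
starting from \<open>t\<close>, exceed \<open>r * a K\<close>.\<close>
lemma exists_lacunary:
  fixes a :: "nat \<Rightarrow> real"
  assumes r: "0 < r" "r < B" and t: "0 < t" and s: "s \<ge> 0"
    and step: "\<And>k. k < K \<Longrightarrow> a (Suc k) \<le> s * a k"
    and start: "r * a 0 < t"
  defines "G \<equiv> 1 + B * s / r"
  assumes top: "G ^ J * t \<le> r * a K"
  shows "\<exists>L. distinct L \<and> length L = J \<and> set L \<subseteq> {..K} \<and> lacunary t B r (map a L)"
proof -
  have G: "G \<ge> 1" using r s by (simp add: G_def)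
  have "j \<le> J \<Longrightarrow> \<exists>L. distinct L \<and> length L = j \<and> set L \<subseteq> {..K} \<and> lacunary t B r (map a L) \<and>
      t \<le> t + B * sum_list (map a L) \<and> t + B * sum_list (map a L) \<le> G ^ j * t \<and>
      (\<forall>i\<in>set L. r * a i < t + B * sum_list (map a L))" for j
  proof (induction j)
    case 0
    show ?case by (intro exI[of _ "[]"]) simp
  next
    case (Suc j)
    then obtain L where L: "distinct L" "length L = j" "set L \<subseteq> {..K}" "lacunary t B r (map a L)"
      "t \<le> t + B * sum_list (map a L)" "t + B * sum_list (map a L) \<le> G ^ j * t"
      "\<forall>i\<in>set L. r * a i < t + B * sum_list (map a L)" by auto
    define T where "T = t + B * sum_list (map a L)"
    have "T \<le> G ^ j * t" using L(6) by (simp add: T_def)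
    also have "\<dots> \<le> G ^ J * t" using Suc.prems G t by (intro mult_right_mono power_increasing) auto
    also note top
    finally have TK: "T \<le> r * a K" .
    define k where "k = (LEAST k. T \<le> r * a k)"
    have k: "T \<le> r * a k" unfolding k_def by (rule LeastI[of _ K]) (rule TK)
    have kK: "k \<le> K" unfolding k_def by (rule Least_le) (rule TK)
    have Tt: "t \<le> T" using L(5) by (simp add: T_def)
    have "k \<noteq> 0"
    proof
      assume "k = 0"
      thus False using k start Tt by simp
    qed
    then obtain k' where k': "k = Suc k'" by (cases k) auto
    have below: "r * a k' < T"
      using not_less_Least[of k' "\<lambda>k. T \<le> r * a k"] k' by (simp add: k_def[symmetric] not_le)
    have ak: "a k > 0" using k Tt t r by (smt (verit) zero_less_mult_iff)
    have "a k \<le> s * a k'" using step[of k'] kK k' by simp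
    also have "\<dots> \<le> s * (T / r)" using below r s by (intro mult_left_mono) (auto simp: field_simps)
    finally have "B * a k \<le> B * (s * (T / r))" using r by (intro mult_left_mono) auto
    hence "T + B * a k \<le> G * T" by (simp add: G_def algebra_simps)
    also have "\<dots> \<le> G * (G ^ j * t)" using L(6) G by (intro mult_left_mono) (auto simp: T_def)
    finally have up: "T + B * a k \<le> G ^ Suc j * t" by simp
    have "k \<notin> set L" using L(7) k by (auto simp: T_def)
    moreover have "r * a k < T + B * a k"
      using mult_strict_right_mono[OF r(2) ak] Tt t by linarith
    moreover have "0 \<le> B * a k" using r ak by simp
    ultimately show ?case
      using L k kK up Tt
      by (intro exI[of _ "k # L"]) (auto simp: T_def algebra_simps intro: less_le_trans)
  qed
  from this[of J] show ?thesis by blast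
qed

locale concentration =
  fixes \<mu> :: "complex measure" and r \<eta> :: real
  assumes prob: "prob_space \<mu>" and sets_\<mu> [simp, measurable_cong]: "sets \<mu> = sets borel"
    and r: "r > 0" and \<eta>: "\<eta> \<ge> 0"
    and conc: "\<And>c. emeasure \<mu> (cball c r) \<le> ennreal \<eta>"
begin

sublocale product_sigma_finite "\<lambda>_. \<mu>"
  by (intro product_sigma_finite.intro prob_space_imp_sigma_finite prob)

definition small_event :: "('i \<Rightarrow> complex) \<Rightarrow> real \<Rightarrow> real \<Rightarrow> 'i set \<Rightarrow> 'i list \<Rightarrow> complex \<Rightarrow> ('i \<Rightarrow> complex) set" where
  "small_event a t B I L c = {x \<in> space (PiM I (\<lambda>_. \<mu>)).
      (\<forall>i\<in>set L. cmod (x i) \<le> B) \<and> cmod ((\<Sum>i\<in>I. a i * x i) - c) \<le> t}"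

lemma small_event_sets:
  assumes "finite I" "set L \<subseteq> I"
  shows "small_event a t B I L c \<in> sets (PiM I (\<lambda>_. \<mu>))"
proof -
  have comp [measurable]: "(\<lambda>x. x i) \<in> borel_measurable (PiM I (\<lambda>_. \<mu>))" if "i \<in> I" for i
    using measurable_component_singleton[OF that, of "\<lambda>_. \<mu>"] by (simp cong: measurable_cong_sets)
  have "{x \<in> space (PiM I (\<lambda>_. \<mu>)). \<forall>i\<in>set L. cmod (x i) \<le> B} \<in> sets (PiM I (\<lambda>_. \<mu>))"
    using assms by (intro sets.sets_Collect_finite_All borel_measurable_le) (auto intro: comp)
  moreover have "(\<lambda>x. (\<Sum>i\<in>I. a i * x i) - c) \<in> borel_measurable (PiM I (\<lambda>_. \<mu>))"
    by (intro borel_measurable_diff borel_measurable_sum borel_measurable_times comp) auto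
  hence "{x \<in> space (PiM I (\<lambda>_. \<mu>)). cmod ((\<Sum>i\<in>I. a i * x i) - c) \<le> t} \<in> sets (PiM I (\<lambda>_. \<mu>))"
    by measurable
  ultimately show ?thesis
    unfolding small_event_def by (intro sets.sets_Collect_conj)
qed

lemma emeasure_small_event_insert:
  assumes "finite J" "k \<notin> J" "set L \<subseteq> insert k J"
  shows "emeasure (PiM (insert k J) (\<lambda>_. \<mu>)) (small_event a t B (insert k J) L c) =
     (\<integral>\<^sup>+y. (\<integral>\<^sup>+x. indicator (small_event a t B (insert k J) L c) (x(k := y)) \<partial>PiM J (\<lambda>_. \<mu>)) \<partial>\<mu>)"
proof -
  have S: "small_event a t B (insert k J) L c \<in> sets (PiM (insert k J) (\<lambda>_. \<mu>))"
    using assms by (intro small_event_sets) auto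
  have "emeasure (PiM (insert k J) (\<lambda>_. \<mu>)) (small_event a t B (insert k J) L c) =
     (\<integral>\<^sup>+x. indicator (small_event a t B (insert k J) L c) x \<partial>PiM (insert k J) (\<lambda>_. \<mu>))"
    using S by simp
  also have "\<dots> = (\<integral>\<^sup>+y. (\<integral>\<^sup>+x. indicator (small_event a t B (insert k J) L c) (x(k := y)) \<partial>PiM J (\<lambda>_. \<mu>)) \<partial>\<mu>)"
    using S assms by (intro product_nn_integral_insert_rev) auto
  finally show ?thesis .
qed

lemma small_event_shift:
  assumes "finite J" "k \<notin> J" "x(k := y) \<in> small_event a t B (insert k J) L c" "set L' \<subseteq> set L" "set L' \<subseteq> J"
    "x \<in> space (PiM J (\<lambda>_. \<mu>))"
  shows "x \<in> small_event a t B J L' (c - a k * y)"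
proof -
  have "(\<Sum>i\<in>insert k J. a i * (x(k := y)) i) = a k * y + (\<Sum>i\<in>J. a i * x i)"
    using assms(1,2) by (auto intro!: sum.cong)
  moreover have "cmod (x i) \<le> B" if "i \<in> set L'" for i
  proof -
    have "i \<noteq> k" "i \<in> set L" using that assms(2,4,5) by auto
    thus ?thesis using assms(3) by (auto simp: small_event_def split: if_splits)
  qed
  ultimately show ?thesis using assms(3,6) by (simp add: small_event_def algebra_simps)
qed

text \<open>Integrate out the coordinate with the largest weight last. On the event the other terms of the sum are
bounded by \<open>B\<close> times the sum of their weights, which confines this coordinate to a disc of radius \<open>r\<close>; for
each fixed value of it the induction hypothesis applies with a shifted centre.\<close>
lemma small_ball_lacunary:
  assumes "distinct L" "lacunary t B r (map (cmod \<circ> a) L)" "t > 0"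
  shows "emeasure (PiM (set L) (\<lambda>_. \<mu>)) (small_event a t B (set L) L c) \<le> ennreal (\<eta> ^ length L)"
  using assms(1,2)
proof (induction L arbitrary: c)
  case Nil
  interpret P: prob_space "PiM {} (\<lambda>_. \<mu>)" by (intro prob_space_PiM prob)
  show ?case using P.emeasure_le_1 by simp
next
  case (Cons k L)
  let ?J = "set L" and ?P = "PiM (set L) (\<lambda>_. \<mu>)"
  let ?E = "small_event a t B (insert k ?J) (k # L)"
  have k: "k \<notin> ?J" using Cons.prems by simp
  have lac: "t + B * (\<Sum>i\<leftarrow>L. cmod (a i)) \<le> r * cmod (a k)" using Cons.prems by (simp add: o_def)
  have "emeasure (PiM (set (k # L)) (\<lambda>_. \<mu>)) (small_event a t B (set (k # L)) (k # L) c) =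
     (\<integral>\<^sup>+y. (\<integral>\<^sup>+x. indicator (?E c) (x(k := y)) \<partial>?P) \<partial>\<mu>)"
    using k by (simp add: emeasure_small_event_insert)
  also have "\<dots> \<le> (\<integral>\<^sup>+y. ennreal (\<eta> ^ length L) * indicator (cball (c / a k) r) y \<partial>\<mu>)"
  proof (rule nn_integral_mono)
    fix y
    have "(\<integral>\<^sup>+x. indicator (?E c) (x(k := y)) \<partial>?P) \<le>
        (\<integral>\<^sup>+x. indicator (small_event a t B ?J L (c - a k * y)) x * indicator (cball (c / a k) r) y \<partial>?P)"
    proof (rule nn_integral_mono)
      fix x assume x: "x \<in> space ?P"
      show "indicator (?E c) (x(k := y)) \<le> (indicator (small_event a t B ?J L (c - a k * y)) x * indicator (cball (c / a k) r) y :: ennreal)"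
      proof (cases "x(k := y) \<in> ?E c")
        case True
        have "x \<in> small_event a t B ?J L (c - a k * y)"
          by (rule small_event_shift[OF _ k True]) (use x in auto)
        moreover have "y \<in> cball (c / a k) r"
        proof -
          let ?S = "\<Sum>i\<in>?J. a i * x i"
          have "cmod ?S \<le> (\<Sum>i\<in>?J. cmod (a i) * B)"
          proof (rule sum_norm_le)
            fix i assume "i \<in> ?J"
            hence "cmod (x i) \<le> B" using True k by (auto simp: small_event_def split: if_splits)
            thus "cmod (a i * x i) \<le> cmod (a i) * B" by (simp add: norm_mult mult_left_mono)
          qed
          also have "\<dots> = B * (\<Sum>i\<leftarrow>L. cmod (a i))"
            using Cons.prems by (simp add: sum_list_distinct_conv_sum_set sum_distrib_left mult.commute)
          finally have S: "cmod ?S \<le> B * (\<Sum>i\<leftarrow>L. cmod (a i))" .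
          have "(\<Sum>i\<in>insert k ?J. a i * (x(k := y)) i) = a k * y + ?S"
            using k by (auto intro!: sum.cong)
          hence "cmod (a k * y + ?S - c) \<le> t" using True by (simp add: small_event_def)
          hence le: "cmod (a k * y - c) \<le> r * cmod (a k)"
            using lac S norm_triangle_ineq4[of "a k * y + ?S - c" ?S] by (simp add: algebra_simps)
          have ak: "a k \<noteq> 0"
          proof
            assume "a k = 0"
            hence "t + cmod ?S \<le> 0" using lac S by simp
            thus False using assms(3) norm_ge_zero[of ?S] by linarith
          qed
          have "cmod (a k * y - c) = cmod (a k) * cmod (c / a k - y)"
            using ak by (simp add: norm_minus_commute right_diff_distrib flip: norm_mult)
          hence "cmod (c / a k - y) \<le> r" using le ak by simp
          thus ?thesis by (simp add: dist_norm)
        qed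
        ultimately show ?thesis by (simp add: indicator_def)
      qed simp
    qed
    also have "\<dots> = emeasure ?P (small_event a t B ?J L (c - a k * y)) * indicator (cball (c / a k) r) y"
      using small_event_sets[of ?J L a t B "c - a k * y"] by (simp add: nn_integral_multc)
    also have "\<dots> \<le> ennreal (\<eta> ^ length L) * indicator (cball (c / a k) r) y"
      using Cons by (intro mult_right_mono Cons.IH) auto
    finally show "(\<integral>\<^sup>+x. indicator (?E c) (x(k := y)) \<partial>?P) \<le> ennreal (\<eta> ^ length L) * indicator (cball (c / a k) r) y" .
  qed
  also have "\<dots> = ennreal (\<eta> ^ length L) * emeasure \<mu> (cball (c / a k) r)"
    by (rule nn_integral_cmult_indicator) simp
  also have "\<dots> \<le> ennreal (\<eta> ^ length L) * ennreal \<eta>"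
    by (intro mult_left_mono conc) simp
  also have "\<dots> = ennreal (\<eta> ^ length (k # L))" using \<eta> by (simp add: ennreal_mult[symmetric] mult.commute)
  finally show ?case .
qed

text \<open>The coordinates outside the chain can be frozen, as the bound is uniform in the centre.\<close>
lemma small_ball_sum:
  assumes "distinct L" "lacunary t B r (map (cmod \<circ> a) L)" "t > 0"
    and F: "finite F" "F \<inter> set L = {}"
  shows "emeasure (PiM (set L \<union> F) (\<lambda>_. \<mu>)) (small_event a t B (set L \<union> F) L c) \<le> ennreal (\<eta> ^ length L)"
  using F
proof (induction F arbitrary: c rule: finite_induct)
  case empty
  show ?case using small_ball_lacunary[OF assms(1-3)] by simp
next
  case (insert k F)
  let ?J = "set L \<union> F" and ?P = "PiM (set L \<union> F) (\<lambda>_. \<mu>)"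
  have k: "k \<notin> ?J" using insert by auto
  have "emeasure (PiM (set L \<union> insert k F) (\<lambda>_. \<mu>)) (small_event a t B (set L \<union> insert k F) L c) =
     (\<integral>\<^sup>+y. (\<integral>\<^sup>+x. indicator (small_event a t B (insert k ?J) L c) (x(k := y)) \<partial>?P) \<partial>\<mu>)"
    by (subst emeasure_small_event_insert[symmetric]) (use insert.hyps(1) k in auto)
  also have "\<dots> \<le> (\<integral>\<^sup>+y. ennreal (\<eta> ^ length L) \<partial>\<mu>)"
  proof (rule nn_integral_mono)
    fix y
    have "(\<integral>\<^sup>+x. indicator (small_event a t B (insert k ?J) L c) (x(k := y)) \<partial>?P) \<le>
        (\<integral>\<^sup>+x. indicator (small_event a t B ?J L (c - a k * y)) x \<partial>?P)"
    proof (rule nn_integral_mono)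
      fix x assume x: "x \<in> space ?P"
      show "indicator (small_event a t B (insert k ?J) L c) (x(k := y)) \<le> (indicator (small_event a t B ?J L (c - a k * y)) x :: ennreal)"
        using small_event_shift[of ?J k x y a t B L c L] k x insert.hyps(1) by (auto simp: indicator_def)
    qed
    also have "\<dots> = emeasure ?P (small_event a t B ?J L (c - a k * y))"
      using small_event_sets[of ?J L a t B "c - a k * y"] insert.hyps(1) by simp
    also have "\<dots> \<le> ennreal (\<eta> ^ length L)" using insert by (intro insert.IH) auto
    finally show "(\<integral>\<^sup>+x. indicator (small_event a t B (insert k ?J) L c) (x(k := y)) \<partial>?P) \<le> ennreal (\<eta> ^ length L)" .
  qed
  also have "\<dots> = ennreal (\<eta> ^ length L)"
    using prob_space.emeasure_space_1[OF prob] by simp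
  finally show ?case .
qed

end

text \<open>A centred variable that is not almost surely zero takes both signs.\<close>
lemma (in prob_space) centered_two_sided:
  fixes X :: "'a \<Rightarrow> real"
  assumes int: "integrable M X" and mean: "expectation X = 0" and ne: "\<not> (AE \<omega> in M. X \<omega> = 0)"
  shows "\<exists>a>0. prob {\<omega> \<in> space M. X \<omega> \<ge> a} > 0 \<and> prob {\<omega> \<in> space M. X \<omega> \<le> - a} > 0"
proof -
  have [measurable]: "X \<in> borel_measurable M" using int by simp
  have pos: "\<exists>a>0. prob {\<omega> \<in> space M. Z \<omega> \<ge> a} > 0"
    if Z: "integrable M Z" "expectation Z = 0" "\<not> (AE \<omega> in M. Z \<omega> = 0)" for Z :: "'a \<Rightarrow> real"
  proof (rule ccontr)
    assume *: "\<not> ?thesis"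
    have [measurable]: "Z \<in> borel_measurable M" using Z by simp
    have "AE \<omega> in M. \<not> Z \<omega> \<ge> 1 / real (Suc j)" for j
    proof -
      have "prob {\<omega> \<in> space M. Z \<omega> \<ge> 1 / real (Suc j)} = 0"
        using * measure_nonneg[of M] by (metis less_eq_real_def of_nat_0_less_iff zero_less_Suc zero_less_divide_1_iff)
      thus ?thesis by (subst (asm) prob_Collect_eq_0) auto
    qed
    hence "AE \<omega> in M. \<forall>j. \<not> Z \<omega> \<ge> 1 / real (Suc j)" by (simp add: AE_all_countable)
    hence le: "AE \<omega> in M. 0 \<le> - Z \<omega>"
    proof eventually_elim
      case (elim \<omega>)
      show ?case
      proof (rule ccontr)
        assume "\<not> 0 \<le> - Z \<omega>"
        then obtain j where "inverse (real (Suc j)) < Z \<omega>" using reals_Archimedean[of "Z \<omega>"] by auto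
        thus False using elim by (auto simp: inverse_eq_divide dest!: spec[of _ j])
      qed
    qed
    have "AE \<omega> in M. - Z \<omega> = 0"
      using Z by (subst integral_nonneg_eq_0_iff_AE[symmetric]) (use le in auto)
    thus False using Z(3) by simp
  qed
  obtain a where a: "a > 0" "prob {\<omega> \<in> space M. X \<omega> \<ge> a} > 0" using pos[OF int mean ne] by blast
  obtain b where b: "b > 0" "prob {\<omega> \<in> space M. - X \<omega> \<ge> b} > 0"
    using pos[of "\<lambda>\<omega>. - X \<omega>"] int mean ne by auto
  have "prob {\<omega> \<in> space M. X \<omega> \<ge> a} \<le> prob {\<omega> \<in> space M. X \<omega> \<ge> min a b}"
    by (intro finite_measure_mono) auto
  moreover have "prob {\<omega> \<in> space M. - X \<omega> \<ge> b} \<le> prob {\<omega> \<in> space M. X \<omega> \<le> - min a b}"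
    by (intro finite_measure_mono) auto
  ultimately show ?thesis using a b by (intro exI[of _ "min a b"]) auto
qed

text \<open>The real or the imaginary part is at least \<open>a\<close> with positive probability and at most \<open>- a\<close> with positive
probability. A disc of radius \<open>a / 2\<close> misses one of these two events.\<close>
lemma (in prob_space) centered_concentration:
  fixes \<zeta> :: "'a \<Rightarrow> complex"
  assumes int: "integrable M \<zeta>" and mean: "expectation \<zeta> = 0" and ne: "\<not> (AE \<omega> in M. \<zeta> \<omega> = 0)"
  shows "\<exists>r \<eta>. 0 < r \<and> 0 < \<eta> \<and> \<eta> < 1 \<and> (\<forall>c. prob {\<omega> \<in> space M. \<zeta> \<omega> \<in> cball c r} \<le> \<eta>)"
proof -
  have [measurable]: "\<zeta> \<in> borel_measurable M" using int by simp
  have main: ?thesis if g: "\<And>z w. \<bar>g z - g w\<bar> \<le> cmod (z - w)" "g \<in> borel_measurable borel"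
    and X: "integrable M (\<lambda>\<omega>. g (\<zeta> \<omega>))" "expectation (\<lambda>\<omega>. g (\<zeta> \<omega>)) = 0"
      "\<not> (AE \<omega> in M. g (\<zeta> \<omega>) = 0)" for g :: "complex \<Rightarrow> real"
  proof -
    note [measurable] = g(2)
    obtain a where a: "a > 0" "prob {\<omega> \<in> space M. g (\<zeta> \<omega>) \<ge> a} > 0" "prob {\<omega> \<in> space M. g (\<zeta> \<omega>) \<le> - a} > 0"
      using centered_two_sided[OF X] by blast
    define q where "q = min (1 / 2) (min (prob {\<omega> \<in> space M. g (\<zeta> \<omega>) \<ge> a}) (prob {\<omega> \<in> space M. g (\<zeta> \<omega>) \<le> - a}))"
    have q: "0 < q" "q \<le> 1 / 2" using a by (auto simp: q_def)
    have "prob {\<omega> \<in> space M. \<zeta> \<omega> \<in> cball c (a / 2)} \<le> 1 - q" for c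
    proof -
      have disj: "prob {\<omega> \<in> space M. \<zeta> \<omega> \<in> cball c (a / 2)} \<le> 1 - prob S"
        if S: "S \<in> events" "\<And>\<omega>. \<omega> \<in> S \<Longrightarrow> \<zeta> \<omega> \<notin> cball c (a / 2)" for S
      proof -
        have "prob {\<omega> \<in> space M. \<zeta> \<omega> \<in> cball c (a / 2)} \<le> prob (space M - S)"
          using S by (intro finite_measure_mono) auto
        thus ?thesis using prob_compl[OF S(1)] by simp
      qed
      show ?thesis
      proof (cases "g c \<ge> 0")
        case True
        have "\<zeta> \<omega> \<notin> cball c (a / 2)" if "g (\<zeta> \<omega>) \<le> - a" for \<omega>
          using g(1)[of c "\<zeta> \<omega>"] True that a(1) by (auto simp: dist_norm)
        hence "prob {\<omega> \<in> space M. \<zeta> \<omega> \<in> cball c (a / 2)} \<le> 1 - prob {\<omega> \<in> space M. g (\<zeta> \<omega>) \<le> - a}"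
          by (intro disj) auto
        thus ?thesis by (simp add: q_def min_def)
      next
        case False
        have "\<zeta> \<omega> \<notin> cball c (a / 2)" if "g (\<zeta> \<omega>) \<ge> a" for \<omega>
          using g(1)[of c "\<zeta> \<omega>"] False that a(1) by (auto simp: dist_norm)
        hence "prob {\<omega> \<in> space M. \<zeta> \<omega> \<in> cball c (a / 2)} \<le> 1 - prob {\<omega> \<in> space M. g (\<zeta> \<omega>) \<ge> a}"
          by (intro disj) auto
        thus ?thesis by (simp add: q_def min_def)
      qed
    qed
    thus ?thesis using a(1) q by (intro exI[of _ "a / 2"] exI[of _ "1 - q"]) auto
  qed
  have "\<not> (AE \<omega> in M. Re (\<zeta> \<omega>) = 0) \<or> \<not> (AE \<omega> in M. Im (\<zeta> \<omega>) = 0)"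
  proof (rule ccontr)
    assume "\<not> ?thesis"
    hence "AE \<omega> in M. Re (\<zeta> \<omega>) = 0" "AE \<omega> in M. Im (\<zeta> \<omega>) = 0" by auto
    hence "AE \<omega> in M. \<zeta> \<omega> = 0" by eventually_elim (simp add: complex_eq_iff)
    thus False using ne by simp
  qed
  thus ?thesis
  proof
    assume "\<not> (AE \<omega> in M. Re (\<zeta> \<omega>) = 0)"
    thus ?thesis using int mean
      by (intro main[of Re]) (auto simp: abs_Re_le_cmod simp flip: minus_complex.sel)
  next
    assume "\<not> (AE \<omega> in M. Im (\<zeta> \<omega>) = 0)"
    thus ?thesis using int mean
      by (intro main[of Im]) (auto simp: abs_Im_le_cmod simp flip: minus_complex.sel)
  qed
qed

section \<open>Weyl polynomials at a fixed point\<close>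

text \<open>The moduli of the coefficients in \<open>exp (- n V(z)) f(z)\<close>, as a linear form in the random variables. In the
unit disc their squares are Poisson probabilities with parameter \<open>n |z|\<^sup>2\<close>.\<close>
definition weyl_weight :: "nat \<Rightarrow> complex \<Rightarrow> nat \<Rightarrow> real" where
  "weyl_weight n z k = sqrt (real n ^ k / fact k) * cmod z ^ k * exp (- (real n * disc_potential z))"

lemma weyl_weight_nonneg: "0 \<le> weyl_weight n z k"
  by (simp add: weyl_weight_def)

lemma exp_partial_sum_le: "x \<ge> 0 \<Longrightarrow> (\<Sum>k\<le>n. x ^ k / fact k) \<le> exp (x::real)"
  unfolding exp_def scaleR_conv_of_real
  by (simp add: divide_inverse mult.commute) (rule sum_le_suminf, use summable_exp[of x] in \<open>auto simp: mult.commute\<close>)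

lemma weyl_weight_square:
  "(weyl_weight n z k)\<^sup>2 = (real n ^ k / fact k) * (cmod z ^ k)\<^sup>2 * exp (- (2 * real n * disc_potential z))"
  by (simp add: weyl_weight_def power_mult_distrib flip: exp_of_nat_mult)

lemma sum_weyl_weight_square: "(\<Sum>k\<le>n. (weyl_weight n z k)\<^sup>2) \<le> 1"
proof -
  have "(\<Sum>k\<le>n. (real n ^ k / fact k) * (cmod z ^ k)\<^sup>2) \<le> exp (2 * real n * disc_potential z)"
  proof (cases "cmod z \<le> 1")
    case True
    have "(\<Sum>k\<le>n. (real n ^ k / fact k) * (cmod z ^ k)\<^sup>2) = (\<Sum>k\<le>n. (real n * (cmod z)\<^sup>2) ^ k / fact k)"
      by (simp add: power_mult_distrib power_mult[symmetric] mult.commute)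
    also have "\<dots> \<le> exp (real n * (cmod z)\<^sup>2)" by (rule exp_partial_sum_le) simp
    finally show ?thesis using True by (simp add: disc_potential_def)
  next
    case False
    have "(\<Sum>k\<le>n. (real n ^ k / fact k) * (cmod z ^ k)\<^sup>2) \<le> (\<Sum>k\<le>n. (real n ^ k / fact k) * (cmod z ^ n)\<^sup>2)"
      using False by (intro sum_mono mult_left_mono power_mono power_increasing) auto
    also have "\<dots> = (\<Sum>k\<le>n. real n ^ k / fact k) * (cmod z ^ n)\<^sup>2" by (simp add: sum_distrib_right)
    also have "\<dots> \<le> exp (real n) * (cmod z ^ n)\<^sup>2"
      by (intro mult_right_mono exp_partial_sum_le) auto
    also have "(cmod z ^ n)\<^sup>2 = exp (2 * real n * ln (cmod z))"
    proof -
      have "cmod z > 0" using False by linarith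
      hence "cmod z ^ n = exp (real n * ln (cmod z))" by (simp add: exp_of_nat_mult)
      thus ?thesis by (simp add: mult.assoc flip: exp_of_nat_mult)
    qed
    also have "exp (real n) * exp (2 * real n * ln (cmod z)) = exp (2 * real n * disc_potential z)"
      using False by (simp add: disc_potential_def algebra_simps flip: exp_add)
    finally show ?thesis .
  qed
  hence "(\<Sum>k\<le>n. (real n ^ k / fact k) * (cmod z ^ k)\<^sup>2) * exp (- (2 * real n * disc_potential z)) \<le>
      exp (2 * real n * disc_potential z) * exp (- (2 * real n * disc_potential z))"
    by (intro mult_right_mono) auto
  thus ?thesis by (simp add: weyl_weight_square sum_distrib_right flip: exp_add)
qed

lemma weyl_poly_upper:
  assumes "\<And>k. k \<le> n \<Longrightarrow> cmod (a k) \<le> B"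
  shows "cmod (poly (weyl_poly n a) z) \<le> sqrt (real n + 1) * B * exp (real n * disc_potential z)"
proof -
  have B0: "B \<ge> 0" using assms[of 0] norm_ge_zero[of "a 0"] by linarith
  have "cmod (poly (weyl_poly n a) z) \<le> (\<Sum>k\<le>n. cmod (complex_of_real (sqrt (real n ^ k / fact k)) * a k * z ^ k))"
    unfolding poly_weyl_poly by (rule norm_sum)
  also have "\<dots> = exp (real n * disc_potential z) * (\<Sum>k\<le>n. \<bar>weyl_weight n z k\<bar> * \<bar>cmod (a k)\<bar>)"
    unfolding sum_distrib_left
    by (intro sum.cong) (auto simp: weyl_weight_def norm_mult norm_power exp_minus field_simps)
  also have "\<dots> \<le> exp (real n * disc_potential z) * (L2_set (weyl_weight n z) {..n} * L2_set (\<lambda>k. cmod (a k)) {..n})"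
    by (intro mult_left_mono L2_set_mult_ineq) auto
  also have "\<dots> \<le> exp (real n * disc_potential z) * (1 * (sqrt (real n + 1) * B))"
  proof (intro mult_left_mono mult_mono)
    show "L2_set (weyl_weight n z) {..n} \<le> 1"
      unfolding L2_set_def using sum_weyl_weight_square[of n z] by simp
    have "(\<Sum>k\<le>n. (cmod (a k))\<^sup>2) \<le> (\<Sum>k\<le>n. B\<^sup>2)" using assms by (intro sum_mono power_mono) auto
    hence "L2_set (\<lambda>k. cmod (a k)) {..n} \<le> sqrt ((real n + 1) * B\<^sup>2)" unfolding L2_set_def by (simp add: add.commute)
    thus "L2_set (\<lambda>k. cmod (a k)) {..n} \<le> sqrt (real n + 1) * B" using B0 by (simp add: real_sqrt_mult)
  qed (auto simp: L2_set_nonneg)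
  finally show ?thesis by (simp add: mult_ac)
qed

lemma weyl_weight_Suc:
  "weyl_weight n z (Suc k) \<le> (sqrt (real n) * cmod z) * weyl_weight n z k"
proof -
  have "sqrt (real n ^ Suc k / fact (Suc k)) \<le> sqrt (real n * (real n ^ k / fact k))"
  proof (intro real_sqrt_le_mono)
    have "real n ^ Suc k / fact (Suc k) = (real n * (real n ^ k / fact k)) / (1 + real k)" by simp
    also have "\<dots> \<le> (real n * (real n ^ k / fact k)) / 1" by (intro divide_left_mono) auto
    finally show "real n ^ Suc k / fact (Suc k) \<le> real n * (real n ^ k / fact k)" by simp
  qed
  also have "\<dots> = sqrt (real n) * sqrt (real n ^ k / fact k)" by (simp only: real_sqrt_mult)
  finally have "sqrt (real n ^ Suc k / fact (Suc k)) * (cmod z ^ Suc k * exp (- (real n * disc_potential z))) \<le>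
     (sqrt (real n) * sqrt (real n ^ k / fact k)) * (cmod z ^ Suc k * exp (- (real n * disc_potential z)))"
    by (intro mult_right_mono) auto
  thus ?thesis by (simp add: weyl_weight_def mult_ac)
qed

lemma weyl_weight_0: "weyl_weight n z 0 \<le> exp (- (min (real n * (cmod z)\<^sup>2) (real n) / 2))"
proof -
  have "min (real n * (cmod z)\<^sup>2) (real n) / 2 \<le> real n * disc_potential z"
  proof (cases "cmod z \<le> 1")
    case False
    hence "real n * (1 / 2) \<le> real n * (1 / 2 + ln (cmod z))" by (intro mult_left_mono) auto
    thus ?thesis using False by (simp add: disc_potential_def min_def)
  qed (auto simp: disc_potential_def)
  thus ?thesis by (simp add: weyl_weight_def)
qed

lemma exp_one_le_power: "exp 1 \<le> ((real m + 1) / real m) ^ Suc m" if "m > 0"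
proof -
  have "1 - 1 / (real m + 1) \<le> exp (- (1 / (real m + 1)))"
    using exp_ge_add_one_self[of "- (1 / (real m + 1))"] by simp
  moreover have "1 - 1 / (real m + 1) = real m / (real m + 1)" by (simp add: field_simps)
  ultimately have "(real m / (real m + 1)) ^ Suc m \<le> exp (- (1 / (real m + 1))) ^ Suc m"
    by (intro power_mono) auto
  also have "\<dots> = exp (real (Suc m) * - (1 / (real m + 1)))" by (simp only: exp_of_nat_mult)
  also have "real (Suc m) * - (1 / (real m + 1)) = - 1" by (simp add: field_simps)
  finally have "inverse (inverse (exp 1)) \<le> inverse ((real m / (real m + 1)) ^ Suc m)"
    using that by (intro le_imp_inverse_le) (auto simp: exp_minus)
  thus ?thesis by (simp add: power_inverse[symmetric] del: power_Suc)
qed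

text \<open>The elementary half of Stirling's formula. Passing from \<open>m\<close> to \<open>m + 1\<close> multiplies the right-hand side by
\<open>(1 + 1/m)^m\<close>, and \<open>exp 1 \<le> (1 + 1/m)^(m + 1)\<close>.\<close>
lemma power_self_div_fact_ge: "exp (real k) / real (Suc k) \<le> real (Suc k) ^ Suc k / fact (Suc k)"
proof (induction k)
  case (Suc k)
  define m where "m = Suc k"
  have m: "m > 0" "real m > 0" by (auto simp: m_def)
  define q where "q = (real m + 1) / real m"
  have q: "q > 0" using m by (simp add: q_def)
  have "exp 1 / q \<le> q ^ Suc m / q"
    using exp_one_le_power[OF m(1)] q by (intro divide_right_mono) (auto simp: q_def)
  hence step: "exp 1 / q \<le> q ^ m" using q by simp
  have "exp (real (Suc k)) / real (Suc (Suc k)) = (exp (real k) / real m) * (exp 1 / q)"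
  proof -
    have "(exp (real k) / real m) * (exp 1 / q) = exp (real k) * exp 1 / (real m * q)" by simp
    also have "real m * q = real (Suc (Suc k))" using m by (simp add: q_def m_def)
    also have "exp (real k) * exp 1 = exp (real (Suc k))" by (simp add: exp_add)
    finally show ?thesis ..
  qed
  also have "\<dots> \<le> (real m ^ m / fact m) * q ^ m"
    using Suc step q m by (intro mult_mono) (auto simp: m_def)
  also have "\<dots> = (real m * q) ^ m / fact m" by (simp add: power_mult_distrib)
  also have "real m * q = real (Suc m)" using m by (simp add: q_def)
  also have "real (Suc m) ^ m / fact m = (real (Suc m) * real (Suc m) ^ m) / (real (Suc m) * fact m)"
    by (subst mult_divide_mult_cancel_left) auto
  also have "\<dots> = real (Suc (Suc k)) ^ Suc (Suc k) / fact (Suc (Suc k))"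
    by (simp only: m_def power_Suc fact_Suc)
  finally show ?case .
qed simp

text \<open>The largest weight is at \<open>k = \<lfloor>n |z|\<^sup>2\<rfloor>\<close>, the mode of the Poisson distribution, or at \<open>k = n\<close> outside the
unit disc.\<close>
lemma weyl_weight_top:
  assumes n: "n \<ge> 1" and z: "real n * (cmod z)\<^sup>2 \<ge> 1"
  shows "\<exists>K\<le>n. weyl_weight n z K \<ge> exp (- 1) / real n"
proof -
  define lam where "lam = real n * (cmod z)\<^sup>2"
  have lam: "lam \<ge> 1" using z by (simp add: lam_def)
  have "\<exists>K\<le>n. exp (- 2) / real n \<le> (weyl_weight n z K)\<^sup>2"
  proof (cases "cmod z \<le> 1")
    case True
    define K where "K = nat \<lfloor>lam\<rfloor>"
    have K1: "K \<ge> 1" using lam by (simp add: K_def le_nat_iff)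
    have K2: "real K \<le> lam" "lam \<le> real K + 1" using lam by (auto simp: K_def)
    have "lam \<le> real n"
      using mult_left_mono[of "(cmod z)\<^sup>2" 1 "real n"] True by (simp add: lam_def power_le_one)
    hence Kn: "K \<le> n" using K2(1) by linarith
    obtain k where k: "K = Suc k" using K1 by (cases K) auto
    have "exp (- 2) / real n \<le> exp (real k - lam) / real K"
      using K1 Kn K2 by (intro frac_le) (auto simp: k)
    also have "\<dots> = (exp (real k) / real K) * exp (- lam)" by (simp add: exp_diff exp_minus divide_inverse)
    also have "\<dots> \<le> (real K ^ K / fact K) * exp (- lam)"
      using power_self_div_fact_ge[of k] unfolding k by (intro mult_right_mono) auto
    also have "\<dots> \<le> (lam ^ K / fact K) * exp (- lam)"
      using K2 by (intro mult_right_mono divide_right_mono power_mono) auto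
    also have "\<dots> = (weyl_weight n z K)\<^sup>2"
      using True by (simp add: weyl_weight_square lam_def power_mult_distrib disc_potential_def power_mult[symmetric] mult.commute)
    finally show ?thesis using Kn by blast
  next
    case False
    hence z0: "cmod z > 0" by linarith
    obtain k where k: "n = Suc k" using n by (cases n) auto
    have "(cmod z ^ n)\<^sup>2 = exp (2 * real n * ln (cmod z))"
    proof -
      have "cmod z ^ n = exp (real n * ln (cmod z))" using z0 by (simp add: exp_of_nat_mult)
      thus ?thesis by (simp add: mult.assoc flip: exp_of_nat_mult)
    qed
    hence w: "(weyl_weight n z n)\<^sup>2 = (real n ^ n / fact n) * exp (- real n)"
      using False by (simp add: weyl_weight_square disc_potential_def mult.assoc algebra_simps flip: exp_add)
    have "exp (- 2) / real n \<le> exp (real k - real n) / real n"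
      by (intro divide_right_mono) (auto simp: k)
    also have "\<dots> = (exp (real k) / real n) * exp (- real n)" by (simp add: exp_diff exp_minus divide_inverse)
    also have "\<dots> \<le> (real n ^ n / fact n) * exp (- real n)"
      using power_self_div_fact_ge[of k] unfolding k by (intro mult_right_mono) auto
    finally show ?thesis using w by auto
  qed
  then obtain K where K: "K \<le> n" "exp (- 2) / real n \<le> (weyl_weight n z K)\<^sup>2" by blast
  have "(exp (- 1) / real n)\<^sup>2 = exp (- 2) / real n / real n"
    by (simp add: power_divide power2_eq_square flip: exp_add)
  also have "\<dots> \<le> exp (- 2) / real n / 1" using n by (intro divide_left_mono) auto
  also note K(2)
  finally have "(exp (- 1) / real n)\<^sup>2 \<le> (weyl_weight n z K)\<^sup>2" by simp
  hence "exp (- 1) / real n \<le> weyl_weight n z K"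
    by (rule power2_le_imp_le) (rule weyl_weight_nonneg)
  thus ?thesis using K(1) by blast
qed

text \<open>The hypothesis \<open>start\<close> puts the weight at \<open>k = 0\<close>, multiplied by \<open>r\<close>, below the precision \<open>t\<close>, and \<open>top\<close>
ensures that the largest weight leaves room for a chain of length \<open>J\<close>.\<close>
lemma (in prob_space) small_ball_weyl:
  fixes \<xi> :: "nat \<Rightarrow> 'a \<Rightarrow> complex"
  assumes indep: "indep_vars (\<lambda>_. borel) \<xi> UNIV"
    and ident: "\<And>k. distr M borel (\<xi> k) = distr M borel (\<xi> 0)"
    and rB: "0 < r" "r < B" and \<eta>: "0 \<le> \<eta>"
    and conc: "\<And>c. prob {\<omega> \<in> space M. \<xi> 0 \<omega> \<in> cball c r} \<le> \<eta>"
    and n: "n \<ge> 1" and z: "real n * (cmod z)\<^sup>2 \<ge> 1" and t: "t > 0"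
    and start: "r * exp (- (min (real n * (cmod z)\<^sup>2) (real n) / 2)) < t"
    and top: "(1 + B * (sqrt (real n) * cmod z) / r) ^ J * t \<le> r * (exp (- 1) / real n)"
  shows "prob {\<omega> \<in> space M. (\<forall>k\<le>n. cmod (\<xi> k \<omega>) \<le> B) \<and>
      cmod (poly (weyl_poly n (\<lambda>k. \<xi> k \<omega>)) z) \<le> t * exp (real n * disc_potential z)} \<le> \<eta> ^ J"
proof -
  have meas [measurable]: "\<xi> k \<in> borel_measurable M" for k
    using indep by (auto simp: indep_vars_def)
  define \<mu> where "\<mu> = distr M borel (\<xi> 0)"
  interpret concentration \<mu> r \<eta>
  proof (rule concentration.intro)
    show "prob_space \<mu>" unfolding \<mu>_def by (rule prob_space_distr) simp
    show "emeasure \<mu> (cball c r) \<le> ennreal \<eta>" for c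
    proof -
      have "emeasure \<mu> (cball c r) = emeasure M {\<omega> \<in> space M. \<xi> 0 \<omega> \<in> cball c r}"
        unfolding \<mu>_def by (subst emeasure_distr) (auto intro!: arg_cong[of _ _ "emeasure M"])
      thus ?thesis using conc[of c] \<eta> by (simp add: emeasure_eq_measure ennreal_le_iff)
    qed
  qed (use rB \<eta> in \<open>auto simp: \<mu>_def\<close>)
  \<comment> \<open>climb from the negligible weight at \<open>0\<close> to the largest one, at \<open>K\<close>\<close>
  obtain K where K: "K \<le> n" "weyl_weight n z K \<ge> exp (- 1) / real n"
    using weyl_weight_top[OF n z] by blast
  have "\<exists>L. distinct L \<and> length L = J \<and> set L \<subseteq> {..K} \<and> lacunary t B r (map (weyl_weight n z) L)"
  proof (rule exists_lacunary[OF rB t, where s = "sqrt (real n) * cmod z"])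
    show "weyl_weight n z (Suc k) \<le> sqrt (real n) * cmod z * weyl_weight n z k" for k
      by (rule weyl_weight_Suc)
    have "r * weyl_weight n z 0 \<le> r * exp (- (min (real n * (cmod z)\<^sup>2) (real n) / 2))"
      using r by (intro mult_left_mono weyl_weight_0) auto
    thus "r * weyl_weight n z 0 < t" using start by simp
    have "r * (exp (- 1) / real n) \<le> r * weyl_weight n z K" using r K by (intro mult_left_mono) auto
    thus "(1 + B * (sqrt (real n) * cmod z) / r) ^ J * t \<le> r * weyl_weight n z K" using top by simp
  qed auto
  then obtain L where L: "distinct L" "length L = J" "set L \<subseteq> {..K}" "lacunary t B r (map (weyl_weight n z) L)"
    by blast
  define a where "a = (\<lambda>k. of_real (sqrt (real n ^ k / fact k) * exp (- (real n * disc_potential z))) * z ^ k)"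
  have a: "cmod \<circ> a = weyl_weight n z"
    by (auto simp: a_def weyl_weight_def norm_mult norm_power fun_eq_iff)
  have sub: "set L \<subseteq> {..n}" using L(3) K(1) by auto
  define E where "E = small_event a t B {..n} L 0"
  have E: "E \<in> sets (PiM {..n} (\<lambda>_. \<mu>))" unfolding E_def by (rule small_event_sets) (use sub in auto)
  have "emeasure (PiM (set L \<union> ({..n} - set L)) (\<lambda>_. \<mu>)) (small_event a t B (set L \<union> ({..n} - set L)) L 0) \<le> ennreal (\<eta> ^ length L)"
    by (rule small_ball_sum) (use L t in \<open>auto simp: a\<close>)
  moreover have "set L \<union> ({..n} - set L) = {..n}" using sub by auto
  ultimately have bound: "emeasure (PiM {..n} (\<lambda>_. \<mu>)) E \<le> ennreal (\<eta> ^ J)" using L(2) by (simp add: E_def)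
  define X where "X = (\<lambda>\<omega>. \<lambda>k\<in>{..n}. \<xi> k \<omega>)"
  have "distr M (PiM {..n} (\<lambda>_. borel)) X = PiM {..n} (\<lambda>k. distr M borel (\<xi> k))"
    unfolding X_def
    by (subst indep_vars_iff_distr_eq_PiM[symmetric]) (auto intro: indep_vars_subset[OF indep])
  moreover have "distr M borel (\<xi> k) = \<mu>" for k unfolding \<mu>_def by (rule ident)
  ultimately have dist: "distr M (PiM {..n} (\<lambda>_. borel)) X = PiM {..n} (\<lambda>_. \<mu>)"
    by simp
  have X [measurable]: "X \<in> measurable M (PiM {..n} (\<lambda>_. borel))"
    unfolding X_def by measurable
  have E': "E \<in> sets (PiM {..n} (\<lambda>_. borel))"
    using E by (simp add: dist[symmetric])
  have "{\<omega> \<in> space M. (\<forall>k\<le>n. cmod (\<xi> k \<omega>) \<le> B) \<and>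
      cmod (poly (weyl_poly n (\<lambda>k. \<xi> k \<omega>)) z) \<le> t * exp (real n * disc_potential z)} \<subseteq> X -` E \<inter> space M"
  proof safe
    fix \<omega> assume \<omega>: "\<omega> \<in> space M" "\<forall>k\<le>n. cmod (\<xi> k \<omega>) \<le> B"
      "cmod (poly (weyl_poly n (\<lambda>k. \<xi> k \<omega>)) z) \<le> t * exp (real n * disc_potential z)"
    have "(\<Sum>i\<le>n. a i * X \<omega> i) = of_real (exp (- (real n * disc_potential z))) * poly (weyl_poly n (\<lambda>k. \<xi> k \<omega>)) z"
      unfolding poly_weyl_poly sum_distrib_left by (intro sum.cong) (auto simp: a_def X_def)
    hence "cmod (\<Sum>i\<le>n. a i * X \<omega> i) = exp (- (real n * disc_potential z)) * cmod (poly (weyl_poly n (\<lambda>k. \<xi> k \<omega>)) z)"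
      by (simp add: norm_mult)
    also have "\<dots> \<le> exp (- (real n * disc_potential z)) * (t * exp (real n * disc_potential z))"
      using \<omega>(3) by (intro mult_left_mono) auto
    also have "\<dots> = t" by (simp add: exp_minus)
    finally have "cmod ((\<Sum>i\<le>n. a i * X \<omega> i) - 0) \<le> t" by simp
    moreover have "X \<omega> \<in> space (PiM {..n} (\<lambda>_. \<mu>))"
      using \<omega>(1) X by (simp add: dist[symmetric]) (rule measurable_space[OF X])
    moreover have "\<forall>i\<in>set L. cmod (X \<omega> i) \<le> B" using \<omega>(2) sub by (auto simp: X_def)
    ultimately show "\<omega> \<in> X -` E" by (simp add: E_def small_event_def)
  qed
  hence "emeasure M {\<omega> \<in> space M. (\<forall>k\<le>n. cmod (\<xi> k \<omega>) \<le> B) \<and>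
      cmod (poly (weyl_poly n (\<lambda>k. \<xi> k \<omega>)) z) \<le> t * exp (real n * disc_potential z)} \<le> emeasure M (X -` E \<inter> space M)"
    using measurable_sets[OF X E'] by (rule emeasure_mono)
  also have "\<dots> = emeasure (PiM {..n} (\<lambda>_. \<mu>)) E"
    unfolding dist[symmetric] using E' by (intro emeasure_distr[symmetric] X)
  also note bound
  finally show ?thesis using \<eta> by (simp add: emeasure_eq_measure ennreal_le_iff)
qed

text \<open>All parameters are powers of \<open>n\<close>, apart from \<open>t = exp (- n powr e)\<close> and the length \<open>J\<close> of the chain. The
latter is a multiple of \<open>ln n\<close> large enough for \<open>\<eta> ^ J\<close> to be a small power of \<open>n\<close>; then the total
growth along the chain is \<open>exp (O(ln\<^sup>2 n))\<close>, which \<open>t\<close> outweighs.\<close>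
lemma eventually_parameters:
  fixes e Q r \<eta> \<epsilon> :: real
  assumes e: "0 < e" "e \<le> 1 / 8" "e < \<epsilon>" and Q: "Q > 0" and r: "r > 0" and \<eta>: "0 < \<eta>" "\<eta> < 1"
  shows "\<forall>\<^sub>F n :: nat in sequentially. n \<ge> 1 \<and>
    real n powr (- 1 / 2 + e) \<le> 1 / 10 \<and>
    4 + 2 / real n powr (- 1 / 2 + e) \<le> real n \<and>
    r * exp (- (real n powr (2 * e) / 2)) < exp (- (real n powr e)) \<and>
    (\<exists>J. (1 + real n powr (Q + 2) * (sqrt (real n) * real n) / r) ^ J * exp (- (real n powr e)) \<le> r * (exp (- 1) / real n) \<and>
        \<eta> ^ J \<le> real n powr (- Q - 3)) \<and>
    r < real n powr (Q + 2) \<and>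
    sqrt (real n + 1) * real n powr (Q + 2) \<le> exp (real n powr (2 * e)) \<and>
    (real n + 1) / (real n powr (Q + 2))\<^sup>2 + 148 * real n * real n powr (- Q - 3) \<le> real n powr (- Q) \<and>
    2 * 10 ^ 6 * real n powr (- 1 / 2 + e) \<le> real n powr (- 1 / 2 + \<epsilon>)"
proof -
  define A where "A = (Q + 3) / (- ln \<eta>)"
  have A: "A > 0" using Q \<eta> by (simp add: A_def divide_pos_neg)
  have e': "e < 1 / 2" using e by simp
  have 1: "\<forall>\<^sub>F n :: nat in sequentially. n \<ge> 1" by (rule eventually_ge_at_top)
  have 2: "\<forall>\<^sub>F n :: nat in sequentially. real n powr (- 1 / 2 + e) \<le> 1 / 10"
    using e' by real_asymp
  have 3: "\<forall>\<^sub>F n :: nat in sequentially. 4 + 2 / real n powr (- 1 / 2 + e) \<le> real n"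
    using e e' by real_asymp
  have 4: "\<forall>\<^sub>F n :: nat in sequentially. r * exp (- (real n powr (2 * e) / 2)) < exp (- (real n powr e))"
    using e r by real_asymp
  have 5: "\<forall>\<^sub>F n :: nat in sequentially. 1 + real n powr (Q + 2) * (sqrt (real n) * real n) / r \<le> real n powr (Q + 5)"
    using Q r by real_asymp
  have 6: "\<forall>\<^sub>F n :: nat in sequentially. real n powr ((Q + 5) * (A * ln (real n) + 1)) * exp (- (real n powr e)) \<le> r * (exp (- 1) / real n)"
    using Q r e A by real_asymp
  have 7: "\<forall>\<^sub>F n :: nat in sequentially. r < real n powr (Q + 2)"
    using Q r by real_asymp
  have 8: "\<forall>\<^sub>F n :: nat in sequentially. sqrt (real n + 1) * real n powr (Q + 2) \<le> exp (real n powr (2 * e))"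
    using Q e by real_asymp
  have 9: "\<forall>\<^sub>F n :: nat in sequentially. (real n + 1) / (real n powr (Q + 2))\<^sup>2 + 148 * real n * real n powr (- Q - 3) \<le> real n powr (- Q)"
    using Q by real_asymp
  have 10: "\<forall>\<^sub>F n :: nat in sequentially. 2 * 10 ^ 6 * real n powr (- 1 / 2 + e) \<le> real n powr (- 1 / 2 + \<epsilon>)"
    using e by real_asymp
  show ?thesis
    using 1 2 3 4 5 6 7 8 9 10
  proof eventually_elim
    case (elim n)
    define J where "J = nat \<lceil>A * ln (real n)\<rceil>"
    have ln0: "ln (real n) \<ge> 0" using elim(1) by simp
    have J: "A * ln (real n) \<le> real J" "real J \<le> A * ln (real n) + 1"
      using A ln0 by (auto simp: J_def intro: real_nat_ceiling_ge)
    have n0: "real n > 0" using elim(1) by simp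
    have "(1 + real n powr (Q + 2) * (sqrt (real n) * real n) / r) ^ J \<le> (real n powr (Q + 5)) ^ J"
      using elim(5) r by (intro power_mono) auto
    also have "\<dots> = real n powr ((Q + 5) * real J)" using n0 by (simp add: powr_powr flip: powr_realpow)
    also have "\<dots> \<le> real n powr ((Q + 5) * (A * ln (real n) + 1))"
      using elim(1) J(2) Q by (intro powr_mono mult_left_mono) auto
    finally have "(1 + real n powr (Q + 2) * (sqrt (real n) * real n) / r) ^ J * exp (- (real n powr e)) \<le>
        real n powr ((Q + 5) * (A * ln (real n) + 1)) * exp (- (real n powr e))"
      by (intro mult_right_mono) auto
    also note elim(6)
    finally have g: "(1 + real n powr (Q + 2) * (sqrt (real n) * real n) / r) ^ J * exp (- (real n powr e)) \<le> r * (exp (- 1) / real n)" .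
    have "\<eta> ^ J = exp (real J * ln \<eta>)" using \<eta> by (simp add: exp_of_nat_mult)
    also have "real J * ln \<eta> \<le> (A * ln (real n)) * ln \<eta>" using J(1) \<eta> by (intro mult_right_mono_neg) auto
    also have "(A * ln (real n)) * ln \<eta> = (- Q - 3) * ln (real n)"
    proof -
      have "ln \<eta> \<noteq> 0" using \<eta> by simp
      hence "A * ln \<eta> = - Q - 3" by (simp add: A_def field_simps)
      thus ?thesis by (metis mult.assoc mult.commute)
    qed
    also have "exp ((- Q - 3) * ln (real n)) = real n powr (- Q - 3)" using n0 by (simp add: powr_def)
    finally have h: "\<eta> ^ J \<le> real n powr (- Q - 3)" by simp
    show ?case using elim g h by blast
  qed
qed

section \<open>Test points and the theorem\<close>

lemma card_grid_ball:
  assumes "0 < \<rho>" "\<rho> \<le> 1"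
  shows "finite (grid \<rho> \<inter> cball 0 2)" "real (card (grid \<rho> \<inter> cball 0 2)) \<le> 36 / \<rho>\<^sup>2"
proof -
  have sub: "ball c (\<rho> / 2) \<subseteq> ball 0 3" if "c \<in> grid \<rho> \<inter> cball 0 2" for c
  proof
    fix w assume "w \<in> ball c (\<rho> / 2)"
    thus "w \<in> ball 0 3" using dist_triangle[of 0 w c] that assms by auto
  qed
  note * = card_grid_le_measure[of \<rho> "grid \<rho> \<inter> cball 0 2" "ball 0 3", OF assms(1) _ _ _ sub]
  show "finite (grid \<rho> \<inter> cball 0 2)" by (rule *(1)) auto
  have "real (card (grid \<rho> \<inter> cball 0 2)) * (pi * \<rho>\<^sup>2 / 4) \<le> measure lborel (ball (0::complex) 3)"
    by (rule *(2)) auto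
  thus "real (card (grid \<rho> \<inter> cball 0 2)) \<le> 36 / \<rho>\<^sup>2"
    using assms by (simp add: measure_ball_complex field_simps)
qed

text \<open>The points at which a lower bound for the polynomial is needed: the centres of inversion themselves, and the
preimages of the grid points under the four inversions.\<close>
definition test_points :: "real \<Rightarrow> complex set" where
  "test_points \<rho> = poles \<union> (\<Union>p\<in>poles. (\<lambda>c. p + 1 / c) ` (grid \<rho> \<inter> cball 0 2))"

lemma finite_test_points:
  assumes "0 < \<rho>" "\<rho> \<le> 1"
  shows "finite (test_points \<rho>)" "real (card (test_points \<rho>)) \<le> 148 / \<rho>\<^sup>2"
proof -
  let ?G = "grid \<rho> \<inter> cball 0 2"
  note G = card_grid_ball[OF assms]
  have fp: "finite poles" by (simp add: poles_def)
  have cp: "card poles \<le> 4" unfolding poles_def by (rule card_insert_le_m1; simp?)+ 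
  show "finite (test_points \<rho>)" unfolding test_points_def using fp G(1) by auto
  have "card (\<Union>p\<in>poles. (\<lambda>c. p + 1 / c) ` ?G) \<le> (\<Sum>p\<in>poles. card ((\<lambda>c. p + 1 / c) ` ?G))"
    by (rule card_UN_le[OF fp])
  also have "\<dots> \<le> (\<Sum>p\<in>poles. card ?G)" by (intro sum_mono card_image_le G)
  also have "\<dots> \<le> 4 * card ?G" using cp by simp
  finally have "card (test_points \<rho>) \<le> 4 + 4 * card ?G"
    unfolding test_points_def using cp card_Un_le[of poles "\<Union>p\<in>poles. (\<lambda>c. p + 1 / c) ` ?G"] by linarith
  hence "real (card (test_points \<rho>)) \<le> 4 + 4 * real (card ?G)" by (simp flip: of_nat_le_iff)
  also have "\<dots> \<le> 4 / \<rho>\<^sup>2 + 4 * (36 / \<rho>\<^sup>2)"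
    using G(2) assms by (intro add_mono mult_left_mono) (auto simp: le_divide_eq power_le_one)
  finally show "real (card (test_points \<rho>)) \<le> 148 / \<rho>\<^sup>2" by simp
qed

text \<open>With \<open>z = p (c + 1/p) / c\<close> the lower bound reduces to the distance of \<open>c\<close> from \<open>- 1/p\<close>, which lies on one of
the coordinate axes.\<close>
lemma test_points_norm:
  assumes \<rho>: "0 < \<rho>" "\<rho> \<le> 1" and z: "z \<in> test_points \<rho>"
  shows "\<rho> \<le> cmod z" "cmod z \<le> 4 + 2 / \<rho>"
proof -
  have "\<rho> \<le> cmod z \<and> cmod z \<le> 4 + 2 / \<rho>"
  proof (cases "z \<in> poles")
    case True
    thus ?thesis using poles_norm[OF True] \<rho> by simp
  next
    case False
    then obtain p c where pc: "p \<in> poles" "c \<in> grid \<rho>" "cmod c \<le> 2" "z = p + 1 / c"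
      using z by (auto simp: test_points_def)
    have c: "\<rho> / 2 \<le> \<bar>Re c\<bar>" "\<rho> / 2 \<le> \<bar>Im c\<bar>" using grid_abs_ge[OF \<rho>(1) pc(2)] by auto
    have cn: "\<rho> / 2 \<le> cmod c" using c(1) abs_Re_le_cmod[of c] by linarith
    hence c0: "c \<noteq> 0" "cmod c > 0" using \<rho> by auto
    have p0: "p \<noteq> 0" "cmod p = 4" using poles_norm[OF pc(1)] by auto
    have "\<rho> / 2 \<le> cmod (c + 1 / p)"
    proof -
      have "Re (1 / p) = 0 \<or> Im (1 / p) = 0" using poles_axis[OF pc(1)] by (auto simp: Re_divide Im_divide)
      thus ?thesis using c abs_Re_le_cmod[of "c + 1 / p"] abs_Im_le_cmod[of "c + 1 / p"] by auto
    qed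
    moreover have "z = p * (c + 1 / p) / c" using c0 p0 by (simp add: pc(4) field_simps)
    hence "cmod z = 4 * cmod (c + 1 / p) / cmod c" using p0 by (simp only: norm_mult norm_divide)
    ultimately have "4 * (\<rho> / 2) / 2 \<le> cmod z"
      using pc(3) c0(2) \<rho> by (simp only:) (intro frac_le mult_left_mono; simp)
    moreover have "cmod z \<le> cmod p + cmod (1 / c)" unfolding pc(4) by (rule norm_triangle_ineq)
    moreover have "cmod (1 / c) \<le> 1 / (\<rho> / 2)" using cn \<rho> c0 by (simp only: norm_divide norm_one) (intro divide_left_mono; simp)
    ultimately show ?thesis using p0 by simp
  qed
  thus "\<rho> \<le> cmod z" "cmod z \<le> 4 + 2 / \<rho>" by auto
qed

lemma degree_weyl_poly:
  assumes "a n \<noteq> 0"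
  shows "degree (weyl_poly n a) = n"
proof (rule antisym)
  have coeff: "coeff (weyl_poly n a) k = (if k \<le> n then of_real (sqrt (real n ^ k / fact k)) * a k else 0)" for k
    by (simp add: weyl_poly_def coeff_sum if_distrib[of "\<lambda>x. x k"] sum.delta)
  show "degree (weyl_poly n a) \<le> n" by (rule degree_le) (simp add: coeff)
  have "coeff (weyl_poly n a) n \<noteq> 0" unfolding coeff using assms by auto
  thus "n \<le> degree (weyl_poly n a)" by (rule le_degree)
qed

text \<open>The choice \<open>M = n \<rho>\<^sup>2\<close> balances the two terms of the discrepancy bound.\<close>
lemma weyl_discrepancy_bound:
  fixes a :: "nat \<Rightarrow> complex"
  assumes n: "n \<ge> 1" and \<rho>: "0 < \<rho>" "\<rho> \<le> 1 / 10" and lead: "a n \<noteq> 0"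
    and coeffs: "\<And>k. k \<le> n \<Longrightarrow> cmod (a k) \<le> B" and B: "sqrt (real n + 1) * B \<le> exp (real n * \<rho>\<^sup>2)"
    and t: "exp (- (real n * \<rho>\<^sup>2)) \<le> t"
    and low: "\<And>z. z \<in> test_points \<rho> \<Longrightarrow> t * exp (real n * disc_potential z) < cmod (poly (weyl_poly n a) z)"
  shows "disc_discrepancy (zeros_measure n (weyl_poly n a)) uniform_disc \<le> 2 * 10 ^ 6 * \<rho>"
proof -
  let ?M = "real n * \<rho>\<^sup>2"
  have low': "exp (- ?M + real n * disc_potential z) < cmod (poly (weyl_poly n a) z)" if z: "z \<in> test_points \<rho>" for z
  proof -
    have "exp (- ?M) * exp (real n * disc_potential z) \<le> t * exp (real n * disc_potential z)"
      using t by (intro mult_right_mono) auto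
    thus ?thesis using low[OF z] unfolding exp_add by linarith
  qed
  interpret controlled_poly "weyl_poly n a" n \<rho> ?M
  proof
    show "degree (weyl_poly n a) = n" by (rule degree_weyl_poly) (rule lead)
    show "cmod (poly (weyl_poly n a) z) \<le> exp (?M + real n * disc_potential z)" for z
    proof -
      have "cmod (poly (weyl_poly n a) z) \<le> sqrt (real n + 1) * B * exp (real n * disc_potential z)"
        by (rule weyl_poly_upper) (rule coeffs)
      also have "\<dots> \<le> exp ?M * exp (real n * disc_potential z)" by (intro mult_right_mono B) auto
      finally show ?thesis by (simp add: exp_add)
    qed
    show "poly (weyl_poly n a) p \<noteq> 0" if p: "p \<in> poles" for p
    proof
      assume "poly (weyl_poly n a) p = 0"
      moreover have "p \<in> test_points \<rho>" using p by (simp add: test_points_def)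
      ultimately show False using low'[of p] by simp
    qed
    show "exp (- ?M + real n * disc_potential (p + 1 / c)) \<le> cmod (poly (weyl_poly n a) (p + 1 / c))"
      if pc: "p \<in> poles" "c \<in> grid \<rho>" "cmod c \<le> 2" for p c
    proof -
      have "p + 1 / c \<in> test_points \<rho>"
        using pc unfolding test_points_def by (intro UnI2 UN_I[of p] imageI) auto
      thus ?thesis by (intro less_imp_le low')
    qed
  qed (use n \<rho> in auto)
  have "?M / (real n * \<rho>) = \<rho>" using n \<rho> by (simp add: power2_eq_square)
  thus ?thesis using discrepancy_bound by simp
qed

lemma (in prob_space) second_moment_tail:
  fixes X :: "'a \<Rightarrow> complex"
  assumes [measurable]: "X \<in> borel_measurable M"
    and X2: "(\<integral>\<^sup>+\<omega>. ennreal ((cmod (X \<omega>))\<^sup>2) \<partial>M) = 1" and B: "B > 0"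
  shows "prob {\<omega> \<in> space M. X \<omega> \<in> - cball 0 B} \<le> 1 / B\<^sup>2"
proof -
  let ?S = "{\<omega> \<in> space M. 1 \<le> ennreal (1 / B\<^sup>2) * ennreal ((cmod (X \<omega>))\<^sup>2)}"
  have "emeasure M ?S \<le> ennreal (1 / B\<^sup>2) * (\<integral>\<^sup>+\<omega>. ennreal ((cmod (X \<omega>))\<^sup>2) * indicator (space M) \<omega> \<partial>M)"
    by (rule nn_integral_Markov_inequality) auto
  also have "(\<integral>\<^sup>+\<omega>. ennreal ((cmod (X \<omega>))\<^sup>2) * indicator (space M) \<omega> \<partial>M) = 1"
    using X2 by (simp cong: nn_integral_cong)
  finally have "prob ?S \<le> 1 / B\<^sup>2"
    by (simp add: emeasure_eq_measure ennreal_le_iff)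
  moreover have "prob {\<omega> \<in> space M. X \<omega> \<in> - cball 0 B} \<le> prob ?S"
  proof (intro finite_measure_mono subsetI)
    fix \<omega> assume "\<omega> \<in> {\<omega> \<in> space M. X \<omega> \<in> - cball 0 B}"
    hence \<omega>: "\<omega> \<in> space M" "cmod (X \<omega>) > B" by auto
    hence "B\<^sup>2 \<le> (cmod (X \<omega>))\<^sup>2" using B by (intro power_mono) auto
    hence "1 \<le> ennreal ((1 / B\<^sup>2) * (cmod (X \<omega>))\<^sup>2)" using B by simp
    thus "\<omega> \<in> ?S" using \<omega> by (subst (asm) ennreal_mult) auto
  qed measurable
  ultimately show ?thesis by simp
qed

theorem theorem10:
  fixes M :: "'a measure" and \<xi> :: "nat \<Rightarrow> 'a \<Rightarrow> complex" and \<delta> \<delta>' :: real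
  assumes "prob_space M"
    and indep: "prob_space.indep_vars M (\<lambda>_. borel) \<xi> UNIV"
    and ident: "\<And>k. distr M borel (\<xi> k) = distr M borel (\<xi> 0)"
    and centered: "integrable M (\<xi> 0)" "integral\<^sup>L M (\<xi> 0) = 0"
    and variance: "(\<integral>\<^sup>+ \<omega>. ennreal ((cmod (\<xi> 0 \<omega>))\<^sup>2) \<partial>M) = 1"
    and moment: "\<delta>' > 0" "(\<integral>\<^sup>+ \<omega>. ennreal (cmod (\<xi> 0 \<omega>) powr (2 + \<delta>')) \<partial>M) < \<infinity>"
    and neg_moment: "\<delta> > 0"
      "(\<integral>\<^sup>+ \<omega>. (if \<xi> 0 \<omega> = 0 then \<infinity> else ennreal (cmod (1 / \<xi> 0 \<omega>) powr \<delta>)) \<partial>M) < \<infinity>"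
  shows "\<forall>\<epsilon>>0. \<forall>Q>0. \<forall>\<^sub>F n in sequentially.
    measure M {\<omega> \<in> space M.
        disc_discrepancy (zeros_measure n (weyl_poly n (\<lambda>k. \<xi> k \<omega>))) uniform_disc
          \<le> real n powr (- 1 / 2 + \<epsilon>)}
      \<ge> 1 - real n powr (- Q)"
proof (intro allI impI)
  fix \<epsilon> Q :: real assume \<epsilon>: "\<epsilon> > 0" and Q: "Q > 0"
  interpret prob_space M by fact
  have meas [measurable]: "\<xi> k \<in> borel_measurable M" for k
    using indep by (auto simp: indep_vars_def)
  have transfer: "prob {\<omega> \<in> space M. \<xi> k \<omega> \<in> A} = prob {\<omega> \<in> space M. \<xi> 0 \<omega> \<in> A}" if "A \<in> sets borel" for k A
  proof -
    have "measure (distr M borel (\<xi> k)) A = measure (distr M borel (\<xi> 0)) A" by (simp only: ident[of k])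
    thus ?thesis using that by (simp add: measure_distr vimage_def Int_def conj_commute)
  qed
  have nonzero0: "AE \<omega> in M. \<xi> 0 \<omega> \<noteq> 0"
  proof -
    have "AE \<omega> in M. (if \<xi> 0 \<omega> = 0 then \<infinity> else ennreal (cmod (1 / \<xi> 0 \<omega>) powr \<delta>)) \<noteq> \<infinity>"
      by (rule nn_integral_PInf_AE) (use neg_moment(2) in auto)
    thus ?thesis by eventually_elim (auto split: if_splits)
  qed
  have zero_prob: "prob {\<omega> \<in> space M. \<xi> k \<omega> \<in> {0}} = 0" for k
    using nonzero0 by (subst transfer) (auto intro!: prob_Collect_eq_0[THEN iffD2])
  have tail: "prob {\<omega> \<in> space M. \<not> cmod (\<xi> k \<omega>) \<le> B} \<le> 1 / B\<^sup>2" if B: "B > 0" for B k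
    using second_moment_tail[OF meas variance B] transfer[of "- cball 0 B" k] by simp
  have "\<not> (AE \<omega> in M. \<xi> 0 \<omega> = 0)"
  proof
    assume "AE \<omega> in M. \<xi> 0 \<omega> = 0"
    with nonzero0 have "AE \<omega> in M. False" by eventually_elim simp
    thus False by simp
  qed
  from centered_concentration[OF centered this]
  obtain r \<eta> where r: "0 < r" and \<eta>: "0 < \<eta>" "\<eta> < 1"
    and conc: "\<And>c. prob {\<omega> \<in> space M. \<xi> 0 \<omega> \<in> cball c r} \<le> \<eta>" by blast
  \<comment> \<open>the room between \<open>e\<close> and \<open>\<epsilon>\<close> absorbs the constant factors\<close>
  define e where "e = min \<epsilon> (1 / 4) / 2"
  have e: "0 < e" "e \<le> 1 / 8" "e < \<epsilon>" using \<epsilon> by (auto simp: e_def min_def)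
  show "\<forall>\<^sub>F n in sequentially. measure M {\<omega> \<in> space M.
        disc_discrepancy (zeros_measure n (weyl_poly n (\<lambda>k. \<xi> k \<omega>))) uniform_disc
          \<le> real n powr (- 1 / 2 + \<epsilon>)} \<ge> 1 - real n powr (- Q)"
    using eventually_parameters[OF e Q r \<eta>]
  proof eventually_elim
    case (elim n)
    define \<rho> where "\<rho> = real n powr (- 1 / 2 + e)"
    define B where "B = real n powr (Q + 2)"
    define t where "t = exp (- (real n powr e))"
    define Ma where "Ma = real n powr (2 * e)"
    obtain J where J: "(1 + B * (sqrt (real n) * real n) / r) ^ J * t \<le> r * (exp (- 1) / real n)"
      "\<eta> ^ J \<le> real n powr (- Q - 3)" using elim by (auto simp: B_def t_def)
    have n: "n \<ge> 1" using elim by blast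
    have \<rho>1: "\<rho> \<le> 1 / 10" using elim by (simp add: \<rho>_def)
    have \<rho>2: "4 + 2 / \<rho> \<le> real n" using elim by (simp add: \<rho>_def)
    have st: "r * exp (- (Ma / 2)) < t" using elim by (simp add: t_def Ma_def)
    have rB: "r < B" using elim by (simp add: B_def)
    have upM: "sqrt (real n + 1) * B \<le> exp Ma" using elim by (simp add: B_def Ma_def)
    have total: "(real n + 1) / B\<^sup>2 + 148 * real n * real n powr (- Q - 3) \<le> real n powr (- Q)"
      using elim by (simp add: B_def)
    have fin: "2 * 10 ^ 6 * \<rho> \<le> real n powr (- 1 / 2 + \<epsilon>)" using elim by (simp add: \<rho>_def)
    have \<rho>0: "\<rho> > 0" using n by (simp add: \<rho>_def)
    have B0: "B > 0" using n by (simp add: B_def)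
    have t0: "t > 0" by (simp add: t_def)
    have nMa: "real n * \<rho>\<^sup>2 = Ma"
    proof -
      have "real n * \<rho>\<^sup>2 = real n powr 1 * (real n powr (- 1 / 2 + e) * real n powr (- 1 / 2 + e))"
        using n by (simp add: \<rho>_def power2_eq_square)
      also have "\<dots> = Ma" unfolding Ma_def powr_add[symmetric] by simp
      finally show ?thesis .
    qed
    have Ma1: "Ma \<ge> 1" unfolding Ma_def using n e by (intro ge_one_powr_ge_zero) auto
    have Man: "Ma \<le> real n" unfolding Ma_def using n e powr_mono[of "2 * e" 1 "real n"] by simp
    have tMa: "exp (- Ma) \<le> t" unfolding t_def Ma_def using n e by (auto intro!: powr_mono)
    let ?f = "\<lambda>\<omega>. weyl_poly n (\<lambda>k. \<xi> k \<omega>)"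
    define S where "S = (\<lambda>z. {\<omega> \<in> space M. (\<forall>k\<le>n. cmod (\<xi> k \<omega>) \<le> B) \<and>
      cmod (poly (?f \<omega>) z) \<le> t * exp (real n * disc_potential z)})"
    define T where "T = (\<lambda>k. {\<omega> \<in> space M. \<not> cmod (\<xi> k \<omega>) \<le> B})"
    define N where "N = {\<omega> \<in> space M. \<xi> n \<omega> \<in> {0}}"
    \<comment> \<open>a large coefficient, a small value at a test point, or a vanishing leading coefficient\<close>
    define Bad where "Bad = (\<Union>k\<in>{..n}. T k) \<union> (\<Union>z\<in>test_points \<rho>. S z) \<union> N"
    have events [measurable]: "S z \<in> events" "T k \<in> events" "N \<in> events" for z k
      unfolding S_def T_def N_def poly_weyl_poly by measurable
    have ftp: "finite (test_points \<rho>)" "real (card (test_points \<rho>)) \<le> 148 / \<rho>\<^sup>2"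
      using finite_test_points[of \<rho>] \<rho>0 \<rho>1 by auto
    have Bad [measurable]: "Bad \<in> events"
      unfolding Bad_def using ftp(1) by (intro sets.Un sets.finite_UN) auto
    have S_le: "prob (S z) \<le> real n powr (- Q - 3)" if z: "z \<in> test_points \<rho>" for z
    proof -
      have zn: "\<rho> \<le> cmod z" "cmod z \<le> real n"
        using test_points_norm[OF \<rho>0 _ z] \<rho>1 \<rho>2 by auto
      have big: "Ma \<le> real n * (cmod z)\<^sup>2"
        unfolding nMa[symmetric] using zn \<rho>0 by (intro mult_left_mono power_mono) auto
      have "prob (S z) \<le> \<eta> ^ J"
        unfolding S_def
      proof (rule small_ball_weyl[OF indep ident r rB _ conc n _ t0])
        show "1 \<le> real n * (cmod z)\<^sup>2" using big Ma1 by linarith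
        have "r * exp (- (min (real n * (cmod z)\<^sup>2) (real n) / 2)) \<le> r * exp (- (Ma / 2))"
          using r big Man by (intro mult_left_mono) auto
        thus "r * exp (- (min (real n * (cmod z)\<^sup>2) (real n) / 2)) < t" using st by linarith
        have "(1 + B * (sqrt (real n) * cmod z) / r) ^ J * t \<le> (1 + B * (sqrt (real n) * real n) / r) ^ J * t"
          using zn B0 r t0 by (intro mult_right_mono power_mono add_left_mono divide_right_mono mult_left_mono) auto
        thus "(1 + B * (sqrt (real n) * cmod z) / r) ^ J * t \<le> r * (exp (- 1) / real n)" using J(1) by linarith
      qed (use \<eta> in auto)
      thus ?thesis using J(2) by linarith
    qed
    have "prob Bad \<le> prob (\<Union>k\<in>{..n}. T k) + prob (\<Union>z\<in>test_points \<rho>. S z) + prob N"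
      unfolding Bad_def using ftp(1)
      by (intro order_trans[OF measure_Un_le] add_right_mono measure_Un_le sets.Un sets.finite_UN) auto
    also have "prob (\<Union>k\<in>{..n}. T k) \<le> (\<Sum>k\<le>n. prob (T k))"
      by (intro finite_measure_subadditive_finite) auto
    also have "\<dots> \<le> (\<Sum>k\<le>n. 1 / B\<^sup>2)" unfolding T_def by (intro sum_mono tail B0)
    also have "\<dots> = (real n + 1) / B\<^sup>2" by (simp add: add.commute)
    also have "prob (\<Union>z\<in>test_points \<rho>. S z) \<le> (\<Sum>z\<in>test_points \<rho>. prob (S z))"
      using ftp(1) by (intro finite_measure_subadditive_finite) auto
    also have "\<dots> \<le> real (card (test_points \<rho>)) * real n powr (- Q - 3)"
      by (intro sum_bounded_above S_le)
    also have "\<dots> \<le> 148 * real n * real n powr (- Q - 3)"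
    proof (intro mult_right_mono)
      have "148 / \<rho>\<^sup>2 = 148 * real n / Ma" using n \<rho>0 by (simp flip: nMa)
      also have "\<dots> \<le> 148 * real n / 1" using Ma1 by (intro divide_left_mono) auto
      finally show "real (card (test_points \<rho>)) \<le> 148 * real n" using ftp(2) by simp
    qed auto
    also have "prob N = 0" unfolding N_def by (rule zero_prob)
    finally have PBad: "prob Bad \<le> real n powr (- Q)" using total by simp
    let ?Good = "{\<omega> \<in> space M. disc_discrepancy (zeros_measure n (?f \<omega>)) uniform_disc \<le> real n powr (- 1 / 2 + \<epsilon>)}"
    have Good: "?Good \<in> events" by (rule discrepancy_event_measurable) (rule meas)
    have "space M - Bad \<subseteq> ?Good"
    proof
      fix \<omega> assume "\<omega> \<in> space M - Bad"
      hence \<omega>: "\<omega> \<in> space M" "\<And>k. k \<le> n \<Longrightarrow> cmod (\<xi> k \<omega>) \<le> B" "\<xi> n \<omega> \<noteq> 0"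
        by (auto simp: Bad_def T_def N_def)
      have low: "t * exp (real n * disc_potential z) < cmod (poly (?f \<omega>) z)" if "z \<in> test_points \<rho>" for z
        using \<open>\<omega> \<in> space M - Bad\<close> \<omega> that by (auto simp: Bad_def S_def)
      have "disc_discrepancy (zeros_measure n (?f \<omega>)) uniform_disc \<le> 2 * 10 ^ 6 * \<rho>"
        by (rule weyl_discrepancy_bound) (use n \<rho>0 \<rho>1 \<omega>(2,3) upM tMa low in \<open>auto simp: nMa\<close>)
      thus "\<omega> \<in> ?Good" using \<omega>(1) fin by simp
    qed
    hence "prob (space M - Bad) \<le> prob ?Good" by (intro finite_measure_mono Good)
    thus ?case using PBad prob_compl[OF Bad] by simp
  qed
qed

end
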